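(* Let $G$ be a compact Hausdorff group and $X$ a complete operator space. Let $1\leq p<\infty$ and let $\nu\in M_{ac}(G,X)$ be a semivariation translation and inversion invariant vector measure with $\nu(G)\neq0$. If $f\in L^p(\nu)$ and $g\in L^q_w(\nu)$, $1\leq q\leq p'$, are such that the mapping $s\mapsto f(ts^{-1})g(s)$ belongs to $L^1(\nu)$ for $m_G$-almost every $t\in G$, then $f*^\nu g$ is Dunford $r$-integrable with $\|f*^\nu g\|_{L^r_w(G,X)}\leq\|f\|_{\nu,p}\|g\|_{\nu,q}\|\nu(G)\|^{-1/r}$, where $\frac1p+\frac1q=1+\frac1r$. In particular, if $g\in L^q(\nu)$, then $f*^\nu g$ is Pettis $r$-integrable.
   Context: $m_G$ is normalized Haar measure; $p'$ is the conjugate exponent of $p$; $X'$ is the dual of $X$ with closed unit ball $B_{X'}$. $M_{ac}(G,X)$: $\sigma$-additive $X$-valued vector measures $\nu$ on the Borel sets of $G$ with $\lim_{m_G(A)\to0}\nu(A)=0$. $\langle\nu,x'\rangle(A)=\langle\nu(A),x'\rangle$, with total variation $|\langle\nu,x'\rangle|$. $L^1_w(\nu)$: functions $f:G\to\mathbb{C}$ with $f\in L^1(|\langle\nu,x'\rangle|)$ for all $x'\in X'$, norm $\|f\|_\nu=\sup_{x'\in B_{X'}}\int_G|f|\,d|\langle\nu,x'\rangle|$. $L^1(\nu)$: those $f\in L_w^1(\nu)$ such that for each Borel $A$ there is a unique $\int_Af\,d\nu\in X$ with $\langle\int_Af\,d\nu,x'\rangle=\int_Af\,d\langle\nu,x'\rangle$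 for all $x'$. For $1\le p<\infty$, $f\in L^p(\nu)$ (resp. $L^p_w(\nu)$) iff $|f|^p\in L^1(\nu)$ (resp. $L^1_w(\nu)$), with norm $\|f\|_{\nu,p}=\||f|^p\|_\nu^{1/p}$. $L^\infty(\nu)=L^\infty_w(\nu)$: $\nu$-a.e. bounded functions with the $\nu$-essential supremum norm. For a homeomorphism $h:G\to G$, $\nu_h(A)=\nu(h(A))$; for a simple function $\phi$, $\nu_\phi(A)=\int_A\phi\,d\nu$; for a vector measure $\mu$, $\|\mu\|=\sup_{x'\in B_{X'}}|\langle\mu,x'\rangle|(G)$. $\nu$ is semivariation $h$-invariant if $\|(\nu_h)_\phi\|=\|\nu_\phi\|$ for all complex simple $\phi$. Translation (resp. inversion) invariance means this for $h=\tau_t$, $\tau_t(s)=st$, for all $t\in G$ (resp. $h(t)=t^{-1}$). The vector-valued convolution is $f*^\nu g(t)=\int_Gf(ts^{-1})g(s)\,d\nu(s)\in X$, for $m_G$-a.e. $t$. A function $F:G\to X$ is Dunford $r$-integrable if $\langle F,x'\rangle\in L^r(G)$ for all $x'\in X'$, with norm $\|F\|_{L^r_w(G,X)}=\sup_{x'\in B_{X'}}\|\langle F,x'\rangle\|_r$; it is Pettis $r$-integrable if moreover for each Borel $A$ there is a unique $x_A\in X$ with $\int_A\langle F,x'\rangle\,dm_G=\langle x_A,x'\rangle$ for all $x'\in X'$. The same definitions are used for $r=\infty$ (the case $q=p'$), with $1/\infty=0$. *)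

theory Defs
  imports "HOL-Analysis.Analysis" "HOL-Probability.Essential_Supremum"
begin

section \<open>Operator spaces\<close>

class complex_normed_vector = real_normed_vector +
  fixes scaleC :: "complex \<Rightarrow> 'a \<Rightarrow> 'a" (infixr "*\<^sub>C" 75)
  assumes scaleC_add_right: "c *\<^sub>C (x + y) = c *\<^sub>C x + c *\<^sub>C y"
    and scaleC_add_left: "(c + d) *\<^sub>C x = c *\<^sub>C x + d *\<^sub>C x"
    and scaleC_scaleC: "c *\<^sub>C d *\<^sub>C x = (c * d) *\<^sub>C x"
    and scaleC_of_real: "complex_of_real a *\<^sub>C x = a *\<^sub>R x"
    and norm_scaleC: "norm (c *\<^sub>C x) = cmod c * norm x"

text \<open>An \<open>n \<times> m\<close> matrix is a function of two indices of which only the entries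
  \<open>a i j\<close> with \<open>i < n\<close>, \<open>j < m\<close> matter. For scalar matrices, \<open>mat_opnorm n m\<close> is the norm as an
  operator between the Hilbert spaces \<open>\<complex>\<^sup>m\<close> and \<open>\<complex>\<^sup>n\<close>.\<close>

definition mat_opnorm :: "nat \<Rightarrow> nat \<Rightarrow> (nat \<Rightarrow> nat \<Rightarrow> complex) \<Rightarrow> real" where
  "mat_opnorm n m a =
     (SUP v\<in>{v :: nat \<Rightarrow> complex. (\<Sum>j<m. (cmod (v j))\<^sup>2) \<le> 1}.
        sqrt (\<Sum>i<n. (cmod (\<Sum>j<m. a i j * v j))\<^sup>2))"

text \<open>Abstract operator spaces in the sense of Ruan: \<open>matrix_norm n\<close> is a norm on the
  \<open>n \<times> n\<close> matrices over the space. A complete operator space is a type of sort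
  \<open>{operator_space, banach}\<close>.\<close>

class operator_space = complex_normed_vector +
  fixes matrix_norm :: "nat \<Rightarrow> (nat \<Rightarrow> nat \<Rightarrow> 'a) \<Rightarrow> real"
  assumes matrix_norm_cong:
      "(\<And>i j. i < n \<Longrightarrow> j < n \<Longrightarrow> v i j = w i j) \<Longrightarrow> matrix_norm n v = matrix_norm n w"
    and matrix_norm_eq_0_iff: "matrix_norm n v = 0 \<longleftrightarrow> (\<forall>i<n. \<forall>j<n. v i j = 0)"
    and matrix_norm_triangle:
      "matrix_norm n (\<lambda>i j. v i j + w i j) \<le> matrix_norm n v + matrix_norm n w"
    and matrix_norm_scaleC: "matrix_norm n (\<lambda>i j. c *\<^sub>C v i j) = cmod c * matrix_norm n v"
    and matrix_norm_1: "matrix_norm 1 v = norm (v 0 0)"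
    and matrix_norm_direct_sum:
      "matrix_norm (m + n)
         (\<lambda>i j. if i < m \<and> j < m then v i j
                else if m \<le> i \<and> m \<le> j then w (i - m) (j - m) else 0)
       = max (matrix_norm m v) (matrix_norm n w)"
    and matrix_norm_bimodule:
      "matrix_norm n (\<lambda>i j. \<Sum>k<m. \<Sum>l<m. (a i k * b l j) *\<^sub>C v k l)
       \<le> mat_opnorm n m a * matrix_norm m v * mat_opnorm m n b"

definition dual :: "('x::complex_normed_vector \<Rightarrow> complex) set" where
  "dual = {x'. bounded_linear x' \<and> (\<forall>c x. x' (c *\<^sub>C x) = c * x' x)}"

definition dual_ball :: "('x::complex_normed_vector \<Rightarrow> complex) set" where
  "dual_ball = {x' \<in> dual. onorm x' \<le> 1}"


section \<open>Haar measure\<close>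

text \<open>Groups are written additively, following the class \<^class>\<open>topological_group_add\<close>, which
  does not include commutativity: \<open>s + t\<close> stands for \<open>st\<close>, \<open>- t\<close> for \<open>t\<^sup>-\<^sup>1\<close> and
  \<open>t - s\<close> (i.e. \<open>t + (- s)\<close>) for \<open>ts\<^sup>-\<^sup>1\<close>.\<close>

definition normalized_haar :: "'g::topological_group_add measure \<Rightarrow> bool" where
  "normalized_haar m \<longleftrightarrow>
     sets m = sets borel \<and>
     emeasure m UNIV = 1 \<and>
     (\<forall>t. \<forall>A\<in>sets borel. emeasure m ((+) t ` A) = emeasure m A) \<and>
     (\<forall>A\<in>sets borel. emeasure m A = (INF U\<in>{U. open U \<and> A \<subseteq> U}. emeasure m U)) \<and>
     (\<forall>A\<in>sets borel. emeasure m A = (SUP K\<in>{K. compact K \<and> K \<subseteq> A}. emeasure m K))"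


section \<open>Integration with respect to a complex measure\<close>

text \<open>Real and complex measures are set functions, considered on Borel sets only. For a
  \<open>\<sigma>\<close>-additive \<open>\<mu>\<close>, the set functions below passed to \<^const>\<open>measure_of\<close> are measures,
  so \<^const>\<open>measure_of\<close> does not fall back to the zero measure.\<close>

definition total_variation ::
    "('g::topological_space set \<Rightarrow> complex) \<Rightarrow> 'g set \<Rightarrow> ennreal" where
  "total_variation \<mu> A =
     (SUP P\<in>{P. finite P \<and> disjoint P \<and> P \<subseteq> sets borel \<and> \<Union>P = A}. \<Sum>E\<in>P. ennreal (cmod (\<mu> E)))"

definition tv_measure :: "('g::topological_space set \<Rightarrow> complex) \<Rightarrow> 'g measure" where
  "tv_measure \<mu> = measure_of UNIV (sets borel) (total_variation \<mu>)"

text \<open>The positive part of the Jordan decomposition of a real measure; its negative part is the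
  positive part of \<open>- \<rho>\<close>. Note that \<^const>\<open>ennreal\<close> truncates negative reals to \<open>0\<close>.\<close>

definition jordan_pos :: "('g::topological_space set \<Rightarrow> real) \<Rightarrow> 'g measure" where
  "jordan_pos \<rho> = measure_of UNIV (sets borel)
     (\<lambda>A. SUP B\<in>{B \<in> sets borel. B \<subseteq> A}. ennreal (\<rho> B))"

definition real_measure_integral ::
    "('g::topological_space set \<Rightarrow> real) \<Rightarrow> 'g set \<Rightarrow> ('g \<Rightarrow> complex) \<Rightarrow> complex" where
  "real_measure_integral \<rho> A f =
     set_lebesgue_integral (jordan_pos \<rho>) A f - set_lebesgue_integral (jordan_pos (\<lambda>B. - \<rho> B)) A f"

definition complex_measure_integral ::
    "('g::topological_space set \<Rightarrow> complex) \<Rightarrow> 'g set \<Rightarrow> ('g \<Rightarrow> complex) \<Rightarrow> complex" where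
  "complex_measure_integral \<mu> A f =
     real_measure_integral (\<lambda>B. Re (\<mu> B)) A f + \<i> * real_measure_integral (\<lambda>B. Im (\<mu> B)) A f"


section \<open>Vector measures\<close>

definition vector_measure ::
    "('g::topological_space set \<Rightarrow> 'x::real_normed_vector) \<Rightarrow> bool" where
  "vector_measure \<nu> \<longleftrightarrow>
     (\<forall>A. range A \<subseteq> sets borel \<and> disjoint_family A \<longrightarrow> (\<lambda>n::nat. \<nu> (A n)) sums \<nu> (\<Union>n. A n))"

definition M_ac ::
    "'g::topological_space measure \<Rightarrow> ('g set \<Rightarrow> 'x::real_normed_vector) set" where
  "M_ac m = {\<nu>. vector_measure \<nu> \<and>
     (\<forall>\<epsilon>>0. \<exists>\<delta>>0. \<forall>A\<in>sets borel. emeasure m A < ennreal \<delta> \<longrightarrow> norm (\<nu> A) < \<epsilon>)}"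

abbreviation pairing :: "('g set \<Rightarrow> 'x) \<Rightarrow> ('x \<Rightarrow> complex) \<Rightarrow> 'g set \<Rightarrow> complex" where
  "pairing \<nu> x' \<equiv> (\<lambda>A. x' (\<nu> A))"

text \<open>The total semivariation \<open>\<parallel>\<nu>\<parallel>\<close>.\<close>

definition semivariation ::
    "('g::topological_space set \<Rightarrow> 'x::complex_normed_vector) \<Rightarrow> ennreal" where
  "semivariation \<nu> = (SUP x'\<in>dual_ball. total_variation (pairing \<nu> x') UNIV)"

definition L1_weak ::
    "('g::topological_space set \<Rightarrow> 'x::complex_normed_vector) \<Rightarrow> ('g \<Rightarrow> complex) set" where
  "L1_weak \<nu> = {f \<in> borel_measurable borel. \<forall>x'\<in>dual. integrable (tv_measure (pairing \<nu> x')) f}"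

definition L1_norm ::
    "('g::topological_space set \<Rightarrow> 'x::complex_normed_vector) \<Rightarrow> ('g \<Rightarrow> complex) \<Rightarrow> ennreal" where
  "L1_norm \<nu> f = (SUP x'\<in>dual_ball. \<integral>\<^sup>+ s. ennreal (cmod (f s)) \<partial>tv_measure (pairing \<nu> x'))"

definition is_vm_integral ::
    "('g::topological_space set \<Rightarrow> 'x::complex_normed_vector) \<Rightarrow> 'g set \<Rightarrow> ('g \<Rightarrow> complex) \<Rightarrow> 'x \<Rightarrow> bool"
  where
  "is_vm_integral \<nu> A f x \<longleftrightarrow> (\<forall>x'\<in>dual. x' x = complex_measure_integral (pairing \<nu> x') A f)"

definition L1 ::
    "('g::topological_space set \<Rightarrow> 'x::complex_normed_vector) \<Rightarrow> ('g \<Rightarrow> complex) set" where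
  "L1 \<nu> = {f \<in> L1_weak \<nu>. \<forall>A\<in>sets borel. \<exists>!x. is_vm_integral \<nu> A f x}"

definition vm_integral ::
    "('g::topological_space set \<Rightarrow> 'x::complex_normed_vector) \<Rightarrow> 'g set \<Rightarrow> ('g \<Rightarrow> complex) \<Rightarrow> 'x" where
  "vm_integral \<nu> A f = (THE x. is_vm_integral \<nu> A f x)"

definition vm_null ::
    "('g::topological_space set \<Rightarrow> 'x::real_normed_vector) \<Rightarrow> 'g set \<Rightarrow> bool" where
  "vm_null \<nu> N \<longleftrightarrow> (\<exists>A\<in>sets borel. N \<subseteq> A \<and> (\<forall>B\<in>sets borel. B \<subseteq> A \<longrightarrow> \<nu> B = 0))"

text \<open>Used with exponents \<open>a > 0\<close> only.\<close>

definition ennreal_powr :: "ennreal \<Rightarrow> real \<Rightarrow> ennreal" where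
  "ennreal_powr x a = (if x = \<infinity> then \<infinity> else ennreal (enn2real x powr a))"

text \<open>Exponents are extended nonnegative reals, where \<open>1 / \<infinity> = 0\<close>.\<close>

definition Linf ::
    "('g::topological_space set \<Rightarrow> 'x::real_normed_vector) \<Rightarrow> ('g \<Rightarrow> complex) set" where
  "Linf \<nu> = {f \<in> borel_measurable borel. \<exists>c::real. vm_null \<nu> {s. c < cmod (f s)}}"

definition Lp_weak ::
    "ennreal \<Rightarrow> ('g::topological_space set \<Rightarrow> 'x::complex_normed_vector) \<Rightarrow> ('g \<Rightarrow> complex) set" where
  "Lp_weak p \<nu> =
     (if p = \<infinity> then Linf \<nu>
      else {f \<in> borel_measurable borel.
              (\<lambda>s. complex_of_real (cmod (f s) powr enn2real p)) \<in> L1_weak \<nu>})"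

definition Lp ::
    "ennreal \<Rightarrow> ('g::topological_space set \<Rightarrow> 'x::complex_normed_vector) \<Rightarrow> ('g \<Rightarrow> complex) set" where
  "Lp p \<nu> =
     (if p = \<infinity> then Linf \<nu>
      else {f \<in> borel_measurable borel.
              (\<lambda>s. complex_of_real (cmod (f s) powr enn2real p)) \<in> L1 \<nu>})"

definition Lp_norm ::
    "ennreal \<Rightarrow> ('g::topological_space set \<Rightarrow> 'x::complex_normed_vector) \<Rightarrow> ('g \<Rightarrow> complex) \<Rightarrow> ennreal"
  where
  "Lp_norm p \<nu> f =
     (if p = \<infinity> then Inf {c. vm_null \<nu> {s. c < ennreal (cmod (f s))}}
      else ennreal_powr (L1_norm \<nu> (\<lambda>s. complex_of_real (cmod (f s) powr enn2real p))) (enn2real (1 / p)))"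


section \<open>Invariance\<close>

definition vm_transport :: "('g \<Rightarrow> 'g) \<Rightarrow> ('g set \<Rightarrow> 'x) \<Rightarrow> 'g set \<Rightarrow> 'x" where
  "vm_transport h \<nu> A = \<nu> (h ` A)"

definition vm_density ::
    "('g::topological_space \<Rightarrow> complex) \<Rightarrow> ('g set \<Rightarrow> 'x::complex_normed_vector) \<Rightarrow> 'g set \<Rightarrow> 'x" where
  "vm_density \<phi> \<nu> A = vm_integral \<nu> A \<phi>"

definition semivariation_invariant ::
    "('g::topological_space \<Rightarrow> 'g) \<Rightarrow> ('g set \<Rightarrow> 'x::complex_normed_vector) \<Rightarrow> bool" where
  "semivariation_invariant h \<nu> \<longleftrightarrow>
     (\<forall>\<phi> :: 'g \<Rightarrow> complex. simple_function borel \<phi> \<longrightarrow>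
        semivariation (vm_density \<phi> (vm_transport h \<nu>)) = semivariation (vm_density \<phi> \<nu>))"

definition semivariation_translation_invariant ::
    "('g::topological_group_add set \<Rightarrow> 'x::complex_normed_vector) \<Rightarrow> bool" where
  "semivariation_translation_invariant \<nu> \<longleftrightarrow> (\<forall>t. semivariation_invariant (\<lambda>s. s + t) \<nu>)"

definition semivariation_inversion_invariant ::
    "('g::topological_group_add set \<Rightarrow> 'x::complex_normed_vector) \<Rightarrow> bool" where
  "semivariation_inversion_invariant \<nu> \<longleftrightarrow> semivariation_invariant (\<lambda>t. - t) \<nu>"


section \<open>Convolution and Dunford/Pettis integrability\<close>

text \<open>At points \<open>t\<close> where \<open>s \<mapsto> f(ts\<^sup>-\<^sup>1)g(s)\<close> is not in \<open>L\<^sup>1(\<nu>)\<close> the value is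
  irrelevant. As the exceptional null set need not be Borel, the spaces \<open>L\<^sup>r(G)\<close> below are those of
  the completion of Haar measure.\<close>

definition vconv ::
    "('g::topological_group_add set \<Rightarrow> 'x::complex_normed_vector) \<Rightarrow>
     ('g \<Rightarrow> complex) \<Rightarrow> ('g \<Rightarrow> complex) \<Rightarrow> 'g \<Rightarrow> 'x" where
  "vconv \<nu> f g t = vm_integral \<nu> UNIV (\<lambda>s. f (t - s) * g s)"

definition scalar_Lr_norm :: "'g measure \<Rightarrow> ennreal \<Rightarrow> ('g \<Rightarrow> complex) \<Rightarrow> ennreal" where
  "scalar_Lr_norm m r \<phi> =
     (if r = \<infinity> then esssup (completion m) (\<lambda>t. ennreal (cmod (\<phi> t)))
      else ennreal_powr (\<integral>\<^sup>+ t. ennreal (cmod (\<phi> t) powr enn2real r) \<partial>completion m) (enn2real (1 / r)))"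

definition scalar_Lr :: "'g measure \<Rightarrow> ennreal \<Rightarrow> ('g \<Rightarrow> complex) set" where
  "scalar_Lr m r = {\<phi> \<in> borel_measurable (completion m). scalar_Lr_norm m r \<phi> < \<infinity>}"

definition dunford_integrable ::
    "'g measure \<Rightarrow> ennreal \<Rightarrow> ('g \<Rightarrow> 'x::complex_normed_vector) \<Rightarrow> bool" where
  "dunford_integrable m r F \<longleftrightarrow> (\<forall>x'\<in>dual. (\<lambda>t. x' (F t)) \<in> scalar_Lr m r)"

definition dunford_norm ::
    "'g measure \<Rightarrow> ennreal \<Rightarrow> ('g \<Rightarrow> 'x::complex_normed_vector) \<Rightarrow> ennreal" where
  "dunford_norm m r F = (SUP x'\<in>dual_ball. scalar_Lr_norm m r (\<lambda>t. x' (F t)))"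

definition pettis_integrable ::
    "'g::topological_space measure \<Rightarrow> ennreal \<Rightarrow> ('g \<Rightarrow> 'x::complex_normed_vector) \<Rightarrow> bool" where
  "pettis_integrable m r F \<longleftrightarrow>
     dunford_integrable m r F \<and>
     (\<forall>A\<in>sets borel. \<exists>!x. \<forall>x'\<in>dual.
        set_lebesgue_integral (completion m) A (\<lambda>t. x' (F t)) = x' x)"

end

theory Submission
  imports Defs
begin

text \<open>Write \<open>\<mu>\<close> for the total variation of \<open>\<langle>\<nu>, x'\<rangle>\<close>, where \<open>x'\<close> lies in the dual ball. Away from a
  null set of points \<open>t\<close>, the value \<open>\<langle>(f * g)(t), x'\<rangle>\<close> is at most
  \<open>\<integral> \<bar>f (t - s)\<bar> \<bar>g s\<bar> d\<mu>(s)\<close>, so the norm estimate is Young's inequality with two different measures: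
  Haar measure \<open>m\<close> in \<open>t\<close> and \<open>\<mu>\<close> in \<open>s\<close>. With \<open>\<rho> = 1/r = 1/p + 1/q - 1\<close>, the three-factor Hoelder
  inequality for \<open>\<mu>\<close> bounds the integral by
  \<open>(\<integral> \<bar>f (t - s)\<bar>\<^sup>p \<bar>g s\<bar>\<^sup>q d\<mu>)\<^sup>\<rho>\<close> times \<open>(\<integral> \<bar>f (t - s)\<bar>\<^sup>p d\<mu>)\<close> to the power \<open>1/p - \<rho>\<close> times
  \<open>(\<integral> \<bar>g\<bar>\<^sup>q d\<mu>)\<close> to the power \<open>1/q - \<rho>\<close>
  (\<open>young_pointwise\<close>).

  Invariance of \<open>\<nu>\<close> enters twice. Semivariation invariance is an equality between suprema over the
  dual ball of integrals of simple functions; by monotone convergence it extends to all nonnegative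
  Borel functions (\<open>weak_integral_invariant\<close>), so that \<open>s \<mapsto> f (t - s)\<close> has the same \<open>L\<^sup>p(\<nu>)\<close> norm as
  \<open>f\<close>. This bounds the middle factor for every \<open>t\<close>. Second, integrating
  \<open>\<integral> u (t - s) d\<mu>(s)\<close> over \<open>t\<close> with Fubini and choosing \<open>x'\<close> norming for \<open>\<nu>(G)\<close> gives
  \<open>\<parallel>\<nu>(G)\<parallel> \<integral> u dm \<le> \<parallel>u\<parallel>\<^sub>\<nu>\<close> (\<open>haar_le_weak_integral\<close>). Applied to \<open>\<bar>f\<bar>\<^sup>p\<close> this bounds the integral of the first
  factor over \<open>t\<close> by \<open>\<parallel>f\<parallel>\<^sup>p \<parallel>g\<parallel>\<^sup>q / \<parallel>\<nu>(G)\<parallel>\<close>, and the powers combine to the stated constant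
  (\<open>convolution_Lr_bound\<close>, \<open>vconv_dunford\<close>). For \<open>q = \<infinity>\<close>, where \<open>p = 1\<close> and \<open>r = \<infinity>\<close>, the trivial
  estimate suffices (\<open>vconv_dunford_infinity\<close>).

  For Pettis integrability the integral of \<open>f * g\<close> over \<open>A\<close> is, by Fubini, the vector integral
  \<open>\<integral> g k d\<nu>\<close> with \<open>k s = \<integral>\<^sub>A f (t - s) dm(t)\<close>. As \<open>k\<close> is bounded, this integral exists: bounded
  functions are uniform limits of simple ones, and integrals of simple multiples of a function in
  \<open>L\<^sup>1(\<nu>)\<close> form a Cauchy sequence in \<open>X\<close> (\<open>bounded_mult_Lp_vm_integral\<close>, \<open>vconv_pettis\<close>).

  Two difficulties lie below this argument. The group need not be second countable, so \<open>f (t - s)\<close>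
  may fail to be measurable for the product \<open>\<sigma>\<close>-algebra; regularity of Haar measure provides an
  almost everywhere equal function for which it is (\<open>difference_measurable_ex\<close>), and absolute continuity
  of \<open>\<nu>\<close> makes the replacement harmless. Finiteness of the norms, which are suprema of finite integrals,
  comes from the uniform boundedness principle in the dual (\<open>weak_integral_finite\<close>), and the
  norming functionals come from the Hahn--Banach theorem (\<open>norming_functional\<close>).\<close>

section \<open>Norming functionals and uniform boundedness\<close>

definition sublinear :: "('a::real_vector \<Rightarrow> real) \<Rightarrow> bool" where
  "sublinear p \<longleftrightarrow> (\<forall>x y. p (x + y) \<le> p x + p y) \<and> (\<forall>t>0. \<forall>x. p (t *\<^sub>R x) \<le> t * p x)"

lemma sublinear_add: "sublinear p \<Longrightarrow> p (x + y) \<le> p x + p y"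
  by (simp add: sublinear_def)

lemma sublinear_scale: "sublinear p \<Longrightarrow> t > 0 \<Longrightarrow> p (t *\<^sub>R x) = t * p x"
proof -
  assume p: "sublinear p" and t: "t > 0"
  have "p x = p ((1/t) *\<^sub>R (t *\<^sub>R x))" using t by simp
  also have "\<dots> \<le> (1/t) * p (t *\<^sub>R x)" using p t unfolding sublinear_def by (metis divide_pos_pos zero_less_one)
  finally have "t * p x \<le> p (t *\<^sub>R x)" using t by (simp add: field_simps)
  moreover have "p (t *\<^sub>R x) \<le> t * p x" using p t unfolding sublinear_def by blast
  ultimately show ?thesis by simp
qed

lemma sublinear_zero: "sublinear p \<Longrightarrow> p 0 = 0"
  using sublinear_scale[of p 2 0] by simp

lemma sublinear_ge: "sublinear p \<Longrightarrow> - p (- x) \<le> p x"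
  using sublinear_add[of p x "- x"] sublinear_zero[of p] by simp

text \<open>For a minimal sublinear functional \<open>p\<close> this functional, which is sublinear and below \<open>p\<close>, equals
  \<open>p\<close>; that is the whole reason why minimal sublinear functionals are additive.\<close>

definition directional :: "('a::real_vector \<Rightarrow> real) \<Rightarrow> 'a \<Rightarrow> 'a \<Rightarrow> real" where
  "directional p x y = (INF t\<in>{0..}. p (y + t *\<^sub>R x) - t * p x)"

lemma directional_le:
  assumes p: "sublinear p" and t: "t \<ge> 0"
  shows "directional p x y \<le> p (y + t *\<^sub>R x) - t * p x"
proof -
  have "- p (- y) \<le> p (y + s *\<^sub>R x) - s * p x" if "s \<ge> 0" for s
  proof (cases "s = 0")
    case True then show ?thesis using sublinear_ge[OF p] by simp
  next
    case False
    have "s * p x = p ((y + s *\<^sub>R x) + (- y))" using sublinear_scale[OF p, of s x] False that by simp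
    also have "\<dots> \<le> p (y + s *\<^sub>R x) + p (- y)" by (rule sublinear_add[OF p])
    finally show ?thesis by simp
  qed
  then have "bdd_below ((\<lambda>t. p (y + t *\<^sub>R x) - t * p x) ` {0..})" by (intro bdd_belowI2) auto
  then show ?thesis unfolding directional_def using t by (intro cINF_lower) auto
qed

lemma directional_greatest:
  assumes "\<And>t. t \<ge> 0 \<Longrightarrow> c \<le> p (y + t *\<^sub>R x) - t * p x"
  shows "c \<le> directional p x y"
  unfolding directional_def using assms by (intro cINF_greatest) auto

lemma sublinear_directional:
  assumes p: "sublinear p" shows "sublinear (directional p x)"
  unfolding sublinear_def
proof (intro conjI allI impI)
  fix y z
  have "directional p x (y + z) - (p (z + t *\<^sub>R x) - t * p x) \<le> directional p x y" if t: "t \<ge> 0" for t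
  proof (rule directional_greatest)
    fix s :: real assume s: "s \<ge> 0"
    have "directional p x (y + z) \<le> p ((y + z) + (s + t) *\<^sub>R x) - (s + t) * p x"
      using s t by (intro directional_le[OF p]) auto
    also have "p ((y + z) + (s + t) *\<^sub>R x) \<le> p (y + s *\<^sub>R x) + p (z + t *\<^sub>R x)"
      using sublinear_add[OF p, of "y + s *\<^sub>R x" "z + t *\<^sub>R x"] by (simp add: algebra_simps)
    finally show "directional p x (y + z) - (p (z + t *\<^sub>R x) - t * p x) \<le> p (y + s *\<^sub>R x) - s * p x"
      by (simp add: algebra_simps)
  qed
  then have "directional p x (y + z) - directional p x y \<le> directional p x z"
    by (intro directional_greatest) (simp add: algebra_simps)
  then show "directional p x (y + z) \<le> directional p x y + directional p x z" by simp
next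
  fix t :: real and y assume t: "t > 0"
  have "directional p x (t *\<^sub>R y) / t \<le> directional p x y"
  proof (rule directional_greatest)
    fix s :: real assume s: "s \<ge> 0"
    have "directional p x (t *\<^sub>R y) \<le> p (t *\<^sub>R y + (t * s) *\<^sub>R x) - (t * s) * p x"
      using s t by (intro directional_le[OF p]) auto
    also have "p (t *\<^sub>R y + (t * s) *\<^sub>R x) = t * p (y + s *\<^sub>R x)"
      using sublinear_scale[OF p t, of "y + s *\<^sub>R x"] by (simp add: algebra_simps)
    finally show "directional p x (t *\<^sub>R y) / t \<le> p (y + s *\<^sub>R x) - s * p x"
      using t by (simp add: field_simps)
  qed
  then show "directional p x (t *\<^sub>R y) \<le> t * directional p x y" using t by (simp add: field_simps)
qed

lemma directional_le_self: "sublinear p \<Longrightarrow> directional p x y \<le> p y"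
  using directional_le[of p 0 x y] by simp

text \<open>Minimality gives \<open>p = directional p x \<le> p (\<cdot> + x) - p x\<close>, which is superadditivity.\<close>

lemma minimal_sublinear_additive:
  assumes p: "sublinear p" and min: "\<And>q. sublinear q \<Longrightarrow> (\<And>x. q x \<le> p x) \<Longrightarrow> q = p"
  shows "linear p"
proof -
  have add: "p (x + y) = p x + p y" for x y
  proof -
    have "directional p x = p" by (intro min sublinear_directional[OF p] directional_le_self[OF p])
    then have "p y \<le> p (y + x) - p x" using directional_le[OF p, of 1 x y] by simp
    with sublinear_add[OF p, of x y] show ?thesis by (simp add: add.commute)
  qed
  have neg: "p (- x) = - p x" for x using add[of x "-x"] sublinear_zero[OF p] by simp
  have "p (t *\<^sub>R x) = t * p x" for t x
  proof (cases t "0::real" rule: linorder_cases)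
    case less
    then have "p ((- t) *\<^sub>R x) = (- t) * p x" by (intro sublinear_scale[OF p]) auto
    then show ?thesis using neg[of "t *\<^sub>R x"] by simp
  next
    case equal then show ?thesis by (simp add: sublinear_zero[OF p])
  next
    case greater then show ?thesis by (rule sublinear_scale[OF p])
  qed
  with add show ?thesis by (intro linearI) auto
qed

text \<open>Zorn's lemma for the sublinear functionals below \<open>p\<close>. The pointwise infimum of a chain is
  finite because \<open>q y \<ge> - q (- y) \<ge> - p (- y)\<close>, and subadditive because any two members of the
  chain are comparable.\<close>

lemma linear_minorant_exists:
  assumes p: "sublinear p"
  obtains f where "linear f" "\<And>x. f x \<le> p x"
proof -
  define A where "A = {q. sublinear q \<and> q \<le> p}"
  define P where "P = (\<lambda>a b :: 'a \<Rightarrow> real. b \<le> a)"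
  have "\<exists>m\<in>A. \<forall>a\<in>A. P m a \<longrightarrow> a = m"
  proof (rule predicate_Zorn)
    show "partial_order_on A (relation_of P A)"
      unfolding P_def by (auto simp: partial_order_on_def preorder_on_def refl_on_def trans_def antisym_def relation_of_def)
  next
    fix C assume C: "C \<in> Chains (relation_of P A)"
    then have CA: "C \<subseteq> A" and ch: "\<And>a b. a \<in> C \<Longrightarrow> b \<in> C \<Longrightarrow> a \<le> b \<or> b \<le> a"
      unfolding Chains_def relation_of_def P_def by auto
    show "\<exists>u\<in>A. \<forall>a\<in>C. P a u"
    proof (cases "C = {}")
      case True then show ?thesis using p by (auto simp: A_def)
    next
      case False
      define u where "u = (\<lambda>y. INF q\<in>C. q y)"
      have "- p (- y) \<le> q y" if "q \<in> C" for q y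
      proof -
        have "sublinear q" "q \<le> p" using CA that by (auto simp: A_def)
        then show ?thesis using sublinear_ge[of q y] le_funD[of q p "- y"] by simp
      qed
      then have "bdd_below ((\<lambda>q. q y) ` C)" for y by (intro bdd_belowI2) auto
      then have u_le: "u y \<le> q y" if "q \<in> C" for q y unfolding u_def using that by (intro cINF_lower)
      have u_gr: "c \<le> u y" if "\<And>q. q \<in> C \<Longrightarrow> c \<le> q y" for c y
        unfolding u_def using that False by (intro cINF_greatest) auto
      have "sublinear u" unfolding sublinear_def
      proof (intro conjI allI impI)
        fix y z
        have *: "u (y + z) \<le> q y + r z" if qr: "q \<in> C" "r \<in> C" for q r
        proof -
          obtain s where s: "s \<in> C" "s \<le> q" "s \<le> r" using ch[OF qr] qr by blast
          then have "sublinear s" using CA by (auto simp: A_def)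
          have "u (y + z) \<le> s (y + z)" by (rule u_le[OF s(1)])
          also have "\<dots> \<le> s y + s z" by (rule sublinear_add[OF \<open>sublinear s\<close>])
          also have "\<dots> \<le> q y + r z" using s by (intro add_mono) (auto simp: le_fun_def)
          finally show ?thesis .
        qed
        have "u (y + z) - r z \<le> u y" if "r \<in> C" for r using *[OF _ that(1)] by (intro u_gr) (simp add: algebra_simps)
        then have "u (y + z) - u y \<le> u z" by (intro u_gr) (simp add: algebra_simps)
        then show "u (y + z) \<le> u y + u z" by simp
      next
        fix t :: real and y assume t: "t > 0"
        have "u (t *\<^sub>R y) / t \<le> q y" if "q \<in> C" for q
          using u_le[OF that, of "t *\<^sub>R y"] sublinear_scale[of q t y] that CA t by (auto simp: A_def field_simps)
        then have "u (t *\<^sub>R y) / t \<le> u y" by (rule u_gr)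
        then show "u (t *\<^sub>R y) \<le> t * u y" using t by (simp add: field_simps)
      qed
      moreover have "u \<le> p"
      proof -
        obtain q where q: "q \<in> C" using False by blast
        then have "q \<le> p" using CA by (auto simp: A_def)
        then show ?thesis using u_le[OF q] by (meson le_fun_def order_trans)
      qed
      ultimately have "u \<in> A" by (simp add: A_def)
      then show ?thesis using u_le by (intro bexI[of _ u]) (simp_all add: P_def le_fun_def)
    qed
  qed
  then obtain f where f: "f \<in> A" and m: "\<And>a. a \<in> A \<Longrightarrow> a \<le> f \<Longrightarrow> a = f" by (auto simp: P_def)
  have "linear f"
  proof (rule minimal_sublinear_additive)
    show "sublinear f" using f by (simp add: A_def)
    show "q = f" if "sublinear q" "\<And>x. q x \<le> f x" for q
      using that f by (intro m) (simp_all add: A_def le_fun_def, meson order_trans)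
  qed
  with f show ?thesis by (intro that[of f]) (auto simp: A_def le_fun_def)
qed

text \<open>A linear minorant of the directional functional at \<open>x\<^sub>0\<close>, instead of one of the norm itself, is at
  most \<open>- norm x\<^sub>0\<close> at \<open>- x\<^sub>0\<close>, hence at least \<open>norm x\<^sub>0\<close> at \<open>x\<^sub>0\<close>.\<close>

lemma real_norming_functional:
  fixes x\<^sub>0 :: "'a::real_normed_vector"
  obtains f where "linear f" "\<And>x. f x \<le> norm x" "f x\<^sub>0 = norm x\<^sub>0"
proof -
  have n: "sublinear (norm :: 'a \<Rightarrow> real)" by (auto simp: sublinear_def norm_triangle_ineq)
  obtain f where f: "linear f" "\<And>x. f x \<le> directional norm x\<^sub>0 x"
    using linear_minorant_exists[OF sublinear_directional[OF n]] by blast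
  have le: "f x \<le> norm x" for x using f(2)[of x] directional_le_self[OF n, of x\<^sub>0 x] by simp
  have "f (- x\<^sub>0) \<le> - norm x\<^sub>0" using f(2)[of "- x\<^sub>0"] directional_le[OF n, of 1 x\<^sub>0 "- x\<^sub>0"] by simp
  then have "f x\<^sub>0 = norm x\<^sub>0" using le[of x\<^sub>0] linear_neg[OF f(1), of x\<^sub>0] by simp
  then show ?thesis using that f(1) le by blast
qed

lemma scaleC_minus_one: "(-1) *\<^sub>C (x::'x::complex_normed_vector) = - x"
  using scaleC_of_real[of "-1" x] by simp

lemma scaleC_scaleR: "c *\<^sub>C (a *\<^sub>R (x::'x::complex_normed_vector)) = a *\<^sub>R (c *\<^sub>C x)"
  by (metis scaleC_of_real scaleC_scaleC mult.commute)

text \<open>The complex-linear functional with real part \<open>f\<close>.\<close>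

definition complexify :: "('x::complex_normed_vector \<Rightarrow> real) \<Rightarrow> 'x \<Rightarrow> complex" where
  "complexify f x = Complex (f x) (- f (\<i> *\<^sub>C x))"

lemma complexify_in_dual:
  assumes f: "linear f" and le: "\<And>x. \<bar>f x\<bar> \<le> K * norm x"
  shows "complexify f \<in> dual" "cmod (complexify f x) \<le> K * norm x"
proof -
  have add: "complexify f (x + y) = complexify f x + complexify f y" for x y
    by (simp add: complexify_def complex_eq_iff linear_add[OF f] scaleC_add_right)
  have i: "complexify f (\<i> *\<^sub>C x) = \<i> * complexify f x" for x
    by (simp add: complexify_def complex_eq_iff scaleC_scaleC scaleC_minus_one linear_neg[OF f])
  have r: "complexify f (a *\<^sub>R x) = a *\<^sub>R complexify f x" for a x
    by (simp add: complexify_def complex_eq_iff linear_scale[OF f] scaleC_scaleR)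
  have c: "complexify f (c *\<^sub>C x) = c * complexify f x" for c x
  proof -
    have "c *\<^sub>C x = (complex_of_real (Re c) + \<i> * complex_of_real (Im c)) *\<^sub>C x" by (rule arg_cong[OF complex_eq])
    also have "\<dots> = Re c *\<^sub>R x + \<i> *\<^sub>C (Im c *\<^sub>R x)"
      by (metis scaleC_add_left scaleC_scaleC scaleC_of_real)
    finally have "complexify f (c *\<^sub>C x) = Re c *\<^sub>R complexify f x + \<i> * (Im c *\<^sub>R complexify f x)"
      by (simp add: add i r)
    also have "\<dots> = c * complexify f x" by (simp add: scaleR_conv_of_real complex_eq_iff)
    finally show ?thesis .
  qed
  have bd: "cmod (complexify f x) \<le> K * norm x" for x
  proof (cases "complexify f x = 0")
    case True then show ?thesis using le[of x] by (simp add: order_trans[OF abs_ge_zero])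
  next
    case False
    \<comment> \<open>rotate the value to the positive real axis, where it is a value of \<open>f\<close>\<close>
    define u where "u = cnj (complexify f x) / cmod (complexify f x)"
    have u: "cmod u = 1" using False by (simp add: u_def norm_divide)
    have "complexify f (u *\<^sub>C x) = cmod (complexify f x)"
      using False unfolding c u_def
      by (simp add: complex_norm_square[symmetric] power2_eq_square field_simps)
    then have "cmod (complexify f x) = f (u *\<^sub>C x)" by (metis Re_complex_of_real complexify_def complex.sel(1))
    also have "\<dots> \<le> K * norm (u *\<^sub>C x)" using le[of "u *\<^sub>C x"] by simp
    finally show ?thesis using u by (simp add: norm_scaleC)
  qed
  then show "cmod (complexify f x) \<le> K * norm x" .
  have "bounded_linear (complexify f)"
    using bd by (intro bounded_linear_intro[of _ K] add r) (simp add: mult.commute)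
  then show "complexify f \<in> dual" using c by (simp add: dual_def)
qed

lemma norming_functional:
  fixes x\<^sub>0 :: "'x::complex_normed_vector"
  obtains x' where "x' \<in> dual_ball" "norm x\<^sub>0 \<le> cmod (x' x\<^sub>0)"
proof -
  obtain f where f: "linear f" "\<And>x. f x \<le> norm x" "f x\<^sub>0 = norm x\<^sub>0" by (rule real_norming_functional[of x\<^sub>0]) blast
  have "\<bar>f x\<bar> \<le> 1 * norm x" for x using f(2)[of x] f(2)[of "- x"] linear_neg[OF f(1), of x] by (simp add: abs_le_iff)
  note d = complexify_in_dual[OF f(1) this]
  have "complexify f \<in> dual_ball" using d by (auto simp: dual_ball_def intro!: onorm_bound)
  moreover have "norm x\<^sub>0 \<le> cmod (complexify f x\<^sub>0)" using abs_Re_le_cmod[of "complexify f x\<^sub>0"] f(3) by (simp add: complexify_def)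
  ultimately show ?thesis using that by blast
qed

lemma dual_bounded_linear: "x' \<in> dual \<Longrightarrow> bounded_linear x'" by (simp add: dual_def)

lemma dual_scaleC: "x' \<in> dual \<Longrightarrow> x' (c *\<^sub>C x) = c * x' x" by (simp add: dual_def)

lemma dual_ball_dual: "x' \<in> dual_ball \<Longrightarrow> x' \<in> dual" by (simp add: dual_ball_def)

lemma dual_ball_le: "x' \<in> dual_ball \<Longrightarrow> cmod (x' x) \<le> norm x"
  using onorm[of x' x] by (auto simp: dual_ball_def dual_def) (metis mult_right_mono norm_ge_zero mult_1 order_trans)

lemma dual_ballI: "x' \<in> dual \<Longrightarrow> (\<And>x. cmod (x' x) \<le> norm x) \<Longrightarrow> x' \<in> dual_ball"
  by (auto simp: dual_ball_def intro!: onorm_bound)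

lemma dual_separates:
  assumes "\<And>x'. x' \<in> dual \<Longrightarrow> x' x = x' y" shows "x = y"
proof -
  obtain x' where x': "x' \<in> dual_ball" "norm (x - y) \<le> cmod (x' (x - y))" by (rule norming_functional)
  have "x' (x - y) = 0"
    using assms[OF dual_ball_dual[OF x'(1)]] linear_diff[OF bounded_linear.linear[OF dual_bounded_linear[OF dual_ball_dual[OF x'(1)]]], of x y] by simp
  with x' show ?thesis by simp
qed


text \<open>A gliding hump argument that avoids Baire category. If the seminorms are unbounded on the unit
  ball, choose seminorms \<open>P (N k)\<close> of norm at least \<open>12\<^sup>k\<close> and move by successive steps of length
  at most \<open>3\<^sup>-\<^sup>k\<close>; since \<open>max (P (x + v)) (P (x - v)) \<ge> P v\<close>, each step can be chosen to make \<open>P (N k)\<close>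
  comparable to its norm times \<open>3\<^sup>-\<^sup>k\<close>. All later steps together have length at most half of
  \<open>3\<^sup>-\<^sup>k\<close> and cannot undo this, so at the limit point the seminorms are at least \<open>4\<^sup>k / 6\<close>.\<close>

lemma uniform_boundedness_seminorms:
  fixes P :: "nat \<Rightarrow> 'a::banach \<Rightarrow> real"
  assumes tri: "\<And>n x y. P n (x + y) \<le> P n x + P n y"
    and hom: "\<And>n c x. P n (c *\<^sub>R x) = \<bar>c\<bar> * P n x"
    and cont: "\<And>n. \<exists>K. \<forall>x. P n x \<le> K * norm x"
    and pw: "\<And>x. \<exists>K. \<forall>n. P n x \<le> K"
  shows "\<exists>K. \<forall>n x. norm x \<le> 1 \<longrightarrow> P n x \<le> K"
proof (rule ccontr)
  assume "\<not> ?thesis"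
  then have unb: "\<exists>n x. norm x \<le> 1 \<and> P n x > K" for K by (meson not_le)
  have P0: "P n 0 = 0" for n using hom[of n 0 0] by simp
  have Pneg: "P n (- x) = P n x" for n x using hom[of n "-1" x] by simp
  have Ppos: "0 \<le> P n x" for n x using tri[of n x "-x"] P0 Pneg by simp
  define K where "K n = (SUP x\<in>cball 0 1. P n x)" for n
  have bdd: "bdd_above (P n ` cball 0 1)" for n
  proof -
    obtain C where C: "\<And>x. P n x \<le> C * norm x" using cont[of n] by blast
    have "P n x \<le> \<bar>C\<bar>" if "norm x \<le> 1" for x
      using C[of x] that by (meson abs_ge_self mult_left_le mult_right_mono norm_ge_zero order_trans abs_ge_zero)
    then show ?thesis by (intro bdd_aboveI2) auto
  qed
  have K: "P n x \<le> K n * norm x" for n x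
  proof (cases "x = 0")
    case True then show ?thesis using P0 by simp
  next
    case False
    have "P n ((1 / norm x) *\<^sub>R x) \<le> K n" unfolding K_def by (rule cSUP_upper[OF _ bdd]) (use False in auto)
    then show ?thesis using False by (simp add: hom field_simps)
  qed
  have Kpos: "0 \<le> K n" for n
    unfolding K_def using cSUP_upper[OF _ bdd, of 0 n] P0 by simp
  have "\<exists>n. K n > 12 ^ k" for k :: nat
  proof -
    obtain n x where "norm x \<le> 1" "P n x > 12 ^ k" using unb by blast
    moreover have "P n x \<le> K n" unfolding K_def by (rule cSUP_upper[OF _ bdd]) (use \<open>norm x \<le> 1\<close> in auto)
    ultimately show ?thesis by (intro exI[of _ n]) simp
  qed
  then obtain N where N: "\<And>k. K (N k) > 12 ^ k" by metis
  have step: "\<exists>y. norm (y - x) \<le> (1/3) ^ k \<and> P (N k) y \<ge> 2/3 * (1/3) ^ k * K (N k)" for k x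
  proof -
    have pos: "K (N k) > 0" using N[of k] by (meson less_trans zero_less_power zero_less_numeral)
    have "\<exists>u\<in>cball 0 1. 2/3 * K (N k) < P (N k) u"
      using less_cSUP_iff[OF _ bdd, of "2/3 * K (N k)" "N k"] pos unfolding K_def by auto
    then obtain u where u: "norm u \<le> 1" "2/3 * K (N k) < P (N k) u" by auto
    define v where "v = ((1/3) ^ k) *\<^sub>R u"
    have nv: "norm v \<le> (1/3) ^ k" using u(1) by (simp add: v_def mult_left_le)
    have "P (N k) v = (1/3) ^ k * P (N k) u" by (simp add: v_def hom)
    then have Pv: "P (N k) v \<ge> 2/3 * (1/3) ^ k * K (N k)"
      using u(2) mult_left_mono[OF less_imp_le[OF u(2)], of "(1/3)^k"] by (simp add: mult.assoc mult.left_commute)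
    have "P (N k) (2 *\<^sub>R v) \<le> P (N k) (x + v) + P (N k) (- (x - v))"
      using tri[of "N k" "x + v" "- (x - v)"] by (simp add: scaleR_2)
    then have "2 * P (N k) v \<le> P (N k) (x + v) + P (N k) (x - v)" by (simp only: hom Pneg)
    then have "P (N k) v \<le> P (N k) (x + v) \<or> P (N k) v \<le> P (N k) (x - v)" by linarith
    then show ?thesis
    proof
      assume "P (N k) v \<le> P (N k) (x + v)" then show ?thesis using Pv nv by (intro exI[of _ "x + v"]) auto
    next
      assume "P (N k) v \<le> P (N k) (x - v)" then show ?thesis using Pv nv by (intro exI[of _ "x - v"]) auto
    qed
  qed
  define h where "h k x = (SOME y. norm (y - x) \<le> (1/3) ^ k \<and> P (N k) y \<ge> 2/3 * (1/3) ^ k * K (N k))" for k x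
  have h: "norm (h k x - x) \<le> (1/3) ^ k" "P (N k) (h k x) \<ge> 2/3 * (1/3) ^ k * K (N k)" for k x
    using someI_ex[OF step[where k = k and x = x]] unfolding h_def by blast+
  define X where "X = rec_nat 0 (\<lambda>k x. h k x)"
  have X: "X (Suc k) = h k (X k)" for k by (simp add: X_def)
  define a where "a k = X (Suc k) - X k" for k
  have na: "norm (a k) \<le> (1/3) ^ k" for k unfolding a_def X by (rule h)
  have summ: "summable a" by (rule summable_comparison_test'[where g = "\<lambda>k. (1/3::real)^k" and N = 0]) (use na in auto)
  define x where "x = suminf a"
  have X_sum: "X k = (\<Sum>i<k. a i)" for k
    by (induction k) (simp_all add: a_def X_def)
  have close: "norm (x - X (Suc k)) \<le> 1/2 * (1/3) ^ k" for k
  proof -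
    have "x - X (Suc k) = (\<Sum>i. a (i + Suc k))" unfolding x_def X_sum suminf_minus_initial_segment[OF summ] ..
    also have "norm \<dots> \<le> (\<Sum>i. (1/3) ^ (i + Suc k))"
    proof -
      have sg: "summable (\<lambda>i. (1/3::real) ^ (i + Suc k))" by (simp add: power_add summable_mult2)
      have sn: "summable (\<lambda>i. norm (a (i + Suc k)))"
        by (rule summable_comparison_test'[OF sg, where N = 0]) (simp only: real_norm_def abs_norm_cancel na)
      show ?thesis by (rule order_trans[OF summable_norm[OF sn] suminf_le[OF na sn sg]])
    qed
    also have "\<dots> = 1/2 * (1/3) ^ k"
      using sums_unique[OF sums_mult2[OF geometric_sums[of "1/3::real"], of "(1/3) ^ Suc k"]] by (simp add: power_add)
    finally show ?thesis .
  qed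
  have "P (N k) x \<ge> 1/6 * 4 ^ k" for k
  proof -
    have "P (N k) (X (Suc k)) \<le> P (N k) x + P (N k) (X (Suc k) - x)" using tri[of "N k" x "X (Suc k) - x"] by simp
    moreover have "P (N k) (X (Suc k) - x) \<le> K (N k) * (1/2 * (1/3) ^ k)"
      using K[of "N k" "X (Suc k) - x"] mult_left_mono[OF close[of k] Kpos[of "N k"]] by (simp add: norm_minus_commute)
    moreover have "P (N k) (X (Suc k)) \<ge> 2/3 * (1/3) ^ k * K (N k)" unfolding X by (rule h)
    ultimately have "P (N k) x \<ge> 1/6 * ((1/3) ^ k * K (N k))" by (simp add: algebra_simps)
    moreover have "(1/3) ^ k * K (N k) \<ge> (1/3) ^ k * 12 ^ k" using N[of k] by (intro mult_left_mono) auto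
    moreover have "(1/3) ^ k * 12 ^ k = (4::real) ^ k" by (simp flip: power_mult_distrib)
    ultimately show ?thesis by linarith
  qed
  moreover obtain C where "\<And>n. P n x \<le> C" using pw by blast
  moreover obtain k where "6 * C < 4 ^ k" using real_arch_pow[of 4 "6 * C"] by auto
  ultimately show False by (metis (no_types, opaque_lifting) mult.commute mult_1 not_le order_trans times_divide_eq_left divide_le_eq zero_less_numeral)
qed

section \<open>Variations of set functions\<close>

text \<open>With \<open>\<tau> E = \<bar>\<mu> E\<bar>\<close> this is the total variation, and with \<open>\<tau> E\<close> the positive part of \<open>\<rho> E\<close> it is the
  positive part of the Jordan decomposition of \<open>\<rho>\<close>; both are measures for the same reason.\<close>

definition variation :: "('g::topological_space set \<Rightarrow> ennreal) \<Rightarrow> 'g set \<Rightarrow> ennreal" where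
  "variation \<tau> A = (SUP P\<in>{P. finite P \<and> disjoint P \<and> P \<subseteq> sets borel \<and> \<Union>P = A}. \<Sum>E\<in>P. \<tau> E)"

definition disjoint_subadditive :: "('g::topological_space set \<Rightarrow> ennreal) \<Rightarrow> bool" where
  "disjoint_subadditive \<tau> \<longleftrightarrow> \<tau> {} = 0 \<and>
     (\<forall>A. range A \<subseteq> sets borel \<and> disjoint_family A \<longrightarrow> \<tau> (\<Union>n. A n) \<le> (\<Sum>n::nat. \<tau> (A n)))"

text \<open>To obtain a partition, adjoin the remainder of \<open>B\<close>. Members with different indices that
  coincide are empty, and contribute nothing.\<close>

lemma sum_le_variation:
  assumes \<tau>: "\<tau> {} = 0" and I: "finite I" "disjoint_family_on A I" "\<And>i. i \<in> I \<Longrightarrow> A i \<in> sets borel"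
    and B: "B \<in> sets borel" "(\<Union>i\<in>I. A i) \<subseteq> B"
  shows "(\<Sum>i\<in>I. \<tau> (A i)) \<le> variation \<tau> B"
proof -
  have dj: "A i \<inter> A j = {}" if "i \<in> I" "j \<in> I" "i \<noteq> j" for i j
    using I(2) that by (auto simp: disjoint_family_on_def)
  have "(\<Sum>i\<in>I. \<tau> (A i)) = (\<Sum>E\<in>A ` I. \<tau> E)"
    using dj \<tau> by (subst sum.reindex_nontrivial[OF I(1)]) (auto, metis Int_absorb)
  also have "\<dots> \<le> (\<Sum>E\<in>insert (B - (\<Union>i\<in>I. A i)) (A ` I). \<tau> E)"
    using I(1) by (intro sum_mono2) auto
  also have "\<dots> \<le> variation \<tau> B" unfolding variation_def
  proof (intro SUP_upper CollectI conjI)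
    show "disjoint (insert (B - (\<Union>i\<in>I. A i)) (A ` I))"
      using dj by (fastforce simp: disjoint_def)
    show "insert (B - (\<Union>i\<in>I. A i)) (A ` I) \<subseteq> sets borel" using I B by auto
  qed (use I(1) B in auto)
  finally show ?thesis .
qed

lemma le_variation: "\<tau> {} = 0 \<Longrightarrow> A \<in> sets borel \<Longrightarrow> B \<in> sets borel \<Longrightarrow> A \<subseteq> B \<Longrightarrow> \<tau> A \<le> variation \<tau> B"
  using sum_le_variation[of \<tau> "{()}" "\<lambda>_. A" B] by (auto simp: disjoint_family_on_def)

lemma variation_le:
  assumes "\<And>P. finite P \<Longrightarrow> disjoint P \<Longrightarrow> P \<subseteq> sets borel \<Longrightarrow> \<Union>P = A \<Longrightarrow> (\<Sum>E\<in>P. \<tau> E) \<le> c"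
  shows "variation \<tau> A \<le> c"
  unfolding variation_def using assms by (intro SUP_least) auto

lemma variation_superadditive:
  assumes \<tau>: "\<tau> {} = 0" and C: "C \<in> sets borel" "D \<in> sets borel" "C \<inter> D = {}"
  shows "variation \<tau> C + variation \<tau> D \<le> variation \<tau> (C \<union> D)"
proof -
  let ?S = "\<lambda>A. {P. finite P \<and> disjoint P \<and> P \<subseteq> sets borel \<and> \<Union>P = A}"
  have ne: "?S A \<noteq> {}" if "A \<in> sets borel" for A
    using that by (auto intro!: exI[of _ "{A}"] simp: disjoint_def)
  have *: "(\<Sum>E\<in>P. \<tau> E) + (\<Sum>E\<in>Q. \<tau> E) \<le> variation \<tau> (C \<union> D)" if P: "P \<in> ?S C" and Q: "Q \<in> ?S D" for P Q
  proof -
    have "(\<Sum>E\<in>P. \<tau> E) + (\<Sum>E\<in>Q. \<tau> E) = (\<Sum>i\<in>P <+> Q. \<tau> (case_sum id id i))"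
      using P Q by (simp add: sum.Plus o_def)
    also have "\<dots> \<le> variation \<tau> (C \<union> D)"
    proof (rule sum_le_variation[where \<tau> = \<tau>, OF \<tau>])
      show "disjoint_family_on (case_sum id id) (P <+> Q)"
      proof -
        have "case_sum id id i \<inter> case_sum id id j = {}" if "i \<in> P <+> Q" "j \<in> P <+> Q" "i \<noteq> j" for i j
        proof -
          have "a \<inter> b = {}" "b \<inter> a = {}" if "a \<in> P" "b \<in> Q" for a b using that P Q C(3) by blast+
          moreover have "a \<inter> b = {}" if "a \<in> P" "b \<in> P" "a \<noteq> b" for a b using that P by (simp add: disjoint_def)
          moreover have "a \<inter> b = {}" if "a \<in> Q" "b \<in> Q" "a \<noteq> b" for a b using that Q by (simp add: disjoint_def)
          ultimately show ?thesis using that by (cases i; cases j) (simp_all add: Plus_def image_iff)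
        qed
        then show ?thesis by (simp add: disjoint_family_on_def)
      qed
    qed (use P Q C in auto)
    finally show ?thesis .
  qed
  have "variation \<tau> C + (\<Sum>E\<in>Q. \<tau> E) \<le> variation \<tau> (C \<union> D)" if "Q \<in> ?S D" for Q
    unfolding variation_def[of \<tau> C] ennreal_SUP_add_left[OF ne[OF C(1)], symmetric]
    using *[OF _ that] by (intro SUP_least)
  then show ?thesis
    unfolding variation_def[of \<tau> D] ennreal_SUP_add_right[OF ne[OF C(2)]] by (intro SUP_least)
qed

lemma variation_mono:
  assumes "\<tau> {} = 0" "A \<in> sets borel" "B \<in> sets borel" "A \<subseteq> B"
  shows "variation \<tau> A \<le> variation \<tau> B"
proof (rule variation_le)
  fix P assume "finite P" "disjoint P" "P \<subseteq> sets borel" "\<Union>P = A"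
  then show "(\<Sum>E\<in>P. \<tau> E) \<le> variation \<tau> B"
    using assms by (intro sum_le_variation[where \<tau> = \<tau> and A = "\<lambda>E. E"]) (auto simp: disjoint_family_on_def disjoint_def)
qed

text \<open>One inequality is superadditivity on finite unions. For the other, each cell of a partition of
  the union is cut along the sets \<open>A n\<close>, where subadditivity of \<open>\<tau>\<close> applies.\<close>

lemma variation_countably_additive:
  assumes \<tau>: "disjoint_subadditive \<tau>"
  shows "positive (sets borel) (variation \<tau>)" "countably_additive (sets borel) (variation \<tau>)"
proof -
  have \<tau>0: "\<tau> {} = 0" using \<tau> by (simp add: disjoint_subadditive_def)
  have "variation \<tau> {} \<le> 0"
  proof (rule variation_le)
    fix P :: "'a set set" assume "\<Union>P = {}"
    then have "P \<subseteq> {{}}" by auto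
    then have "P = {} \<or> P = {{}}" by auto
    then show "(\<Sum>E\<in>P. \<tau> E) \<le> 0" using \<tau>0 by auto
  qed
  then show "positive (sets borel) (variation \<tau>)" by (simp add: positive_def)
  show "countably_additive (sets borel) (variation \<tau>)"
  proof (rule countably_additiveI)
    fix A :: "nat \<Rightarrow> 'a set" assume A: "range A \<subseteq> sets borel" "disjoint_family A" "(\<Union>i. A i) \<in> sets borel"
    have Am: "A n \<in> sets borel" for n using A by auto
    have part: "(\<Sum>n<N. variation \<tau> (A n)) \<le> variation \<tau> (\<Union>n<N. A n)" for N
    proof (induction N)
      case (Suc N)
      have "(\<Sum>n<Suc N. variation \<tau> (A n)) \<le> variation \<tau> (\<Union>n<N. A n) + variation \<tau> (A N)"
        using Suc by (simp add: add_right_mono)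
      also have "\<dots> \<le> variation \<tau> ((\<Union>n<N. A n) \<union> A N)"
      proof (intro variation_superadditive[where \<tau> = \<tau>, OF \<tau>0])
        show "(\<Union>n<N. A n) \<inter> A N = {}"       proof -
          have "A n \<inter> A N = {}" if "n < N" for n using A(2) that by (simp add: disjoint_family_on_def)
          then show ?thesis by blast
        qed
      qed (use Am in auto)
      finally show ?case by (simp add: lessThan_Suc Un_commute)
    qed simp
    have "(\<Sum>n<N. variation \<tau> (A n)) \<le> variation \<tau> (\<Union>n. A n)" for N
      by (rule order_trans[OF part variation_mono[where \<tau> = \<tau>, OF \<tau>0]]) (use Am in auto)
    then have ge: "(\<Sum>n. variation \<tau> (A n)) \<le> variation \<tau> (\<Union>n. A n)"
      by (intro suminf_le_const) auto
    have "variation \<tau> (\<Union>n. A n) \<le> (\<Sum>n. variation \<tau> (A n))"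
    proof (rule variation_le)
      fix P :: "'a set set" assume P: "finite P" "disjoint P" "P \<subseteq> sets borel" "\<Union>P = (\<Union>n. A n)"
      have "(\<Sum>E\<in>P. \<tau> E) \<le> (\<Sum>E\<in>P. \<Sum>n. \<tau> (E \<inter> A n))"
      proof (rule sum_mono)
        fix E assume E: "E \<in> P"
        then have "E = (\<Union>n. E \<inter> A n)" using P(4) by auto
        then have "\<tau> E = \<tau> (\<Union>n. E \<inter> A n)" by simp
        also have "\<dots> \<le> (\<Sum>n. \<tau> (E \<inter> A n))"
        proof -
          have "range (\<lambda>n. E \<inter> A n) \<subseteq> sets borel" using E P(3) Am by auto
          moreover have "disjoint_family (\<lambda>n. E \<inter> A n)" using A(2) unfolding disjoint_family_on_def by blast
          ultimately show ?thesis using \<tau> unfolding disjoint_subadditive_def by blast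
        qed
        finally show "\<tau> E \<le> (\<Sum>n. \<tau> (E \<inter> A n))" .
      qed
      also have "\<dots> = (\<Sum>n. \<Sum>E\<in>P. \<tau> (E \<inter> A n))" by (rule suminf_sum[symmetric]) auto
      also have "\<dots> \<le> (\<Sum>n. variation \<tau> (A n))"
      proof (intro suminf_le)
        fix n show "(\<Sum>E\<in>P. \<tau> (E \<inter> A n)) \<le> variation \<tau> (A n)"
          using P Am by (intro sum_le_variation[where \<tau> = \<tau>, OF \<tau>0]) (auto simp: disjoint_family_on_def disjoint_def)
      qed auto
      finally show "(\<Sum>E\<in>P. \<tau> E) \<le> (\<Sum>n. variation \<tau> (A n))" .
    qed
    with ge show "(\<Sum>i. variation \<tau> (A i)) = variation \<tau> (\<Union>i. A i)" by simp
  qed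
qed

section \<open>Vector measures\<close>

lemma vm_sums:
  "vector_measure \<nu> \<Longrightarrow> range A \<subseteq> sets borel \<Longrightarrow> disjoint_family A \<Longrightarrow> (\<lambda>n::nat. \<nu> (A n)) sums \<nu> (\<Union>n. A n)"
  by (simp add: vector_measure_def)

lemma vm_empty: 
  fixes \<nu> :: "'g::topological_space set \<Rightarrow> 'x::real_normed_vector"
  assumes "vector_measure \<nu>" shows "\<nu> {} = 0"
proof -
  have "(\<lambda>n::nat. \<nu> {}) sums \<nu> {}"
    using vm_sums[OF assms, of "\<lambda>_. {}"] by (simp add: disjoint_family_on_def)
  then show ?thesis using sums_summable summable_const_iff by blast
qed

lemma vm_Un:
  assumes \<nu>: "vector_measure \<nu>" and "A \<in> sets borel" "B \<in> sets borel" "A \<inter> B = {}"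
  shows "\<nu> (A \<union> B) = \<nu> A + \<nu> B"
proof -
  have "(\<lambda>n. \<nu> (binaryset A B n)) sums \<nu> (\<Union>n. binaryset A B n)"
    using assms by (intro vm_sums) (auto simp: binaryset_def disjoint_family_on_def)
  moreover have "(\<lambda>n. \<nu> (binaryset A B n)) sums (\<nu> A + \<nu> B)"
    using binaryset_sums[of \<nu> A B] vm_empty[OF \<nu>] by simp
  ultimately show ?thesis using sums_unique2 by (fastforce simp: UN_binaryset_eq)
qed

lemma vm_Diff:
  assumes "vector_measure \<nu>" "A \<in> sets borel" "B \<in> sets borel" "A \<subseteq> B"
  shows "\<nu> (B - A) = \<nu> B - \<nu> A"
  using vm_Un[OF assms(1,2), of "B - A"] assms by (simp add: Un_absorb1 Diff_partition algebra_simps)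

lemma vm_UN:
  assumes \<nu>: "vector_measure \<nu>" and "finite I" "disjoint_family_on A I" "\<And>i. i \<in> I \<Longrightarrow> A i \<in> sets borel"
  shows "\<nu> (\<Union>i\<in>I. A i) = (\<Sum>i\<in>I. \<nu> (A i))"
  using assms(2-)
proof (induction I)
  case empty then show ?case by (simp add: vm_empty[OF \<nu>])
next
  case (insert i I)
  have "\<nu> (A i \<union> (\<Union>j\<in>I. A j)) = \<nu> (A i) + \<nu> (\<Union>j\<in>I. A j)"
    using insert by (intro vm_Un[OF \<nu>]) (auto simp: disjoint_family_on_def)
  moreover have "\<nu> (\<Union>i\<in>I. A i) = (\<Sum>i\<in>I. \<nu> (A i))"
    using insert by (intro insert.IH) (auto simp: disjoint_family_on_def)
  ultimately show ?case using insert by simp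
qed

lemma vm_linear_image:
  "vector_measure \<nu> \<Longrightarrow> bounded_linear T \<Longrightarrow> vector_measure (\<lambda>A. T (\<nu> A))"
  unfolding vector_measure_def using bounded_linear.sums[of T] by simp


text \<open>If \<open>\<nu>\<close> is unbounded on the subsets of \<open>A\<close>, split \<open>A\<close> by a subset \<open>B\<close> with
  \<open>\<parallel>\<nu> B\<parallel> > \<parallel>\<nu> A\<parallel> + 1\<close>: both pieces have norm at least \<open>1\<close>, and \<open>\<nu>\<close> is unbounded on the subsets of one
  of them. Iterating and discarding the other piece gives disjoint sets whose measures do not tend
  to \<open>0\<close>, against \<open>\<sigma>\<close>-additivity.\<close>

lemma vm_bounded:
  fixes \<nu> :: "'g::topological_space set \<Rightarrow> 'x::real_normed_vector"
  assumes \<nu>: "vector_measure \<nu>"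
  obtains K where "\<And>A. A \<in> sets borel \<Longrightarrow> norm (\<nu> A) \<le> K"
proof (rule ccontr)
  assume "\<not> thesis"
  then have unb: "\<exists>A\<in>sets borel. norm (\<nu> A) > K" for K using that by (meson not_le)
  define bad where "bad A \<longleftrightarrow> A \<in> sets borel \<and> (\<forall>K. \<exists>B\<in>sets borel. B \<subseteq> A \<and> norm (\<nu> B) > K)" for A
  have bad0: "bad UNIV" using unb by (auto simp: bad_def)
  have step: "\<exists>A'. bad A' \<and> A' \<subseteq> A \<and> norm (\<nu> (A - A')) \<ge> 1" if A: "bad A" for A
  proof -
    have Am: "A \<in> sets borel" using A by (simp add: bad_def)
    obtain B where B: "B \<in> sets borel" "B \<subseteq> A" "norm (\<nu> B) > norm (\<nu> A) + 1" using A unfolding bad_def by blast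
    have d: "\<nu> (A - B) = \<nu> A - \<nu> B" by (rule vm_Diff[OF \<nu> B(1) Am B(2)])
    have n1: "norm (\<nu> (A - B)) \<ge> 1" using B(3) norm_triangle_ineq3[of "\<nu> A" "\<nu> B"] unfolding d by linarith
    have n2: "norm (\<nu> (A - (A - B))) \<ge> 1" using B(2,3) norm_ge_zero[of "\<nu> A"] by (simp add: double_diff, linarith)
    have "bad B \<or> bad (A - B)"
    proof (rule ccontr)
      assume "\<not> ?thesis"
      then obtain K L where K: "\<And>C. C \<in> sets borel \<Longrightarrow> C \<subseteq> B \<Longrightarrow> norm (\<nu> C) \<le> K"
        and L: "\<And>C. C \<in> sets borel \<Longrightarrow> C \<subseteq> A - B \<Longrightarrow> norm (\<nu> C) \<le> L"
        using B Am unfolding bad_def by (metis not_le sets.Diff)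
      obtain C where C: "C \<in> sets borel" "C \<subseteq> A" "norm (\<nu> C) > K + L" using A unfolding bad_def by blast
      have "\<nu> C = \<nu> (C \<inter> B) + \<nu> (C - B)"
        using vm_Un[OF \<nu>, of "C \<inter> B" "C - B"] C B by (auto simp: Int_Diff_Un)
      moreover have "norm (\<nu> (C \<inter> B)) \<le> K" "norm (\<nu> (C - B)) \<le> L" using C B by (auto intro!: K L)
      ultimately show False using C(3) norm_triangle_ineq[of "\<nu> (C \<inter> B)" "\<nu> (C - B)"] by simp
    qed
    then show ?thesis
    proof
      assume "bad B" then show ?thesis using B n1 by blast
    next
      assume "bad (A - B)" then show ?thesis using n2 by blast
    qed
  qed
  define F where "F A = (SOME A'. bad A' \<and> A' \<subseteq> A \<and> norm (\<nu> (A - A')) \<ge> 1)" for A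
  have F: "bad (F A)" "F A \<subseteq> A" "norm (\<nu> (A - F A)) \<ge> 1" if "bad A" for A
    using someI_ex[OF step[OF that]] unfolding F_def by blast+
  define S where "S n = (F ^^ n) UNIV" for n
  have S: "bad (S n)" for n by (induction n) (auto simp: S_def bad0 F)
  have S_Suc: "S (Suc n) = F (S n)" for n by (simp add: S_def)
  have "decseq S" unfolding decseq_Suc_iff S_Suc using F(2) S by blast
  have dj: "disjoint_family (\<lambda>n. S n - S (Suc n))"
  proof -
    have "(S m - S (Suc m)) \<inter> (S n - S (Suc n)) = {}" if "m < n" for m n
      using decseqD[OF \<open>decseq S\<close>, of "Suc m" n] that by auto
    then have "(S m - S (Suc m)) \<inter> (S n - S (Suc n)) = {}" if "m \<noteq> n" for m n
      using that by (cases m n rule: linorder_cases) (blast, simp, blast)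
    then show ?thesis by (simp add: disjoint_family_on_def)
  qed
  have "(\<lambda>n. \<nu> (S n - S (Suc n))) sums \<nu> (\<Union>n. S n - S (Suc n))"
    using S dj by (intro vm_sums[OF \<nu>]) (auto simp: bad_def)
  then have "(\<lambda>n. \<nu> (S n - S (Suc n))) \<longlonglongrightarrow> 0" using sums_summable summable_LIMSEQ_zero by blast
  then obtain n where "norm (\<nu> (S n - S (Suc n))) < 1" using LIMSEQ_D[of _ 0 1] by fastforce
  with F(3)[OF S[of n]] show False by (simp add: S_Suc)
qed

lemma vm_subadditive:
  fixes \<nu> :: "'g::topological_space set \<Rightarrow> 'x::real_normed_vector" and T :: "'x \<Rightarrow> ennreal"
  assumes \<nu>: "vector_measure \<nu>" and T0: "T 0 = 0" and Tadd: "\<And>x y. T (x + y) \<le> T x + T y"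
    and Tc: "\<And>X l. X \<longlonglongrightarrow> l \<Longrightarrow> (\<lambda>n::nat. T (X n)) \<longlonglongrightarrow> T l"
  shows "disjoint_subadditive (\<lambda>A. T (\<nu> A))"
  unfolding disjoint_subadditive_def
proof (intro conjI allI impI)
  show "T (\<nu> {}) = 0" using vm_empty[OF \<nu>] T0 by simp
  fix A :: "nat \<Rightarrow> 'g set" assume A: "range A \<subseteq> sets borel \<and> disjoint_family A"
  have "(\<lambda>N. \<Sum>n<N. \<nu> (A n)) \<longlonglongrightarrow> \<nu> (\<Union>n. A n)"
    using vm_sums[OF \<nu>, of A] A by (simp add: sums_def)
  then have "(\<lambda>N. T (\<Sum>n<N. \<nu> (A n))) \<longlonglongrightarrow> T (\<nu> (\<Union>n. A n))" by (rule Tc)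
  moreover have "T (\<Sum>n<N. \<nu> (A n)) \<le> (\<Sum>n. T (\<nu> (A n)))" for N
  proof -
    have "T (\<Sum>n<N. \<nu> (A n)) \<le> (\<Sum>n<N. T (\<nu> (A n)))"
      by (induction N) (auto simp: T0 intro: order_trans[OF Tadd add_right_mono])
    also have "\<dots> \<le> (\<Sum>n. T (\<nu> (A n)))" by (intro sum_le_suminf) auto
    finally show ?thesis .
  qed
  ultimately show "T (\<nu> (\<Union>n. A n)) \<le> (\<Sum>n. T (\<nu> (A n)))" by (intro LIMSEQ_le_const2) auto
qed

lemma cmod_subadditive: "vector_measure \<mu> \<Longrightarrow> disjoint_subadditive (\<lambda>A. ennreal (cmod (\<mu> A)))"
  by (rule vm_subadditive)
    (auto intro!: tendsto_ennrealI tendsto_norm simp: norm_triangle_ineq simp flip: ennreal_plus)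

lemma ennreal_add_le: "ennreal (a + b) \<le> ennreal a + ennreal b"
  by (smt (verit) add.right_neutral add_0 ennreal_leI ennreal_neg ennreal_plus)

lemma ennreal_subadditive: "vector_measure \<rho> \<Longrightarrow> disjoint_subadditive (\<lambda>A. ennreal (\<rho> A))"
  by (rule vm_subadditive) (auto intro!: tendsto_ennrealI ennreal_add_le)

lemma total_variation_eq: "total_variation \<mu> = variation (\<lambda>E. ennreal (cmod (\<mu> E)))"
  by (simp add: fun_eq_iff total_variation_def variation_def)

lemma sets_tv_measure[simp, measurable_cong]: "sets (tv_measure \<mu>) = sets borel"
  using sets.sigma_sets_eq[of borel] by (simp add: tv_measure_def sets.space_closed[of borel, simplified])

lemma space_tv_measure[simp]: "space (tv_measure \<mu>) = UNIV"
  by (simp add: sets_eq_imp_space_eq[OF sets_tv_measure])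

lemma sets_jordan_pos[simp, measurable_cong]: "sets (jordan_pos \<rho>) = sets borel"
  using sets.sigma_sets_eq[of borel] by (simp add: jordan_pos_def sets.space_closed[of borel, simplified])

lemma space_jordan_pos[simp]: "space (jordan_pos \<rho>) = UNIV"
  by (simp add: sets_eq_imp_space_eq[OF sets_jordan_pos])

lemma UNIV_in_borel: "UNIV \<in> sets borel" using sets.top[of borel] by simp

lemma sigma_algebra_borel: "sigma_algebra UNIV (sets borel)"
  using sets.sigma_algebra_axioms[of borel] by simp

lemma emeasure_tv_measure:
  assumes "vector_measure \<mu>" "A \<in> sets borel"
  shows "emeasure (tv_measure \<mu>) A = total_variation \<mu> A"
  unfolding tv_measure_def total_variation_eq
  using variation_countably_additive[OF cmod_subadditive[OF assms(1)]] assms(2)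
  by (intro emeasure_measure_of_sigma sigma_algebra_borel)

text \<open>In the sum over a partition only the cells of positive measure count, and their union is a
  single competitor for the supremum.\<close>

lemma jordan_variation:
  fixes \<rho> :: "'g::topological_space set \<Rightarrow> real"
  assumes \<rho>: "vector_measure \<rho>" and A: "A \<in> sets borel"
  shows "(SUP B\<in>{B \<in> sets borel. B \<subseteq> A}. ennreal (\<rho> B)) = variation (\<lambda>E. ennreal (\<rho> E)) A"
proof (rule antisym)
  show "(SUP B\<in>{B \<in> sets borel. B \<subseteq> A}. ennreal (\<rho> B)) \<le> variation (\<lambda>E. ennreal (\<rho> E)) A"
    using A vm_empty[OF \<rho>] by (intro SUP_least le_variation[where \<tau> = "\<lambda>E. ennreal (\<rho> E)"]) auto
  show "variation (\<lambda>E. ennreal (\<rho> E)) A \<le> (SUP B\<in>{B \<in> sets borel. B \<subseteq> A}. ennreal (\<rho> B))"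
  proof (rule variation_le)
    fix P assume P: "finite P" "disjoint P" "P \<subseteq> sets borel" "\<Union>P = A"
    let ?Q = "{E \<in> P. \<rho> E > 0}"
    have "(\<Sum>E\<in>P. ennreal (\<rho> E)) = (\<Sum>E\<in>?Q. ennreal (\<rho> E))"
      using P(1) by (intro sum.mono_neutral_right) (auto simp: ennreal_neg not_less)
    also have "\<dots> = ennreal (\<Sum>E\<in>?Q. \<rho> E)" by (rule sum_ennreal) auto
    also have "(\<Sum>E\<in>?Q. \<rho> E) = \<rho> (\<Union>E\<in>?Q. E)"
      using P by (intro vm_UN[OF \<rho>, symmetric]) (auto simp: disjoint_family_on_def disjoint_def)
    also have "ennreal (\<rho> (\<Union>E\<in>?Q. E)) \<le> (SUP B\<in>{B \<in> sets borel. B \<subseteq> A}. ennreal (\<rho> B))"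
      using P by (intro SUP_upper) (auto intro!: sets.finite_Union)
    finally show "(\<Sum>E\<in>P. ennreal (\<rho> E)) \<le> (SUP B\<in>{B \<in> sets borel. B \<subseteq> A}. ennreal (\<rho> B))" .
  qed
qed

lemma emeasure_jordan_pos:
  assumes \<rho>: "vector_measure \<rho>" and A: "A \<in> sets borel"
  shows "emeasure (jordan_pos \<rho>) A = (SUP B\<in>{B \<in> sets borel. B \<subseteq> A}. ennreal (\<rho> B))"
proof -
  let ?j = "\<lambda>A. SUP B\<in>{B \<in> sets borel. B \<subseteq> A}. ennreal (\<rho> B)"
  note v = variation_countably_additive[OF ennreal_subadditive[OF \<rho>]]
  have "positive (sets borel) ?j"
    using v(1) jordan_variation[OF \<rho>, of "{}"] by (simp add: positive_def)
  moreover have "countably_additive (sets borel) ?j"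
    unfolding countably_additive_def
  proof (intro allI impI)
    fix A :: "nat \<Rightarrow> 'a set" assume A: "range A \<subseteq> sets borel" "disjoint_family A" "(\<Union>i. A i) \<in> sets borel"
    then have "?j (A i) = variation (\<lambda>E. ennreal (\<rho> E)) (A i)" for i using jordan_variation[OF \<rho>] by auto
    then show "(\<Sum>i. ?j (A i)) = ?j (\<Union>i. A i)"
      using v(2) A jordan_variation[OF \<rho> A(3)] by (simp add: countably_additive_def)
  qed
  ultimately show ?thesis unfolding jordan_pos_def
    using A by (intro emeasure_measure_of_sigma sigma_algebra_borel)
qed

lemma vm_minus: "vector_measure \<rho> \<Longrightarrow> vector_measure (\<lambda>B. - \<rho> B)"
  by (rule vm_linear_image[where T = uminus]) (auto intro: bounded_linear_minus bounded_linear_ident)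

lemma vm_Re: "vector_measure \<mu> \<Longrightarrow> vector_measure (\<lambda>B. Re (\<mu> B))"
  by (rule vm_linear_image[where T = Re]) (auto intro: bounded_linear_Re)


lemma finite_measure_jordan_pos:
  assumes \<rho>: "vector_measure \<rho>" shows "finite_measure (jordan_pos \<rho>)"
proof (rule finite_measureI)
  obtain K where K: "\<And>A. A \<in> sets borel \<Longrightarrow> norm (\<rho> A) \<le> K" using vm_bounded[OF \<rho>] by blast
  have "emeasure (jordan_pos \<rho>) UNIV \<le> ennreal K"
    unfolding emeasure_jordan_pos[OF \<rho> UNIV_in_borel]
    using K by (intro SUP_least ennreal_leI) (auto simp: abs_le_iff)
  then show "emeasure (jordan_pos \<rho>) (space (jordan_pos \<rho>)) \<noteq> \<infinity>" by (auto simp: top_unique)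
qed

text \<open>Passing from \<open>B\<close> to \<open>A - B\<close> turns the supremum of \<open>\<rho> B\<close> into \<open>\<rho> A\<close> plus the supremum of
  \<open>- \<rho> B\<close>.\<close>

lemma jordan_decomposition:
  assumes \<rho>: "vector_measure \<rho>" and A: "A \<in> sets borel"
  shows "measure (jordan_pos \<rho>) A - measure (jordan_pos (\<lambda>B. - \<rho> B)) A = \<rho> A"
proof -
  note \<rho>' = vm_minus[OF \<rho>]
  interpret P: finite_measure "jordan_pos \<rho>" by (rule finite_measure_jordan_pos[OF \<rho>])
  interpret N: finite_measure "jordan_pos (\<lambda>B. - \<rho> B)" by (rule finite_measure_jordan_pos[OF \<rho>'])
  have le: "measure (jordan_pos \<sigma>) A - measure (jordan_pos (\<lambda>B. - \<sigma> B)) A \<le> \<sigma> A"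
    if \<sigma>: "vector_measure \<sigma>" for \<sigma> :: "'a set \<Rightarrow> real"
  proof -
    note \<sigma>' = vm_minus[OF \<sigma>]
    interpret P: finite_measure "jordan_pos \<sigma>" by (rule finite_measure_jordan_pos[OF \<sigma>])
    interpret N: finite_measure "jordan_pos (\<lambda>B. - \<sigma> B)" by (rule finite_measure_jordan_pos[OF \<sigma>'])
    let ?n = "measure (jordan_pos (\<lambda>B. - \<sigma> B)) A"
    have b: "- \<sigma> B \<le> ?n" if "B \<in> sets borel" "B \<subseteq> A" for B
    proof -
      have "ennreal (- \<sigma> B) \<le> emeasure (jordan_pos (\<lambda>B. - \<sigma> B)) A"
        unfolding emeasure_jordan_pos[OF \<sigma>' A] using that by (intro SUP_upper2[of B]) auto
      then show ?thesis using measure_nonneg[of "jordan_pos (\<lambda>B. - \<sigma> B)" A]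
        by (auto simp: N.emeasure_eq_measure ennreal_le_iff2 simp del: measure_nonneg)
    qed
    have "\<sigma> B \<le> \<sigma> A + ?n" if "B \<in> sets borel" "B \<subseteq> A" for B
      using b[of "A - B"] vm_Diff[OF \<sigma> that(1) A that(2)] that A by auto
    moreover from this[of "{}"] have "0 \<le> \<sigma> A + ?n" using vm_empty[OF \<sigma>] by simp
    ultimately have "emeasure (jordan_pos \<sigma>) A \<le> ennreal (\<sigma> A + ?n)"
      unfolding emeasure_jordan_pos[OF \<sigma> A] by (intro SUP_least ennreal_leI) auto
    then show ?thesis using \<open>0 \<le> \<sigma> A + ?n\<close> by (simp add: P.emeasure_eq_measure)
  qed
  show ?thesis using le[OF \<rho>] le[OF \<rho>'] by simp
qed

section \<open>Integration against a complex measure\<close>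

abbreviation cint :: "('g::topological_space set \<Rightarrow> complex) \<Rightarrow> ('g \<Rightarrow> complex) \<Rightarrow> complex" where
  "cint \<mu> \<equiv> complex_measure_integral \<mu> UNIV"

text \<open>The values \<open>1, -1, -\<i>, \<i>\<close> of \<open>c\<close> give the positive and negative Jordan parts of \<open>Re \<mu>\<close> and of
  \<open>Im \<mu>\<close>, in this order. The parameter lets the four parts share their lemmas.\<close>

definition jordan_part :: "('g::topological_space set \<Rightarrow> complex) \<Rightarrow> complex \<Rightarrow> 'g measure" where
  "jordan_part \<mu> c = jordan_pos (\<lambda>B. Re (c * \<mu> B))"

lemma sets_jordan_part[simp, measurable_cong]: "sets (jordan_part \<mu> c) = sets borel"
  by (simp add: jordan_part_def)

lemma space_jordan_part[simp]: "space (jordan_part \<mu> c) = UNIV"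
  by (simp add: jordan_part_def)

lemma cint_eq:
  "cint \<mu> f =
     (LINT s|jordan_part \<mu> 1. f s) - (LINT s|jordan_part \<mu> (-1). f s)
     + \<i> * ((LINT s|jordan_part \<mu> (-\<i>). f s) - (LINT s|jordan_part \<mu> \<i>. f s))"
  by (simp add: complex_measure_integral_def real_measure_integral_def jordan_part_def set_lebesgue_integral_def)

lemma cint_set:
  "complex_measure_integral \<mu> A f = cint \<mu> (\<lambda>s. indicator A s *\<^sub>R f s)"
  by (simp add: complex_measure_integral_def real_measure_integral_def set_lebesgue_integral_def)

lemma vm_mult:
  fixes \<mu> :: "'g::topological_space set \<Rightarrow> complex"
  shows "vector_measure \<mu> \<Longrightarrow> vector_measure (\<lambda>B. c * \<mu> B)"
  by (rule vm_linear_image[where T = "(*) c"]) (auto intro: bounded_linear_mult_right)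

lemma vm_Re_mult:
  fixes \<mu> :: "'g::topological_space set \<Rightarrow> complex"
  shows "vector_measure \<mu> \<Longrightarrow> vector_measure (\<lambda>B. Re (c * \<mu> B))"
  by (intro vm_Re vm_mult)

lemma finite_measure_jordan_part: "vector_measure \<mu> \<Longrightarrow> finite_measure (jordan_part \<mu> c)"
  unfolding jordan_part_def by (intro finite_measure_jordan_pos vm_Re_mult)

lemma jordan_part_le_tv:
  assumes \<mu>: "vector_measure \<mu>" and c: "cmod c = 1" and A: "A \<in> sets borel"
  shows "emeasure (jordan_part \<mu> c) A \<le> emeasure (tv_measure \<mu>) A"
  unfolding jordan_part_def emeasure_jordan_pos[OF vm_Re_mult[OF \<mu>] A] emeasure_tv_measure[OF \<mu> A]
proof (rule SUP_least)
  fix B assume B: "B \<in> {B \<in> sets borel. B \<subseteq> A}"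
  have "Re (c * \<mu> B) \<le> cmod (\<mu> B)" using complex_Re_le_cmod[of "c * \<mu> B"] c by (simp add: norm_mult)
  then have "ennreal (Re (c * \<mu> B)) \<le> ennreal (cmod (\<mu> B))" by (rule ennreal_leI)
  also have "\<dots> \<le> total_variation \<mu> A" unfolding total_variation_eq
    using B A vm_empty[OF \<mu>] by (intro le_variation[where \<tau> = "\<lambda>E. ennreal (cmod (\<mu> E))"]) auto
  finally show "ennreal (Re (c * \<mu> B)) \<le> total_variation \<mu> A" .
qed

lemma nn_integral_jordan_part_le:
  assumes "vector_measure \<mu>" "cmod c = 1"
  shows "(\<integral>\<^sup>+s. u s \<partial>jordan_part \<mu> c) \<le> (\<integral>\<^sup>+s. u s \<partial>tv_measure \<mu>)"
  by (rule nn_integral_mono_measure) (use jordan_part_le_tv[OF assms] in \<open>auto simp: le_measure\<close>)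

lemma AE_jordan_part:
  assumes "vector_measure \<mu>" "cmod c = 1" "AE s in tv_measure \<mu>. Q s"
  shows "AE s in jordan_part \<mu> c. Q s"
proof -
  obtain N where N: "N \<in> sets borel" "emeasure (tv_measure \<mu>) N = 0" "{s. \<not> Q s} \<subseteq> N"
    using assms(3) by (auto elim: AE_E)
  then have "emeasure (jordan_part \<mu> c) N = 0" using jordan_part_le_tv[OF assms(1,2) N(1)] by simp
  with N show ?thesis by (intro AE_I[of _ _ N]) auto
qed

lemma integrable_jordan_part:
  fixes f :: "'g::topological_space \<Rightarrow> complex"
  assumes "vector_measure \<mu>" "cmod c = 1" "integrable (tv_measure \<mu>) f"
  shows "integrable (jordan_part \<mu> c) f"
proof (rule integrableI_bounded)
  show "f \<in> borel_measurable (jordan_part \<mu> c)"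
    using borel_measurable_integrable[OF assms(3)] by (simp cong: measurable_cong_sets)
  have "(\<integral>\<^sup>+s. ennreal (norm (f s)) \<partial>jordan_part \<mu> c) \<le> (\<integral>\<^sup>+s. ennreal (norm (f s)) \<partial>tv_measure \<mu>)"
    by (rule nn_integral_jordan_part_le[OF assms(1,2)])
  also have "\<dots> < \<infinity>" using assms(3) by (simp add: integrable_iff_bounded)
  finally show "(\<integral>\<^sup>+s. ennreal (norm (f s)) \<partial>jordan_part \<mu> c) < \<infinity>" .
qed

text \<open>The modulus is dominated by the sum of the positive parts of \<open>\<plusminus> Re\<close> and \<open>\<plusminus> Im\<close>, and each of these
  four sums over a partition is the value of \<open>Re (c \<mu>)\<close> at one set.\<close>

lemma total_variation_le_bound:
  assumes \<mu>: "vector_measure \<mu>" and K: "\<And>B. B \<in> sets borel \<Longrightarrow> cmod (\<mu> B) \<le> K" and A: "A \<in> sets borel"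
  shows "total_variation \<mu> A \<le> ennreal (4 * K)"
proof -
  have J: "(\<Sum>E\<in>P. ennreal (Re (c * \<mu> E))) \<le> ennreal K"
    if P: "finite P" "disjoint P" "P \<subseteq> sets borel" "\<Union>P = A" and c: "cmod c = 1" for P c
  proof -
    have "(\<Sum>E\<in>P. ennreal (Re (c * \<mu> E))) \<le> variation (\<lambda>E. ennreal (Re (c * \<mu> E))) A"
      unfolding variation_def using P by (intro SUP_upper) auto
    also have "\<dots> = (SUP B\<in>{B \<in> sets borel. B \<subseteq> A}. ennreal (Re (c * \<mu> B)))"
      by (rule jordan_variation[OF vm_Re_mult[OF \<mu>] A, symmetric])
    also have "\<dots> \<le> ennreal K"
    proof (intro SUP_least ennreal_leI)
      fix B assume "B \<in> {B \<in> sets borel. B \<subseteq> A}"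
      then show "Re (c * \<mu> B) \<le> K" using complex_Re_le_cmod[of "c * \<mu> B"] c K[of B] by (simp add: norm_mult)
    qed
    finally show ?thesis .
  qed
  have "0 \<le> K" using K[of "{}"] order_trans[OF norm_ge_zero] by blast
  show ?thesis unfolding total_variation_eq
  proof (rule variation_le)
    fix P assume P: "finite P" "disjoint P" "P \<subseteq> sets borel" "\<Union>P = A"
    have "ennreal (cmod z) \<le> (ennreal (Re (1 * z)) + ennreal (Re ((-1) * z))) + (ennreal (Re ((-\<i>) * z)) + ennreal (Re (\<i> * z)))" for z
    proof -
      have "ennreal \<bar>a\<bar> \<le> ennreal a + ennreal (- a)" for a by (cases "a \<ge> 0") (auto simp: abs_if)
      from add_mono[OF this[of "Re z"] this[of "Im z"]]
      have "ennreal (\<bar>Re z\<bar> + \<bar>Im z\<bar>) \<le> (ennreal (Re z) + ennreal (- Re z)) + (ennreal (Im z) + ennreal (- Im z))" by simp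
      from order_trans[OF ennreal_leI[OF cmod_le[of z]] this] show ?thesis by simp
    qed
    then have "(\<Sum>E\<in>P. ennreal (cmod (\<mu> E))) \<le> (\<Sum>E\<in>P. (ennreal (Re (1 * \<mu> E)) + ennreal (Re ((-1) * \<mu> E))) + (ennreal (Re ((-\<i>) * \<mu> E)) + ennreal (Re (\<i> * \<mu> E))))"
      by (intro sum_mono)
    also have "\<dots> = ((\<Sum>E\<in>P. ennreal (Re (1 * \<mu> E))) + (\<Sum>E\<in>P. ennreal (Re ((-1) * \<mu> E)))) + ((\<Sum>E\<in>P. ennreal (Re ((-\<i>) * \<mu> E))) + (\<Sum>E\<in>P. ennreal (Re (\<i> * \<mu> E))))"
      by (simp only: sum.distrib)
    also have "\<dots> \<le> (ennreal K + ennreal K) + (ennreal K + ennreal K)"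
      by (intro add_mono J P) simp_all
    also have "\<dots> = ennreal (4 * K)" using \<open>0 \<le> K\<close> by (simp flip: ennreal_plus)
    finally show "(\<Sum>E\<in>P. ennreal (cmod (\<mu> E))) \<le> ennreal (4 * K)" .
  qed
qed

lemma finite_measure_tv:
  fixes \<mu> :: "'g::topological_space set \<Rightarrow> complex"
  assumes \<mu>: "vector_measure \<mu>" shows "finite_measure (tv_measure \<mu>)"
proof (rule finite_measureI)
  obtain K where K: "\<And>A. A \<in> sets borel \<Longrightarrow> norm (\<mu> A) \<le> K" using vm_bounded[OF \<mu>] by blast
  show "emeasure (tv_measure \<mu>) (space (tv_measure \<mu>)) \<noteq> \<infinity>"
    using total_variation_le_bound[OF \<mu> K UNIV_in_borel] emeasure_tv_measure[OF \<mu> UNIV_in_borel] by (auto simp: top_unique)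
qed

lemma cint_add:
  assumes "vector_measure \<mu>" "integrable (tv_measure \<mu>) f" "integrable (tv_measure \<mu>) g"
  shows "cint \<mu> (\<lambda>s. f s + g s) =
    cint \<mu> f + cint \<mu> g"
  using integrable_jordan_part[OF assms(1) _ assms(2)] integrable_jordan_part[OF assms(1) _ assms(3)]
  by (simp add: cint_eq algebra_simps)

lemma cint_mult:
  "cint \<mu> (\<lambda>s. c * f s) = c * cint \<mu> f"
  by (simp add: cint_eq algebra_simps)

lemma cint_sum:
  assumes "vector_measure \<mu>" "\<And>i. i \<in> I \<Longrightarrow> integrable (tv_measure \<mu>) (f i)"
  shows "cint \<mu> (\<lambda>s. \<Sum>i\<in>I. f i s) = (\<Sum>i\<in>I. cint \<mu> (f i))"
  using assms(2)
proof (induction I rule: infinite_finite_induct)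
  case (insert i I)
  then show ?case by (simp add: cint_add[OF assms(1)])
qed (simp_all add: cint_eq)

lemma cint_indicator:
  assumes \<mu>: "vector_measure \<mu>" and A: "A \<in> sets borel"
  shows "cint \<mu> (indicator A) = \<mu> A"
proof -
  have int: "(LINT s|jordan_part \<mu> c. indicator A s) = complex_of_real (measure (jordan_part \<mu> c) A)" for c
  proof -
    interpret finite_measure "jordan_part \<mu> c" by (rule finite_measure_jordan_part[OF \<mu>])
    have "(LINT s|jordan_part \<mu> c. indicator A s :: complex) = (LINT s|jordan_part \<mu> c. complex_of_real (indicator A s))"
      by (simp add: indicator_def of_bool_def if_distrib cong: if_cong)
    also have "\<dots> = complex_of_real (LINT s|jordan_part \<mu> c. indicator A s)" by simp
    finally show ?thesis using A by simp
  qed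
  have "measure (jordan_part \<mu> c) A - measure (jordan_part \<mu> (- c)) A = Re (c * \<mu> A)" for c
    using jordan_decomposition[OF vm_Re_mult[OF \<mu>] A, of c] by (simp add: jordan_part_def)
  from this[of 1] this[of "-\<i>"] show ?thesis
    by (simp add: cint_eq int complex_eq_iff)
qed

lemma cint_dominated:
  fixes f w :: "'g::topological_space \<Rightarrow> complex"
  assumes \<mu>: "vector_measure \<mu>" and w: "integrable (tv_measure \<mu>) w"
    and [measurable]: "f \<in> borel_measurable borel" "\<And>n::nat. F n \<in> borel_measurable borel"
    and lim: "\<And>s. (\<lambda>n. F n s) \<longlonglongrightarrow> f s" and le: "\<And>n s. cmod (F n s) \<le> cmod (w s)"
  shows "(\<lambda>n. cint \<mu> (F n)) \<longlonglongrightarrow> cint \<mu> f"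
proof -
  have "(\<lambda>n. LINT s|jordan_part \<mu> c. F n s) \<longlonglongrightarrow> (LINT s|jordan_part \<mu> c. f s)" if "cmod c = 1" for c
  proof (rule integral_dominated_convergence)
    show "integrable (jordan_part \<mu> c) (\<lambda>s. cmod (w s))"
      using integrable_jordan_part[OF \<mu> that w] by (rule integrable_norm)
  qed (use lim le in auto)
  then show ?thesis unfolding cint_eq by (intro tendsto_intros) simp_all
qed

lemma simple_function_borelD:
  assumes "simple_function borel F"
  shows "finite (range F)" "F -` {y} \<in> sets borel"
  using simple_functionD[OF assms] by auto

lemma simple_representation:
  fixes F :: "'g \<Rightarrow> complex"
  assumes "finite (range F)"
  shows "F s = (\<Sum>y\<in>range F. y * indicator (F -` {y}) s)"
proof -
  have "(\<Sum>y\<in>range F. y * indicator (F -` {y}) s) = (\<Sum>y\<in>range F. if y = F s then y else 0)"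
    by (intro sum.cong) (auto simp: indicator_def)
  also have "\<dots> = F s" using assms by simp
  finally show ?thesis by simp
qed

lemma integrable_indicator_tv:
  assumes "vector_measure \<mu>" "A \<in> sets borel"
  shows "integrable (tv_measure \<mu>) (indicator A :: 'g::topological_space \<Rightarrow> complex)"
proof -
  interpret finite_measure "tv_measure \<mu>" by (rule finite_measure_tv[OF assms(1)])
  show ?thesis using assms(2) by (intro integrable_const_bound[where B = 1]) (auto simp: indicator_def)
qed

lemma cint_simple:
  assumes \<mu>: "vector_measure \<mu>" and F: "simple_function borel F" and A: "A \<in> sets borel"
  shows "complex_measure_integral \<mu> A F = (\<Sum>y\<in>range F. y * \<mu> (A \<inter> F -` {y}))"
proof -
  note F = simple_function_borelD[OF F]
  have "indicator A s *\<^sub>R F s = (\<Sum>y\<in>range F. y * indicator (A \<inter> F -` {y}) s)" for s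
    by (subst simple_representation[OF F(1)]) (auto simp: indicator_def sum_distrib_left intro!: sum.cong)
  then have "complex_measure_integral \<mu> A F = cint \<mu> (\<lambda>s. \<Sum>y\<in>range F. y * indicator (A \<inter> F -` {y}) s)"
    by (subst cint_set) presburger
  also have "\<dots> = (\<Sum>y\<in>range F. cint \<mu> (\<lambda>s. y * indicator (A \<inter> F -` {y}) s))"
    using F A by (intro cint_sum[OF \<mu>] integrable_mult_right integrable_indicator_tv[OF \<mu>]) auto
  also have "\<dots> = (\<Sum>y\<in>range F. y * \<mu> (A \<inter> F -` {y}))"
    using F A by (simp add: cint_mult cint_indicator[OF \<mu>])
  finally show ?thesis .
qed

lemma nn_integral_simple_tv:
  fixes F :: "'g::topological_space \<Rightarrow> complex"
  assumes F: "simple_function borel F"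
  shows "(\<integral>\<^sup>+s. ennreal (cmod (F s)) \<partial>tv_measure \<mu>) = (\<Sum>y\<in>range F. ennreal (cmod y) * emeasure (tv_measure \<mu>) (F -` {y}))"
proof -
  note F = simple_function_borelD[OF F]
  have "ennreal (cmod (F s)) = (\<Sum>y\<in>range F. ennreal (cmod y) * indicator (F -` {y}) s)" for s
  proof -
    have "(\<Sum>y\<in>range F. ennreal (cmod y) * indicator (F -` {y}) s) = (\<Sum>y\<in>range F. if y = F s then ennreal (cmod y) else 0)"
      by (intro sum.cong) (auto simp: indicator_def)
    also have "\<dots> = ennreal (cmod (F s))" using F by simp
    finally show ?thesis by simp
  qed
  then have "(\<integral>\<^sup>+s. ennreal (cmod (F s)) \<partial>tv_measure \<mu>) = (\<integral>\<^sup>+s. (\<Sum>y\<in>range F. ennreal (cmod y) * indicator (F -` {y}) s) \<partial>tv_measure \<mu>)"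
    by (rule nn_integral_cong)
  also have "\<dots> = (\<Sum>y\<in>range F. ennreal (cmod y) * emeasure (tv_measure \<mu>) (F -` {y}))"
    using F by (subst nn_integral_sum) (simp_all add: nn_integral_cmult_indicator)
  finally show ?thesis .
qed

text \<open>The four-part definition of the integral only yields a constant larger than \<open>1\<close>. The sharp constant is
  clear for simple functions, where the integral is \<open>\<Sum> y \<mu>(F = y)\<close>, and passes to the limit by dominated
  convergence.\<close>

lemma cmod_cint_le:
  assumes \<mu>: "vector_measure \<mu>" and f: "integrable (tv_measure \<mu>) f"
  shows "cmod (cint \<mu> f) \<le> (LINT s|tv_measure \<mu>. cmod (f s))"
proof -
  interpret T: finite_measure "tv_measure \<mu>" by (rule finite_measure_tv[OF \<mu>])
  have fm: "f \<in> borel_measurable borel"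
    using borel_measurable_integrable[OF f] by (simp cong: measurable_cong_sets)
  obtain F where F: "\<And>i. simple_function borel (F i)" "\<And>s. (\<lambda>i. F i s) \<longlonglongrightarrow> f s"
    "\<And>i s. cmod (F i s) \<le> 2 * cmod (f s)"
    using borel_measurable_implies_sequence_metric[OF fm, of 0] by auto
  have Fm: "F i \<in> borel_measurable borel" for i using F(1) by (rule borel_measurable_simple_function)
  have 1: "(\<lambda>i. cint \<mu> (F i)) \<longlonglongrightarrow> cint \<mu> f"
    by (rule cint_dominated[OF \<mu> integrable_mult_right[OF f, of 2]])
      (use F fm Fm in \<open>auto simp: norm_mult\<close>)
  have 2: "(\<lambda>i. LINT s|tv_measure \<mu>. cmod (F i s)) \<longlonglongrightarrow> (LINT s|tv_measure \<mu>. cmod (f s))"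
  proof (rule integral_dominated_convergence)
    show "integrable (tv_measure \<mu>) (\<lambda>s. 2 * cmod (f s))" using f by simp
    show "AE s in tv_measure \<mu>. (\<lambda>i. cmod (F i s)) \<longlonglongrightarrow> cmod (f s)" by (intro AE_I2 tendsto_norm F(2))
  qed (use F fm Fm in \<open>auto cong: measurable_cong_sets\<close>)
  have 3: "cmod (cint \<mu> (F i)) \<le> (LINT s|tv_measure \<mu>. cmod (F i s))" for i
  proof -
    note Fi = simple_function_borelD[OF F(1)[of i]]
    have "cmod (cint \<mu> (F i)) \<le> (\<Sum>y\<in>range (F i). cmod y * cmod (\<mu> (F i -` {y})))"
      unfolding cint_simple[OF \<mu> F(1) UNIV_in_borel]
      by (rule order_trans[OF norm_sum]) (simp add: norm_mult)
    also have "\<dots> \<le> (\<Sum>y\<in>range (F i). cmod y * measure (tv_measure \<mu>) (F i -` {y}))"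
    proof (intro sum_mono mult_left_mono)
      fix y
      have "ennreal (cmod (\<mu> (F i -` {y}))) \<le> emeasure (tv_measure \<mu>) (F i -` {y})"
        unfolding emeasure_tv_measure[OF \<mu> Fi(2)] total_variation_eq
        using Fi(2) vm_empty[OF \<mu>] by (intro le_variation[where \<tau> = "\<lambda>E. ennreal (cmod (\<mu> E))"]) auto
      then show "cmod (\<mu> (F i -` {y})) \<le> measure (tv_measure \<mu>) (F i -` {y})"
        by (simp add: T.emeasure_eq_measure)
    qed simp
    also have "\<dots> = (LINT s|tv_measure \<mu>. cmod (F i s))"
    proof -
      have "(\<integral>\<^sup>+s. ennreal (cmod (F i s)) \<partial>tv_measure \<mu>) = ennreal (\<Sum>y\<in>range (F i). cmod y * measure (tv_measure \<mu>) (F i -` {y}))"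
        unfolding nn_integral_simple_tv[OF F(1)] T.emeasure_eq_measure
        by (subst sum_ennreal[symmetric]) (auto simp: ennreal_mult)
      then show ?thesis using Fm
        by (subst integral_eq_nn_integral) (auto simp: sum_nonneg cong: measurable_cong_sets)
    qed
    finally show ?thesis .
  qed
  show ?thesis using 1 2 3 by (intro LIMSEQ_le[OF tendsto_norm[OF 1] 2]) auto
qed

lemma cint_cong_AE:
  assumes \<mu>: "vector_measure \<mu>" and [measurable]: "f \<in> borel_measurable borel" "g \<in> borel_measurable borel"
    and eq: "AE s in tv_measure \<mu>. f s = g s"
  shows "cint \<mu> f = cint \<mu> g"
proof -
  have "(LINT s|jordan_part \<mu> c. f s) = (LINT s|jordan_part \<mu> c. g s)" if "cmod c = 1" for c
    by (rule integral_cong_AE) (use AE_jordan_part[OF \<mu> that eq] in \<open>auto cong: measurable_cong_sets\<close>)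
  then show ?thesis by (simp add: cint_eq)
qed

section \<open>Integrals against a vector measure\<close>

abbreviation tv :: "('g::topological_space set \<Rightarrow> 'x) \<Rightarrow> ('x \<Rightarrow> complex) \<Rightarrow> 'g measure" where
  "tv \<nu> x' \<equiv> tv_measure (pairing \<nu> x')"

lemma vm_integral_eq: "is_vm_integral \<nu> A f x \<Longrightarrow> vm_integral \<nu> A f = x"
  unfolding vm_integral_def
proof (rule the_equality)
  show "y = x" if "is_vm_integral \<nu> A f x" "is_vm_integral \<nu> A f y" for y
    using that by (intro dual_separates) (simp add: is_vm_integral_def)
qed

lemma vm_pairing: "vector_measure \<nu> \<Longrightarrow> x' \<in> dual \<Longrightarrow> vector_measure (pairing \<nu> x')"
  by (rule vm_linear_image[OF _ dual_bounded_linear])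

lemma dual_sum: "x' \<in> dual \<Longrightarrow> x' (\<Sum>i\<in>I. f i) = (\<Sum>i\<in>I. x' (f i))"
  by (rule linear_sum[OF bounded_linear.linear[OF dual_bounded_linear]])

lemma pairing_vm_density_simple:
  assumes \<nu>: "vector_measure \<nu>" and \<phi>: "simple_function borel \<phi>" and A: "A \<in> sets borel" and x': "x' \<in> dual"
  shows "pairing (vm_density \<phi> \<nu>) x' A = (\<Sum>y\<in>range \<phi>. y * x' (\<nu> (A \<inter> \<phi> -` {y})))"
proof -
  have "is_vm_integral \<nu> A \<phi> (\<Sum>y\<in>range \<phi>. y *\<^sub>C \<nu> (A \<inter> \<phi> -` {y}))"
    unfolding is_vm_integral_def
    using cint_simple[OF vm_pairing[OF \<nu>] \<phi> A]
    by (simp add: dual_sum dual_scaleC)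
  from vm_integral_eq[OF this] show ?thesis using x' by (simp add: vm_density_def dual_sum dual_scaleC)
qed

lemma vm_restrict:
  fixes \<mu> :: "'g::topological_space set \<Rightarrow> 'x::real_normed_vector"
  assumes \<mu>: "vector_measure \<mu>" and E: "E \<in> sets borel"
  shows "vector_measure (\<lambda>A. \<mu> (A \<inter> E))"
  unfolding vector_measure_def
proof (intro allI impI)
  fix A :: "nat \<Rightarrow> 'g set" assume A: "range A \<subseteq> sets borel \<and> disjoint_family A"
  have UN: "(\<Union>n. A n) \<inter> E = (\<Union>n. A n \<inter> E)" by blast
  have "(\<lambda>n. \<mu> (A n \<inter> E)) sums \<mu> (\<Union>n. A n \<inter> E)"
  proof (rule vm_sums[OF \<mu>])
    show "range (\<lambda>n. A n \<inter> E) \<subseteq> sets borel" using A E by auto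
    show "disjoint_family (\<lambda>n. A n \<inter> E)" using A unfolding disjoint_family_on_def by blast
  qed
  then show "(\<lambda>n. \<mu> (A n \<inter> E)) sums \<mu> ((\<Union>n. A n) \<inter> E)" unfolding UN .
qed

lemma variation_cong: "(\<And>E. E \<in> sets borel \<Longrightarrow> E \<subseteq> A \<Longrightarrow> \<tau> E = \<tau>' E) \<Longrightarrow> variation \<tau> A = variation \<tau>' A"
  unfolding variation_def by (intro SUP_cong sum.cong refl) blast

lemma variation_mult: "variation (\<lambda>E. c * \<tau> E) A = c * variation \<tau> A"
  unfolding variation_def by (simp add: SUP_mult_left_ennreal sum_distrib_left)

text \<open>On the set where \<open>\<phi> = y\<close> the measure with density \<open>\<phi>\<close> is \<open>y\<close> times \<open>\<langle>\<nu>, x'\<rangle>\<close>; total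
  variation is additive over these finitely many sets.\<close>

lemma total_variation_simple_density:
  assumes \<nu>: "vector_measure \<nu>" and \<phi>: "simple_function borel \<phi>" and x': "x' \<in> dual"
  shows "total_variation (pairing (vm_density \<phi> \<nu>) x') UNIV = (\<integral>\<^sup>+s. ennreal (cmod (\<phi> s)) \<partial>tv \<nu> x')"
proof -
  note \<phi>' = simple_function_borelD[OF \<phi>]
  let ?\<mu> = "pairing \<nu> x'"
  note \<mu> = vm_pairing[OF \<nu> x']
  define \<kappa> where "\<kappa> A = (\<Sum>y\<in>range \<phi>. y * ?\<mu> (A \<inter> \<phi> -` {y}))" for A
  have \<kappa>: "vector_measure \<kappa>"
    using vm_mult[OF vm_restrict[OF \<mu> \<phi>'(2)]]
    unfolding \<kappa>_def vector_measure_def by (auto intro!: sums_sum)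
  have UN: "UNIV = (\<Union>y\<in>range \<phi>. \<phi> -` {y})" by auto
  have "total_variation (pairing (vm_density \<phi> \<nu>) x') UNIV = total_variation \<kappa> UNIV"
    unfolding total_variation_eq
    by (rule variation_cong) (simp add: pairing_vm_density_simple[OF \<nu> \<phi> _ x'] \<kappa>_def)
  also have "\<dots> = emeasure (tv_measure \<kappa>) (\<Union>y\<in>range \<phi>. \<phi> -` {y})"
    using emeasure_tv_measure[OF \<kappa> UNIV_in_borel] UN by simp
  also have "\<dots> = (\<Sum>y\<in>range \<phi>. emeasure (tv_measure \<kappa>) (\<phi> -` {y}))"
    using \<phi>' by (intro sum_emeasure[symmetric]) (auto simp: disjoint_family_on_def)
  also have "\<dots> = (\<Sum>y\<in>range \<phi>. ennreal (cmod y) * emeasure (tv_measure ?\<mu>) (\<phi> -` {y}))"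
  proof (rule sum.cong[OF refl])
    fix y assume y: "y \<in> range \<phi>"
    have "\<kappa> E = y * ?\<mu> E" if "E \<subseteq> \<phi> -` {y}" for E
    proof -
      have "\<kappa> E = (\<Sum>z\<in>range \<phi>. if z = y then y * ?\<mu> E else 0)"
        unfolding \<kappa>_def
      proof (rule sum.cong[OF refl])
        fix z assume "z \<in> range \<phi>"
        have "E \<inter> \<phi> -` {z} = (if z = y then E else {})" using that by auto
        then show "z * ?\<mu> (E \<inter> \<phi> -` {z}) = (if z = y then y * ?\<mu> E else 0)"
          using vm_empty[OF \<mu>] by simp
      qed
      then show ?thesis using y \<phi>'(1) by simp
    qed
    then have "variation (\<lambda>E. ennreal (cmod (\<kappa> E))) (\<phi> -` {y}) = variation (\<lambda>E. ennreal (cmod y) * ennreal (cmod (?\<mu> E))) (\<phi> -` {y})"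
      by (intro variation_cong) (simp add: norm_mult ennreal_mult)
    then show "emeasure (tv_measure \<kappa>) (\<phi> -` {y}) = ennreal (cmod y) * emeasure (tv_measure ?\<mu>) (\<phi> -` {y})"
      unfolding emeasure_tv_measure[OF \<kappa> \<phi>'(2)] emeasure_tv_measure[OF \<mu> \<phi>'(2)] total_variation_eq
      by (simp add: variation_mult)
  qed
  also have "\<dots> = (\<integral>\<^sup>+s. ennreal (cmod (\<phi> s)) \<partial>tv_measure ?\<mu>)" by (rule nn_integral_simple_tv[OF \<phi>, symmetric])
  finally show ?thesis .
qed

text \<open>The norm of \<open>L\<^sup>1\<^sub>w(\<nu>)\<close> as a functional on nonnegative extended functions, where monotone limits
  are available.\<close>

definition weak_integral :: "('g::topological_space set \<Rightarrow> 'x::complex_normed_vector) \<Rightarrow> ('g \<Rightarrow> ennreal) \<Rightarrow> ennreal" where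
  "weak_integral \<nu> u = (SUP x'\<in>dual_ball. \<integral>\<^sup>+ s. u s \<partial>tv \<nu> x')"

lemma L1_norm_eq: "L1_norm \<nu> f = weak_integral \<nu> (\<lambda>s. ennreal (cmod (f s)))"
  by (simp add: L1_norm_def weak_integral_def)

lemma semivariation_simple_density:
  assumes "vector_measure \<nu>" "simple_function borel \<phi>"
  shows "semivariation (vm_density \<phi> \<nu>) = weak_integral \<nu> (\<lambda>s. ennreal (cmod (\<phi> s)))"
  unfolding semivariation_def weak_integral_def
  using total_variation_simple_density[OF assms dual_ball_dual] by (intro SUP_cong) auto

lemma weak_integral_SUP:
  fixes S :: "nat \<Rightarrow> 'g::topological_space \<Rightarrow> ennreal"
  assumes "incseq S" "\<And>n. S n \<in> borel_measurable borel"
  shows "weak_integral \<nu> (\<lambda>s. SUP n. S n s) = (SUP n. weak_integral \<nu> (S n))"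
proof -
  have "(\<integral>\<^sup>+ s. (SUP n. S n s) \<partial>tv_measure \<mu>) = (SUP n. \<integral>\<^sup>+ s. S n s \<partial>tv_measure \<mu>)" for \<mu>
    using assms by (intro nn_integral_monotone_convergence_SUP) (auto cong: measurable_cong_sets)
  then show ?thesis unfolding weak_integral_def by (simp only: SUP_commute[of _ dual_ball])
qed

lemma variation_transport:
  fixes h k :: "'g::topological_space \<Rightarrow> 'g"
  assumes \<tau>: "\<tau> {} = 0" and h: "h \<in> borel \<rightarrow>\<^sub>M borel" and k: "k \<in> borel \<rightarrow>\<^sub>M borel"
    and hk: "\<And>x. h (k x) = x" "\<And>x. k (h x) = x" and A: "A \<in> sets borel"
  shows "variation (\<lambda>E. \<tau> (k -` E)) A = variation \<tau> (k -` A)"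
proof -
  have le: "variation (\<lambda>E. \<tau> (k -` E)) A \<le> variation \<tau> (k -` A)"
    if \<tau>: "\<tau> {} = 0" and k: "k \<in> borel \<rightarrow>\<^sub>M borel" and A: "A \<in> sets borel" for \<tau> :: "'g set \<Rightarrow> ennreal" and k :: "'g \<Rightarrow> 'g" and A
  proof (rule variation_le)
    fix P assume P: "finite P" "disjoint P" "P \<subseteq> sets borel" "\<Union>P = A"
    have m: "k -` E \<in> sets borel" if "E \<in> sets borel" for E using measurable_sets[OF k that] by simp
    show "(\<Sum>E\<in>P. \<tau> (k -` E)) \<le> variation \<tau> (k -` A)"
    proof (rule sum_le_variation[where \<tau> = \<tau>, OF \<tau>])
      show "disjoint_family_on (\<lambda>E. k -` E) P" using P(2) unfolding disjoint_family_on_def disjoint_def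
        by (metis vimage_Int vimage_empty)
    qed (use P m A in auto)
  qed
  have 1: "k -` h -` E = E" "h -` k -` E = E" for E using hk by auto
  have "variation (\<lambda>E. \<tau> (k -` h -` E)) (k -` A) \<le> variation (\<lambda>E. \<tau> (k -` E)) (h -` k -` A)"
    using le[of "\<lambda>E. \<tau> (k -` E)" h "k -` A"] \<tau> h measurable_sets[OF k A] by simp
  then show ?thesis using le[where \<tau> = \<tau>, OF \<tau> k A] by (simp add: 1)
qed

lemma weak_integral_transport:
  fixes \<nu> :: "'g::topological_space set \<Rightarrow> 'x::complex_normed_vector" and h k :: "'g \<Rightarrow> 'g"
  assumes \<nu>: "vector_measure \<nu>" and h: "h \<in> borel \<rightarrow>\<^sub>M borel" and k: "k \<in> borel \<rightarrow>\<^sub>M borel"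
    and hk: "\<And>x. h (k x) = x" "\<And>x. k (h x) = x" and u: "u \<in> borel_measurable borel"
  shows "vector_measure (vm_transport h \<nu>)"
    and "weak_integral (vm_transport h \<nu>) u = weak_integral \<nu> (\<lambda>s. u (k s))"
proof -
  have im: "h ` A = k -` A" for A
  proof
    show "h ` A \<subseteq> k -` A" using hk(2) by auto
    show "k -` A \<subseteq> h ` A" using hk(1) by (metis imageI subsetI vimage_eq)
  qed
  have kA: "k -` A \<in> sets borel" if "A \<in> sets borel" for A using measurable_sets[OF k that] by simp
  show \<nu>': "vector_measure (vm_transport h \<nu>)"
    unfolding vector_measure_def vm_transport_def im
  proof (intro allI impI)
    fix A :: "nat \<Rightarrow> 'g set" assume A: "range A \<subseteq> sets borel \<and> disjoint_family A"
    have "(\<lambda>n. \<nu> (k -` A n)) sums \<nu> (\<Union>n. k -` A n)"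
    proof (rule vm_sums[OF \<nu>])
      show "range (\<lambda>n. k -` A n) \<subseteq> sets borel" using A kA by auto
      show "disjoint_family (\<lambda>n. k -` A n)" using A unfolding disjoint_family_on_def by blast
    qed
    then show "(\<lambda>n. \<nu> (k -` A n)) sums \<nu> (k -` (\<Union>n. A n))" by (simp add: vimage_UN)
  qed
  have tv: "tv_measure (pairing (vm_transport h \<nu>) x') = distr (tv \<nu> x') borel k" if x': "x' \<in> dual_ball" for x'
  proof (rule measure_eqI)
    fix A assume "A \<in> sets (tv_measure (pairing (vm_transport h \<nu>) x'))"
    then have A: "A \<in> sets borel" by simp
    note \<mu> = vm_pairing[OF \<nu> dual_ball_dual[OF x']]
    note \<mu>' = vm_pairing[OF \<nu>' dual_ball_dual[OF x']]
    have "emeasure (tv_measure (pairing (vm_transport h \<nu>) x')) A = emeasure (tv \<nu> x') (k -` A)"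
      unfolding emeasure_tv_measure[OF \<mu>' A] emeasure_tv_measure[OF \<mu> kA[OF A]] total_variation_eq
      unfolding vm_transport_def im
      by (rule variation_transport[OF _ h k hk A, where \<tau> = "\<lambda>E. ennreal (cmod (x' (\<nu> E)))"])
        (use vm_empty[OF \<mu>] in simp)
    then show "emeasure (tv_measure (pairing (vm_transport h \<nu>) x')) A = emeasure (distr (tv \<nu> x') borel k) A"
      using A k by (simp add: emeasure_distr cong: measurable_cong_sets)
  qed simp
  show "weak_integral (vm_transport h \<nu>) u = weak_integral \<nu> (\<lambda>s. u (k s))"
    unfolding weak_integral_def using tv k u
    by (intro SUP_cong) (auto simp: nn_integral_distr cong: measurable_cong_sets)
qed

text \<open>Semivariation invariance is the case of simple functions. The supremum over the dual
  ball commutes with the supremum of an increasing sequence, so approximation from below by simple functions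
  gives the general case.\<close>

lemma weak_integral_invariant:
  fixes \<nu> :: "'g::topological_space set \<Rightarrow> 'x::complex_normed_vector"
  assumes \<nu>: "vector_measure \<nu>" and inv: "semivariation_invariant h \<nu>"
    and h: "h \<in> borel \<rightarrow>\<^sub>M borel" and k: "k \<in> borel \<rightarrow>\<^sub>M borel"
    and hk: "\<And>x. h (k x) = x" "\<And>x. k (h x) = x" and u: "u \<in> borel_measurable borel"
  shows "weak_integral \<nu> (\<lambda>s. u (k s)) = weak_integral \<nu> u"
proof -
  note tr = weak_integral_transport[OF \<nu> h k hk]
  obtain S where S: "\<And>i. simple_function borel (S i)" "incseq S" "\<And>i s. S i s < top" "\<And>s. (SUP i. S i s) = u s"
    using borel_measurable_implies_simple_function_sequence'[OF u] by metis
  have Sm: "S i \<in> borel_measurable borel" for i using S(1) by (rule borel_measurable_simple_function)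
  have *: "weak_integral \<nu> (\<lambda>s. S i (k s)) = weak_integral \<nu> (S i)" for i
  proof -
    define \<phi> where "\<phi> s = complex_of_real (enn2real (S i s))" for s
    have sf: "simple_function borel \<phi>"
      unfolding \<phi>_def using simple_function_compose1[OF S(1)[of i], of "\<lambda>x. complex_of_real (enn2real x)"] by simp
    have c: "ennreal (cmod (\<phi> s)) = S i s" for s using S(3)[of i s] by (simp add: \<phi>_def)
    have "weak_integral \<nu> (\<lambda>s. S i (k s)) = weak_integral (vm_transport h \<nu>) (S i)"
      by (rule tr(2)[OF Sm, symmetric])
    also have "\<dots> = semivariation (vm_density \<phi> (vm_transport h \<nu>))"
      using semivariation_simple_density[OF tr(1)[OF Sm] sf] by (simp add: c)
    also have "\<dots> = semivariation (vm_density \<phi> \<nu>)" using inv sf by (simp add: semivariation_invariant_def)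
    also have "\<dots> = weak_integral \<nu> (S i)" using semivariation_simple_density[OF \<nu> sf] by (simp add: c)
    finally show ?thesis .
  qed
  have "weak_integral \<nu> (\<lambda>s. SUP i. S i (k s)) = (SUP i. weak_integral \<nu> (\<lambda>s. S i (k s)))"
    using S(2) measurable_compose[OF k Sm] by (intro weak_integral_SUP) (auto simp: incseq_def le_fun_def)
  also have "\<dots> = (SUP i. weak_integral \<nu> (S i))" by (simp add: *)
  also have "\<dots> = weak_integral \<nu> (\<lambda>s. SUP i. S i s)" by (rule weak_integral_SUP[OF S(2) Sm, symmetric])
  finally show ?thesis by (simp add: S(4))
qed

section \<open>Haar measure of a compact group\<close>

text \<open>The Borel sets of the product of two large compact spaces may exceed the product
  \<open>\<sigma>\<close>-algebra. A set \<open>{z. c \<le> h z}\<close> is nevertheless in it: being compact, it is separated from the complement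
  of each of its open neighbourhoods \<open>{z. c - 1/n < h z}\<close> by a finite union of open boxes, and it is the intersection of
  these neighbourhoods.\<close>

lemma continuous_prod_measurable:
  fixes h :: "'a::topological_space \<times> 'b::topological_space \<Rightarrow> real"
  assumes cpt: "compact (UNIV :: ('a \<times> 'b) set)" and h: "continuous_on UNIV h"
  shows "h \<in> borel_measurable (borel \<Otimes>\<^sub>M borel)"
proof (subst borel_measurable_iff_ge, intro allI)
  fix c :: real
  let ?C = "{z. c \<le> h z}"
  define O' where "O' n = {z. c - 1 / real (Suc n) < h z}" for n
  have C: "compact ?C"
    using compact_Int_closed[OF cpt, of ?C] closed_Collect_le[OF continuous_on_const h] by simp
  have O': "open (O' n)" for n unfolding O'_def by (intro open_Collect_less continuous_intros h)
  have "\<exists>P. P \<in> sets (borel \<Otimes>\<^sub>M borel) \<and> ?C \<subseteq> P \<and> P \<subseteq> O' n" for n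
  proof -
    have CO: "?C \<subseteq> O' n" by (auto simp: O'_def intro: less_le_trans[rotated])
    let ?B = "{A \<times> B | A B. open A \<and> open B \<and> A \<times> B \<subseteq> O' n}"
    have cover: "?C \<subseteq> \<Union>?B"
    proof
      fix z assume "z \<in> ?C"
      then have "z \<in> O' n" using CO by auto
      from open_prod_elim[OF O' this] obtain A B where "open A" "open B" "z \<in> A \<times> B" "A \<times> B \<subseteq> O' n" .
      then show "z \<in> \<Union>?B" by (intro UnionI[of "A \<times> B"]) auto
    qed
    have op: "open E" if "E \<in> ?B" for E
    proof -
      obtain A B where "E = A \<times> B" "open A" "open B" using \<open>E \<in> ?B\<close> by blast
      then show ?thesis by (simp add: open_Times)
    qed
    obtain D where D: "D \<subseteq> ?B" "finite D" "?C \<subseteq> \<Union>D" by (rule compactE[OF C cover op])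
    have "E \<in> sets (borel \<Otimes>\<^sub>M borel)" if "E \<in> D" for E
    proof -
      have "E \<in> ?B" by (rule subsetD[OF D(1) \<open>E \<in> D\<close>])
      then obtain A B where "E = A \<times> B" "open A" "open B" by blast
      then show ?thesis by (simp add: pair_measureI)
    qed
    then have "\<Union>D \<in> sets (borel \<Otimes>\<^sub>M borel)" using D(2) by (intro sets.finite_Union) auto
    moreover have "\<Union>D \<subseteq> O' n"
    proof (rule Union_least)
      fix E assume "E \<in> D"
      then have "E \<in> ?B" by (rule subsetD[OF D(1)])
      then obtain A B where "E = A \<times> B" "A \<times> B \<subseteq> O' n" by blast
      then show "E \<subseteq> O' n" by simp
    qed
    ultimately show ?thesis using D(3) by (intro exI[of _ "\<Union>D"] conjI)
  qed
  then obtain P where P: "\<And>n. P n \<in> sets (borel \<Otimes>\<^sub>M borel)" "\<And>n. ?C \<subseteq> P n" "\<And>n. P n \<subseteq> O' n" by metis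
  have "(\<Inter>n. O' n) \<subseteq> ?C"
  proof
    fix z assume z: "z \<in> (\<Inter>n. O' n)"
    have "c \<le> h z + e" if e: "e > 0" for e
    proof -
      obtain n where "1 / real (Suc n) < e" by (rule nat_approx_posE[OF e])
      moreover have "c - 1 / real (Suc n) < h z" using z by (simp add: O'_def)
      ultimately show ?thesis by linarith
    qed
    then show "z \<in> ?C" using field_le_epsilon by blast
  qed
  moreover have "(\<Inter>n. P n) \<subseteq> (\<Inter>n. O' n)" by (rule INF_mono) (use P(3) in auto)
  ultimately have "(\<Inter>n. P n) \<subseteq> ?C" by (rule order_trans[rotated])
  moreover have "?C \<subseteq> (\<Inter>n. P n)" using P(2) by (intro INT_greatest)
  ultimately have "?C = (\<Inter>n. P n)" by (rule equalityI[rotated])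
  then show "{w \<in> space (borel \<Otimes>\<^sub>M borel). c \<le> h w} \<in> sets (borel \<Otimes>\<^sub>M borel)"
    using P(1) by (simp add: space_pair_measure)
qed

lemma continuous_separation:
  fixes K U :: "'g::t2_space set"
  assumes cpt: "compact (UNIV :: 'g set)" and K: "closed K" and U: "open U" "K \<subseteq> U"
  obtains \<phi> :: "'g \<Rightarrow> real" where "continuous_on UNIV \<phi>" "K \<subseteq> {x. 1 \<le> \<phi> x}" "{x. 1 \<le> \<phi> x} \<subseteq> U"
proof -
  have n: "normal_space (euclidean :: 'g topology)"
  proof (intro compact_Hausdorff_or_regular_imp_normal_space disjI1)
    show "compact_space (euclidean :: 'g topology)" using cpt by (simp add: compact_space_def)
    show "Hausdorff_space (euclidean :: 'g topology)"
      unfolding Hausdorff_space_def disjnt_def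
    proof (intro allI impI)
      fix x y :: 'g assume "x \<in> topspace euclidean \<and> y \<in> topspace euclidean \<and> x \<noteq> y"
      then obtain U V where "open U" "open V" "x \<in> U" "y \<in> V" "U \<inter> V = {}" using hausdorff[of x y] by blast
      then show "\<exists>U V. openin euclidean U \<and> openin euclidean V \<and> x \<in> U \<and> y \<in> V \<and> U \<inter> V = {}"
        by (intro exI[of _ U] exI[of _ V]) simp
    qed
  qed
  obtain \<phi> where \<phi>: "continuous_map euclidean (top_of_set {0..1::real}) \<phi>" "\<phi> ` (- U) \<subseteq> {0}" "\<phi> ` K \<subseteq> {1}"
    by (rule Urysohn_lemma[OF n, of "- U" K 0 1]) (use K U in \<open>auto simp: disjnt_def\<close>)
  show ?thesis
  proof
    show "continuous_on UNIV \<phi>" using continuous_map_into_fulltopology[OF \<phi>(1)] by simp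
    show "K \<subseteq> {x. 1 \<le> \<phi> x}" using \<phi>(3) by auto
    show "{x. 1 \<le> \<phi> x} \<subseteq> U" using \<phi>(2) by force
  qed
qed

locale compact_haar =
  fixes m :: "'g::{topological_group_add, t2_space} measure"
  assumes compact_UNIV: "compact (UNIV :: 'g set)" and haar: "normalized_haar m"
begin

lemma sets_haar[simp, measurable_cong]: "sets m = sets borel"
  using haar by (simp add: normalized_haar_def)

lemma space_haar[simp]: "space m = UNIV"
  by (simp add: sets_eq_imp_space_eq[OF sets_haar])

lemma emeasure_haar_UNIV[simp]: "emeasure m UNIV = 1"
  using haar by (simp add: normalized_haar_def)

sublocale finite_measure m by (rule finite_measureI) simp

lemma measurable_diff_left: "(\<lambda>s. t - s) \<in> borel \<rightarrow>\<^sub>M (borel :: 'g measure)"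
  by (intro borel_measurable_continuous_onI continuous_intros)

lemma measurable_diff_right: "(\<lambda>s. s - t) \<in> borel \<rightarrow>\<^sub>M (borel :: 'g measure)"
  by (intro borel_measurable_continuous_onI continuous_intros)

lemma measurable_add_right: "(\<lambda>s. s + t) \<in> borel \<rightarrow>\<^sub>M (borel :: 'g measure)"
  by (intro borel_measurable_continuous_onI continuous_intros)

lemma measurable_uminus: "uminus \<in> borel \<rightarrow>\<^sub>M (borel :: 'g measure)"
  by (intro borel_measurable_continuous_onI continuous_intros)

lemma uminus_vimage_borel: "A \<in> sets borel \<Longrightarrow> uminus -` A \<in> sets (borel :: 'g measure)"
  using measurable_sets[OF measurable_uminus, of A] by simp

lemma left_invariant:
  assumes "A \<in> sets borel" shows "emeasure m ((+) t -` A) = emeasure m A"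
proof -
  have "(+) t -` A = (+) (- t) ` A"
    by (auto simp: image_iff) (metis add.assoc add.left_neutral left_minus)
  then show ?thesis using haar assms by (simp add: normalized_haar_def)
qed

lemma outer_regular: "A \<in> sets borel \<Longrightarrow> emeasure m A = (INF U\<in>{U. open U \<and> A \<subseteq> U}. emeasure m U)"
  using haar unfolding normalized_haar_def by blast

lemma inner_regular: "A \<in> sets borel \<Longrightarrow> emeasure m A = (SUP K\<in>{K. compact K \<and> K \<subseteq> A}. emeasure m K)"
  using haar unfolding normalized_haar_def by blast

text \<open>Borel functions \<open>u\<close> for which Fubini's theorem may be applied to \<open>u (t - s)\<close>.\<close>

definition difference_measurable :: "('g \<Rightarrow> 'b::topological_space) \<Rightarrow> bool" where
  "difference_measurable u \<longleftrightarrow> u \<in> borel_measurable borel \<and> (\<lambda>(t, s). u (t - s)) \<in> borel_measurable (borel \<Otimes>\<^sub>M borel)"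

lemma continuous_difference_measurable:
  fixes \<phi> :: "'g \<Rightarrow> real"
  assumes "continuous_on UNIV \<phi>" shows "difference_measurable \<phi>"
proof -
  have "continuous_on UNIV (\<lambda>z::'g \<times> 'g. \<phi> (fst z - snd z))"
    by (rule continuous_on_compose2[OF assms]) (intro continuous_intros, simp)
  moreover have "compact (UNIV :: ('g \<times> 'g) set)"
    using compact_Times[OF compact_UNIV compact_UNIV] by simp
  ultimately show ?thesis using assms
    by (auto simp: difference_measurable_def case_prod_unfold intro: continuous_prod_measurable borel_measurable_continuous_onI)
qed

text \<open>Let \<open>n\<close> be the image of \<open>m\<close> under inversion, a right invariant measure, and \<open>C\<close> the level set.
  The product measure of \<open>{(t, s). t - s \<in> C}\<close> under \<open>n\<close> and \<open>n\<close> is \<open>n C\<close> if the integration over \<open>t\<close> is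
  carried out first, and \<open>m C\<close> if the one over \<open>s\<close> is.\<close>

lemma emeasure_level_uminus:
  assumes \<phi>: "continuous_on UNIV (\<phi> :: 'g \<Rightarrow> real)"
  shows "emeasure m {x. c \<le> \<phi> x} = emeasure m (uminus -` {x. c \<le> \<phi> x})"
proof -
  let ?C = "{x. c \<le> \<phi> x}"
  define n where "n = distr m borel uminus"
  have n_sets[simp, measurable_cong]: "sets n = sets borel" by (simp add: n_def)
  have n_em: "emeasure n A = emeasure m (uminus -` A)" if "A \<in> sets borel" for A
    unfolding n_def using that measurable_uminus by (simp add: emeasure_distr cong: measurable_cong_sets)
  have n1: "emeasure n UNIV = 1" using n_em[of UNIV] UNIV_in_borel by simp
  have n_space[simp]: "space n = UNIV" by (simp add: n_def)
  interpret N: finite_measure n by (rule finite_measureI) (simp add: n1)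
  interpret NN: pair_sigma_finite n n ..
  have Cm: "?C \<in> sets borel" using continuous_difference_measurable[OF \<phi>]
    by (simp add: difference_measurable_def borel_measurable_iff_ge)
  have k: "(\<lambda>(t, s). indicator ?C (t - s) :: ennreal) \<in> borel_measurable (n \<Otimes>\<^sub>M n)"
  proof -
    have [measurable]: "(\<lambda>(t, s). \<phi> (t - s)) \<in> borel_measurable (borel \<Otimes>\<^sub>M borel)"
      using continuous_difference_measurable[OF \<phi>] by (simp add: difference_measurable_def)
    have "(\<lambda>z. if c \<le> (case z of (t, s) \<Rightarrow> \<phi> (t - s)) then 1 else 0 :: ennreal) \<in> borel_measurable (borel \<Otimes>\<^sub>M borel)"
      by measurable
    then show ?thesis by (simp add: indicator_def of_bool_def case_prod_unfold cong: measurable_cong_sets)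
  qed
  have 1: "(\<integral>\<^sup>+t. indicator ?C (t - s) \<partial>n) = emeasure n ?C" for s
  proof -
    have "(\<integral>\<^sup>+t. indicator ?C (t - s) \<partial>n) = (\<integral>\<^sup>+t. indicator ((\<lambda>t. t - s) -` ?C) t \<partial>n)"
      by (simp add: indicator_def)
    also have "\<dots> = emeasure n ((\<lambda>t. t - s) -` ?C)"
      using measurable_sets[OF measurable_diff_right Cm, of s] by (intro nn_integral_indicator) simp
    also have "\<dots> = emeasure m (uminus -` (\<lambda>t. t - s) -` ?C)"
      using measurable_sets[OF measurable_diff_right Cm, of s] by (intro n_em) simp
    also have "uminus -` (\<lambda>t. t - s) -` ?C = (+) s -` (uminus -` ?C)" by (auto simp: minus_add)
    also have "emeasure m \<dots> = emeasure n ?C"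
      using left_invariant[OF uminus_vimage_borel[OF Cm]] n_em[OF Cm] by simp
    finally show ?thesis .
  qed
  have 2: "(\<integral>\<^sup>+s. indicator ?C (t - s) \<partial>n) = emeasure m ?C" for t
  proof -
    have "(\<integral>\<^sup>+s. indicator ?C (t - s) \<partial>n) = (\<integral>\<^sup>+s. indicator ((\<lambda>s. t - s) -` ?C) s \<partial>n)"
      by (simp add: indicator_def)
    also have "\<dots> = emeasure n ((\<lambda>s. t - s) -` ?C)"
      using measurable_sets[OF measurable_diff_left Cm, of t] by (intro nn_integral_indicator) simp
    also have "\<dots> = emeasure m (uminus -` (\<lambda>s. t - s) -` ?C)"
      using measurable_sets[OF measurable_diff_left Cm, of t] by (intro n_em) simp
    also have "uminus -` (\<lambda>s. t - s) -` ?C = (+) t -` ?C" by auto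
    finally show ?thesis using left_invariant[OF Cm] by simp
  qed
  have "(\<integral>\<^sup>+s. (\<integral>\<^sup>+t. indicator ?C (t - s) \<partial>n) \<partial>n) = (\<integral>\<^sup>+t. (\<integral>\<^sup>+s. indicator ?C (t - s) \<partial>n) \<partial>n)"
    by (rule NN.Fubini'[OF k])
  then show ?thesis by (simp add: 1 2 n1 n_em[OF Cm])
qed

text \<open>Haar measure of a compact group is inversion invariant. Between a compact set and an
  open neighbourhood lies a level set of a continuous function, for which this is known; regularity
  does the rest.\<close>

lemma emeasure_uminus:
  assumes A: "A \<in> sets borel" shows "emeasure m (uminus -` A) = emeasure m A"
proof -
  have K: "emeasure m K \<le> emeasure m (uminus -` K)" if K: "compact K" for K
  proof -
    have Kc: "closed K" using compact_imp_closed[OF K] .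
    have Km: "uminus -` K \<in> sets borel" using Kc by (intro uminus_vimage_borel borel_closed)
    show ?thesis unfolding outer_regular[OF Km]
    proof (rule INF_greatest)
      fix V assume V: "V \<in> {U. open U \<and> uminus -` K \<subseteq> U}"
      then have U: "open (uminus -` V)" by (intro open_vimage continuous_intros) auto
      have "- x \<in> uminus -` K" if "x \<in> K" for x using that by simp
      then have "K \<subseteq> uminus -` V" using V by blast
      from continuous_separation[OF compact_UNIV Kc U this] obtain \<phi> :: "'g \<Rightarrow> real"
        where \<phi>: "continuous_on UNIV \<phi>" "K \<subseteq> {x. 1 \<le> \<phi> x}" "{x. 1 \<le> \<phi> x} \<subseteq> uminus -` V" by metis
      have Cm: "{x. 1 \<le> \<phi> x} \<in> sets borel" using continuous_difference_measurable[OF \<phi>(1)]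
        by (simp add: difference_measurable_def borel_measurable_iff_ge)
      have "emeasure m K \<le> emeasure m {x. 1 \<le> \<phi> x}" using \<phi> Cm by (intro emeasure_mono) auto
      also have "\<dots> = emeasure m (uminus -` {x. 1 \<le> \<phi> x})" by (rule emeasure_level_uminus[OF \<phi>(1)])
      also have "\<dots> \<le> emeasure m V" using \<phi> V by (intro emeasure_mono) force+
      finally show "emeasure m K \<le> emeasure m V" .
    qed
  qed
  have le: "emeasure m A \<le> emeasure m (uminus -` A)" if A: "A \<in> sets borel" for A
    unfolding inner_regular[OF A]
  proof (rule SUP_least)
    fix K assume "K \<in> {K. compact K \<and> K \<subseteq> A}"
    then have "compact K" "K \<subseteq> A" by auto
    then have "emeasure m (uminus -` K) \<le> emeasure m (uminus -` A)"
      using uminus_vimage_borel[OF A] by (intro emeasure_mono) auto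
    with K[OF \<open>compact K\<close>] show "emeasure m K \<le> emeasure m (uminus -` A)" by (rule order_trans)
  qed
  have "uminus -` uminus -` A = A" by auto
  with le[OF A] le[OF uminus_vimage_borel[OF A]] show ?thesis by simp
qed

lemma distr_diff_right: "distr m borel (\<lambda>t. t - s) = m"
proof (rule measure_eqI)
  fix A assume "A \<in> sets (distr m borel (\<lambda>t. t - s))"
  then have A: "A \<in> sets borel" by simp
  have "emeasure (distr m borel (\<lambda>t. t - s)) A = emeasure m ((\<lambda>t. t - s) -` A)"
    using A measurable_diff_right by (simp add: emeasure_distr cong: measurable_cong_sets)
  also have "\<dots> = emeasure m (uminus -` (\<lambda>t. t - s) -` A)"
    using measurable_sets[OF measurable_diff_right A, of s] by (intro emeasure_uminus[symmetric]) simp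
  also have "uminus -` (\<lambda>t. t - s) -` A = (+) s -` (uminus -` A)"
    by (auto simp: minus_add)
  also have "emeasure m \<dots> = emeasure m A"
    using left_invariant[OF uminus_vimage_borel[OF A]] emeasure_uminus[OF A] by simp
  finally show "emeasure (distr m borel (\<lambda>t. t - s)) A = emeasure m A" .
qed simp

lemma distr_diff_left: "distr m borel (\<lambda>s. t - s) = m"
proof (rule measure_eqI)
  fix A assume "A \<in> sets (distr m borel (\<lambda>s. t - s))"
  then have A: "A \<in> sets borel" by simp
  have "emeasure (distr m borel (\<lambda>s. t - s)) A = emeasure m ((\<lambda>s. t - s) -` A)"
    using A measurable_diff_left by (simp add: emeasure_distr cong: measurable_cong_sets)
  also have "\<dots> = emeasure m (uminus -` (\<lambda>s. t - s) -` A)"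
    using measurable_sets[OF measurable_diff_left A, of t] by (intro emeasure_uminus[symmetric]) simp
  also have "uminus -` (\<lambda>s. t - s) -` A = (+) t -` A" by auto
  also have "emeasure m \<dots> = emeasure m A" by (rule left_invariant[OF A])
  finally show "emeasure (distr m borel (\<lambda>s. t - s)) A = emeasure m A" .
qed simp

lemma AE_diff_left:
  assumes "AE x in m. Q x" shows "AE s in m. Q (t - s)"
proof (rule AE_distrD[where M' = borel and f = "\<lambda>s. t - s"])
  show "AE s in distr m borel (\<lambda>s. t - s). Q s" unfolding distr_diff_left by (rule assms)
qed (use measurable_diff_left in \<open>simp cong: measurable_cong_sets\<close>)


lemma nn_integral_diff_right:
  assumes u: "u \<in> borel_measurable borel" shows "(\<integral>\<^sup>+t. u (t - s) \<partial>m) = (\<integral>\<^sup>+x. u x \<partial>m)"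
proof -
  have "(\<integral>\<^sup>+x. u x \<partial>m) = (\<integral>\<^sup>+x. u x \<partial>distr m borel (\<lambda>t. t - s))" by (simp add: distr_diff_right)
  also have "\<dots> = (\<integral>\<^sup>+t. u (t - s) \<partial>m)"
    using u measurable_diff_right by (intro nn_integral_distr) (auto cong: measurable_cong_sets)
  finally show ?thesis by simp
qed

definition difference_set :: "'g set \<Rightarrow> bool" where
  "difference_set A \<longleftrightarrow> A \<in> sets borel \<and> {z. fst z - snd z \<in> A} \<in> sets (borel \<Otimes>\<^sub>M borel)"

text \<open>The sets with this property form a \<open>\<sigma>\<close>-algebra. It contains every closed \<open>K\<close>: outer
  regularity and Urysohn functions provide a compact \<open>G\<^sub>\<delta>\<close> set of the same measure that contains \<open>K\<close>.\<close>

lemma difference_set_ex: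
  assumes "A \<in> sets borel"
  shows "\<exists>B. difference_set B \<and> (AE x in m. x \<in> A \<longleftrightarrow> x \<in> B)"
proof -
  have "A \<in> sigma_sets UNIV (Collect closed)"
    using assms by (simp add: borel_eq_closed)
  then show ?thesis
  proof induction
    case (Basic K)
    then have K: "closed K" by simp
    then have Km: "K \<in> sets borel" by simp
    have "\<exists>U. open U \<and> K \<subseteq> U \<and> emeasure m U < emeasure m K + ennreal (1 / Suc n)" for n
    proof -
      have "(INF U\<in>{U. open U \<and> K \<subseteq> U}. emeasure m U) < emeasure m K + ennreal (1 / Suc n)"
        unfolding outer_regular[OF Km, symmetric]
        by (simp add: emeasure_eq_measure ennreal_less_iff flip: ennreal_plus)
      then show ?thesis unfolding INF_less_iff by auto
    qed
    then obtain U where U: "\<And>n. open (U n)" "\<And>n. K \<subseteq> U n" "\<And>n. emeasure m (U n) < emeasure m K + ennreal (1 / Suc n)"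
      by metis
    have "\<exists>\<phi>::'g \<Rightarrow> real. continuous_on UNIV \<phi> \<and> K \<subseteq> {x. 1 \<le> \<phi> x} \<and> {x. 1 \<le> \<phi> x} \<subseteq> U n" for n
      using continuous_separation[OF compact_UNIV K U(1,2)[of n]] by metis
    then obtain \<phi> :: "nat \<Rightarrow> 'g \<Rightarrow> real" where \<phi>: "\<And>n. continuous_on UNIV (\<phi> n)"
      "\<And>n. K \<subseteq> {x. 1 \<le> \<phi> n x}" "\<And>n. {x. 1 \<le> \<phi> n x} \<subseteq> U n" by metis
    define B where "B = (\<Inter>n. {x. 1 \<le> \<phi> n x})"
    have 1: "difference_set {x. 1 \<le> \<phi> n x}" for n
      using continuous_difference_measurable[OF \<phi>(1)[of n]]
      by (simp add: difference_measurable_def difference_set_def borel_measurable_iff_ge case_prod_unfold space_pair_measure)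
    have B: "difference_set B"
    proof -
      have "{z. fst z - snd z \<in> B} = (\<Inter>n. {z. fst z - snd z \<in> {x. 1 \<le> \<phi> n x}})" by (auto simp: B_def)
      moreover have "(\<Inter>n. {z. fst z - snd z \<in> {x. 1 \<le> \<phi> n x}}) \<in> sets (borel \<Otimes>\<^sub>M borel)"
        using 1 unfolding difference_set_def by (intro sets.countable_INT) auto
      moreover have "B \<in> sets borel" unfolding B_def using 1 unfolding difference_set_def by (intro sets.countable_INT) auto
      ultimately show ?thesis by (simp add: difference_set_def)
    qed
    have KB: "K \<subseteq> B" using \<phi>(2) by (auto simp: B_def)
    have Bm: "B \<in> sets borel" using B by (simp add: difference_set_def)
    have "emeasure m B \<le> emeasure m K + ennreal e" if e: "e > 0" for e
    proof -
      obtain n where n: "1 / real (Suc n) < e" by (rule nat_approx_posE[OF e])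
      have "B \<subseteq> U n" using \<phi>(3)[of n] by (auto simp: B_def)
      then have "emeasure m B \<le> emeasure m (U n)" using U(1) by (intro emeasure_mono) auto
      also have "\<dots> \<le> emeasure m K + ennreal (1 / Suc n)" using U(3)[of n] by simp
      also have "\<dots> \<le> emeasure m K + ennreal e" using n by (intro add_left_mono ennreal_leI) simp
      finally show ?thesis .
    qed
    then have "emeasure m B \<le> emeasure m K" by (rule ennreal_le_epsilon)
    then have "emeasure m (B - K) = 0"
      using KB Km Bm by (subst emeasure_Diff) (auto simp: diff_eq_0_iff_ennreal less_top[symmetric])
    then have "AE x in m. x \<notin> B - K" using Km Bm by (intro AE_not_in) (auto simp: null_sets_def)
    then have "AE x in m. x \<in> K \<longleftrightarrow> x \<in> B" using KB by (auto elim: eventually_mono)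
    with B show ?case by blast
  next
    case Empty
    then show ?case by (intro exI[of _ "{}"]) (simp add: difference_set_def)
  next
    case (Compl A)
    then obtain B where B: "difference_set B" "AE x in m. x \<in> A \<longleftrightarrow> x \<in> B" by blast
    have "{z. fst z - snd z \<in> UNIV - B} = space (borel \<Otimes>\<^sub>M borel) - {z. fst z - snd z \<in> B}" by (auto simp: space_pair_measure)
    moreover have "space (borel \<Otimes>\<^sub>M borel) - {z. fst z - snd z \<in> B} \<in> sets (borel \<Otimes>\<^sub>M borel)"
      using B(1) unfolding difference_set_def by (intro sets.Diff sets.top) simp
    moreover have "UNIV - B \<in> sets borel"
      using B(1) UNIV_in_borel unfolding difference_set_def by (intro sets.Diff) simp_all
    ultimately have "difference_set (UNIV - B)" unfolding difference_set_def by simp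
    then show ?case using B(2) by (intro exI[of _ "UNIV - B"]) auto
  next
    case (Union A)
    then obtain B where B: "\<And>n. difference_set (B n)" "\<And>n. AE x in m. x \<in> A n \<longleftrightarrow> x \<in> B n" by metis
    have "{z. fst z - snd z \<in> (\<Union>n. B n)} = (\<Union>n. {z. fst z - snd z \<in> B n})" by auto
    then have "difference_set (\<Union>n. B n)" using B(1) unfolding difference_set_def by auto
    moreover have "AE x in m. \<forall>n. x \<in> A n \<longleftrightarrow> x \<in> B n" using B(2) by (simp add: AE_all_countable)
    then have "AE x in m. x \<in> (\<Union>n. A n) \<longleftrightarrow> x \<in> (\<Union>n. B n)" by (auto elim!: eventually_mono)
    ultimately show ?case by blast
  qed
qed

lemma difference_measurable_ex_ennreal:
  fixes u :: "'g \<Rightarrow> ennreal"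
  assumes "u \<in> borel_measurable borel"
  shows "\<exists>v. difference_measurable v \<and> (AE x in m. u x = v x)"
  using assms
proof (induction rule: borel_measurable_induct)
  case (cong f g)
  then have "f = g" by auto
  with cong show ?case by simp
next
  case (set A)
  from difference_set_ex[OF set] obtain B where B: "difference_set B" "AE x in m. x \<in> A \<longleftrightarrow> x \<in> B" by blast
  have "(\<lambda>(t, s). indicator B (t - s) :: ennreal) = indicator {z. fst z - snd z \<in> B}"
    by (auto simp: indicator_def)
  then have "difference_measurable (indicator B :: 'g \<Rightarrow> ennreal)"
    using B(1) unfolding difference_measurable_def difference_set_def
    by (auto simp: borel_measurable_indicator)
  moreover have "AE x in m. indicator A x = (indicator B x :: ennreal)"
    using B(2) by (auto elim!: eventually_mono simp: indicator_def)
  ultimately show ?case by blast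
next
  case (mult u c)
  then obtain v where v: "difference_measurable v" "AE x in m. u x = v x" by blast
  have "difference_measurable (\<lambda>x. c * v x)"
    using v(1) by (auto simp: difference_measurable_def case_prod_unfold)
  with v(2) show ?case by (intro exI[of _ "\<lambda>x. c * v x"]) auto
next
  case (add u v)
  then obtain a b where ab: "difference_measurable a" "AE x in m. u x = a x"
    "difference_measurable b" "AE x in m. v x = b x" by blast
  have "difference_measurable (\<lambda>x. b x + a x)"
    using ab(1,3) by (auto simp: difference_measurable_def case_prod_unfold)
  moreover have "AE x in m. v x + u x = b x + a x" using ab(2,4) by auto
  ultimately show ?case by blast
next
  case (seq U)
  then obtain V where V: "\<And>i. difference_measurable (V i)" "\<And>i. AE x in m. U i x = V i x" by metis
  have "V i \<in> borel_measurable borel" "(\<lambda>p. V i (fst p - snd p)) \<in> borel_measurable (borel \<Otimes>\<^sub>M borel)" for i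
    using V(1)[of i] by (simp_all add: difference_measurable_def case_prod_unfold)
  then have "difference_measurable (\<lambda>x. SUP i. V i x)"
    unfolding difference_measurable_def case_prod_unfold
    by (intro conjI borel_measurable_SUP) simp_all
  moreover have "AE x in m. \<forall>i. U i x = V i x" using V(2) by (simp add: AE_all_countable)
  then have "AE x in m. (SUP i. U i) x = (SUP i. V i x)" by (auto elim!: eventually_mono simp: SUP_apply image_image)
  ultimately show ?case by blast
qed

text \<open>On a group without countable base \<open>f (t - s)\<close> need not be measurable for the product
  \<open>\<sigma>\<close>-algebra; after a change of \<open>f\<close> on a null set it is.\<close>

lemma difference_measurable_ex:
  fixes f :: "'g \<Rightarrow> complex"
  assumes [measurable]: "f \<in> borel_measurable borel"
  obtains f\<^sub>0 where "difference_measurable f\<^sub>0" "AE x in m. f x = f\<^sub>0 x"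
proof -
  have "\<exists>v. difference_measurable v \<and> (AE x in m. ennreal (T (f x)) = v x)" if "T \<in> borel_measurable borel" for T :: "complex \<Rightarrow> real"
    using measurable_compose[OF assms that] by (intro difference_measurable_ex_ennreal) simp
  note * = this
  obtain a where a: "difference_measurable a" "AE x in m. ennreal (Re (f x)) = a x" using *[of Re] by auto
  obtain b where b: "difference_measurable b" "AE x in m. ennreal (- Re (f x)) = b x" using *[of "\<lambda>z. - Re z"] by auto
  obtain c where c: "difference_measurable c" "AE x in m. ennreal (Im (f x)) = c x" using *[of Im] by auto
  obtain d where d: "difference_measurable d" "AE x in m. ennreal (- Im (f x)) = d x" using *[of "\<lambda>z. - Im z"] by auto
  let ?f = "\<lambda>x. complex_of_real (enn2real (a x) - enn2real (b x)) + \<i> * complex_of_real (enn2real (c x) - enn2real (d x))"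
  have re: "r = enn2real (ennreal r) - enn2real (ennreal (- r))" for r by (cases "r \<ge> 0") (auto simp: ennreal_neg)
  show ?thesis
  proof
    show "difference_measurable ?f"
      using a(1) b(1) c(1) d(1) by (auto simp: difference_measurable_def case_prod_unfold)
    show "AE x in m. f x = ?f x"
      using a(2) b(2) c(2) d(2)
    proof eventually_elim
      case (elim x)
      show ?case unfolding elim[symmetric] re[symmetric] by (simp add: complex_eq_iff)
    qed
  qed
qed

end

section \<open>Finiteness of the weak integral\<close>

text \<open>Every element of the complex dual arises from the real dual, a Banach space to which the uniform
  boundedness principle applies.\<close>

lemma complexify_Re:
  assumes "x' \<in> dual" shows "complexify (\<lambda>x. Re (x' x)) = x'"
  by (simp add: fun_eq_iff complexify_def complex_eq_iff dual_scaleC[OF assms])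

lemma total_variation_add_le:
  assumes A: "A \<in> sets borel"
  shows "total_variation (\<lambda>B. \<mu> B + \<mu>' B) A \<le> total_variation \<mu> A + total_variation \<mu>' A"
  unfolding total_variation_eq
proof (rule variation_le)
  fix P assume P: "finite P" "disjoint P" "P \<subseteq> sets borel" "\<Union>P = A"
  have "(\<Sum>E\<in>P. ennreal (cmod (\<mu> E + \<mu>' E))) \<le> (\<Sum>E\<in>P. ennreal (cmod (\<mu> E)) + ennreal (cmod (\<mu>' E)))"
    by (intro sum_mono) (simp add: norm_triangle_ineq flip: ennreal_plus)
  also have "\<dots> = (\<Sum>E\<in>P. ennreal (cmod (\<mu> E))) + (\<Sum>E\<in>P. ennreal (cmod (\<mu>' E)))" by (rule sum.distrib)
  also have "\<dots> \<le> variation (\<lambda>E. ennreal (cmod (\<mu> E))) A + variation (\<lambda>E. ennreal (cmod (\<mu>' E))) A"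
    unfolding variation_def using P by (intro add_mono SUP_upper) simp_all
  finally show "(\<Sum>E\<in>P. ennreal (cmod (\<mu> E + \<mu>' E))) \<le> \<dots>" .
qed

lemma total_variation_mult: "total_variation (\<lambda>B. c * \<mu> B) A = ennreal (cmod c) * total_variation \<mu> A"
  unfolding total_variation_eq by (simp add: norm_mult ennreal_mult variation_mult)

lemma measure_tv: "vector_measure \<mu> \<Longrightarrow> A \<in> sets borel \<Longrightarrow> measure (tv_measure \<mu>) A = enn2real (total_variation \<mu> A)"
  by (simp add: measure_def emeasure_tv_measure)

lemma total_variation_finite:
  fixes \<mu> :: "'g::topological_space set \<Rightarrow> complex"
  assumes "vector_measure \<mu>" "A \<in> sets borel" shows "total_variation \<mu> A < top"
  using finite_measure.emeasure_finite[OF finite_measure_tv[OF assms(1)], of A]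
  by (simp add: emeasure_tv_measure[OF assms] less_top)

text \<open>Approximate \<open>u\<close> by simple functions \<open>S n\<close>. Then \<open>y \<mapsto> \<integral> S n d\<bar>\<langle>\<nu>, y\<rangle>\<bar>\<close> is a bounded seminorm on
  the dual, and the seminorms are pointwise bounded by hypothesis, so the uniform boundedness
  principle applies.\<close>

lemma weak_integral_finite:
  fixes \<nu> :: "'g::topological_space set \<Rightarrow> 'x::complex_normed_vector"
  assumes \<nu>: "vector_measure \<nu>" and u: "u \<in> borel_measurable borel"
    and fin: "\<And>x'. x' \<in> dual \<Longrightarrow> (\<integral>\<^sup>+s. u s \<partial>tv \<nu> x') < \<infinity>"
  shows "weak_integral \<nu> u < \<infinity>"
proof -
  obtain S where S: "\<And>i. simple_function borel (S i)" "incseq S" "\<And>i s. S i s < top" "\<And>s. (SUP i. S i s) = u s"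
    using borel_measurable_implies_simple_function_sequence'[OF u] by metis
  have Sm: "S i \<in> borel_measurable borel" for i using S(1) by (rule borel_measurable_simple_function)
  have S': "finite (range (S i))" "S i -` {z} \<in> sets borel" for i z using simple_functionD[OF S(1)[of i]] by auto
  obtain K where K: "\<And>A. A \<in> sets borel \<Longrightarrow> norm (\<nu> A) \<le> K" using vm_bounded[OF \<nu>] by blast
  have K0: "0 \<le> K" using K[of "{}"] order_trans[OF norm_ge_zero] by blast
  define c where "c y = complexify (blinfun_apply y)" for y :: "'x \<Rightarrow>\<^sub>L real"
  have lin: "linear (blinfun_apply y)" for y :: "'x \<Rightarrow>\<^sub>L real" by (rule bounded_linear.linear[OF blinfun.bounded_linear_right])
  have bd: "\<bar>blinfun_apply y x\<bar> \<le> norm y * norm x" for y :: "'x \<Rightarrow>\<^sub>L real" and x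
    using norm_blinfun[of y x] by simp
  have c: "c y \<in> dual" "cmod (c y x) \<le> norm y * norm x" for y x
    unfolding c_def using complexify_in_dual[OF lin bd] by auto
  have c_add: "c (y + z) x = c y x + c z x" for y z x
    by (simp add: c_def complexify_def complex_eq_iff blinfun.add_left)
  have c_scale: "c (r *\<^sub>R y) x = complex_of_real r * c y x" for r y x
    by (simp add: c_def complexify_def complex_eq_iff blinfun.scaleR_left)
  note \<mu> = vm_pairing[OF \<nu> c(1)]
  define P where "P n y = (\<Sum>z\<in>range (S n). enn2real z * measure (tv_measure (pairing \<nu> (c y))) (S n -` {z}))" for n y
  have P_int: "ennreal (P n y) = (\<integral>\<^sup>+s. S n s \<partial>tv_measure (pairing \<nu> (c y)))" for n y
  proof -
    interpret finite_measure "tv_measure (pairing \<nu> (c y))" by (rule finite_measure_tv[OF \<mu>])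
    have sf: "simple_function (tv_measure (pairing \<nu> (c y))) (S n)"
      using S(1)[of n] by (simp add: simple_function_def)
    have top: "z < top" if "z \<in> range (S n)" for z using S(3) that by auto
    have "ennreal (P n y) = (\<Sum>z\<in>range (S n). z * emeasure (tv_measure (pairing \<nu> (c y))) (S n -` {z}))"
      unfolding P_def
    proof (subst sum_ennreal[symmetric])
      show "(\<Sum>z\<in>range (S n). ennreal (enn2real z * measure (tv_measure (pairing \<nu> (c y))) (S n -` {z})))
          = (\<Sum>z\<in>range (S n). z * emeasure (tv_measure (pairing \<nu> (c y))) (S n -` {z}))"
        using top by (intro sum.cong refl) (simp add: ennreal_mult emeasure_eq_measure)
    qed simp
    also have "\<dots> = (\<integral>\<^sup>+s. S n s \<partial>tv_measure (pairing \<nu> (c y)))"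
      by (simp add: nn_integral_eq_simple_integral[OF sf] simple_integral_def)
    finally show ?thesis .
  qed
  have "\<exists>C. \<forall>n y. norm y \<le> 1 \<longrightarrow> P n y \<le> C"
  proof (rule uniform_boundedness_seminorms)
    fix n y z
    have "measure (tv_measure (pairing \<nu> (c (y + z)))) E
        \<le> measure (tv_measure (pairing \<nu> (c y))) E + measure (tv_measure (pairing \<nu> (c z))) E" if E: "E \<in> sets borel" for E
    proof -
      have "total_variation (pairing \<nu> (c (y + z))) E \<le> total_variation (pairing \<nu> (c y)) E + total_variation (pairing \<nu> (c z)) E"
        unfolding c_add by (rule total_variation_add_le[OF E])
      then show ?thesis
        using total_variation_finite[OF \<mu> E, of y] total_variation_finite[OF \<mu> E, of z] unfolding measure_tv[OF \<mu> E]
        by (subst enn2real_plus[symmetric]) (auto intro!: enn2real_mono)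
    qed
    then show "P n (y + z) \<le> P n y + P n z" unfolding P_def sum.distrib[symmetric] distrib_left[symmetric]
      by (intro sum_mono mult_left_mono) (simp_all add: S')
  next
    fix n r y
    have "measure (tv_measure (pairing \<nu> (c (r *\<^sub>R y)))) E = \<bar>r\<bar> * measure (tv_measure (pairing \<nu> (c y))) E"
      if E: "E \<in> sets borel" for E
    proof -
      have "total_variation (pairing \<nu> (c (r *\<^sub>R y))) E = ennreal \<bar>r\<bar> * total_variation (pairing \<nu> (c y)) E"
        using total_variation_mult[of "complex_of_real r" "pairing \<nu> (c y)" E] by (simp add: c_scale)
      then show ?thesis unfolding measure_tv[OF \<mu> E] by (simp add: enn2real_mult)
    qed
    then show "P n (r *\<^sub>R y) = \<bar>r\<bar> * P n y" unfolding P_def by (simp add: S' sum_distrib_left mult.left_commute)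
  next
    fix n
    have "P n y \<le> (\<Sum>z\<in>range (S n). enn2real z * (4 * K)) * norm y" for y
      unfolding P_def sum_distrib_right
    proof (rule sum_mono)
      fix z
      have "cmod (c y (\<nu> B)) \<le> K * norm y" if "B \<in> sets borel" for B
        using c(2)[of y "\<nu> B"] mult_left_mono[OF K[OF that] norm_ge_zero[of y]] by (simp add: mult.commute)
      from total_variation_le_bound[OF \<mu> this S'(2)]
      have "measure (tv_measure (pairing \<nu> (c y))) (S n -` {z}) \<le> 4 * (K * norm y)"
        unfolding measure_tv[OF \<mu> S'(2)] using K0 by (simp add: enn2real_leI)
      then show "enn2real z * measure (tv_measure (pairing \<nu> (c y))) (S n -` {z}) \<le> enn2real z * (4 * K) * norm y"
        using mult_left_mono[of _ _ "enn2real z"] by (fastforce simp: mult.assoc)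
    qed
    then show "\<exists>K. \<forall>y. P n y \<le> K * norm y" by blast
  next
    fix y
    have "P n y \<le> enn2real (\<integral>\<^sup>+s. u s \<partial>tv_measure (pairing \<nu> (c y)))" for n
    proof -
      have "ennreal (P n y) \<le> (\<integral>\<^sup>+s. u s \<partial>tv_measure (pairing \<nu> (c y)))"
        unfolding P_int S(4)[symmetric] by (intro nn_integral_mono SUP_upper) simp
      then have "enn2real (ennreal (P n y)) \<le> enn2real (\<integral>\<^sup>+s. u s \<partial>tv_measure (pairing \<nu> (c y)))"
        using fin[OF c(1)[of y]] by (intro enn2real_mono) auto
      moreover have "0 \<le> P n y" unfolding P_def by (intro sum_nonneg mult_nonneg_nonneg) auto
      ultimately show ?thesis by simp
    qed
    then show "\<exists>K. \<forall>n. P n y \<le> K" by blast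
  qed
  then obtain C where C: "\<And>n y. norm y \<le> 1 \<Longrightarrow> P n y \<le> C" by blast
  have "weak_integral \<nu> u \<le> ennreal C" unfolding weak_integral_def
  proof (rule SUP_least)
    fix x' :: "'x \<Rightarrow> complex" assume x': "x' \<in> dual_ball"
    have bl: "bounded_linear (\<lambda>x. Re (x' x))"
      by (rule bounded_linear_compose[OF bounded_linear_Re dual_bounded_linear[OF dual_ball_dual[OF x']]])
    define y where "y = Blinfun (\<lambda>x. Re (x' x))"
    have y: "blinfun_apply y = (\<lambda>x. Re (x' x))" unfolding y_def by (rule bounded_linear_Blinfun_apply[OF bl])
    have cy: "c y = x'" unfolding c_def y by (rule complexify_Re[OF dual_ball_dual[OF x']])
    have "norm (blinfun_apply y x) \<le> 1 * norm x" for x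
      unfolding y using order_trans[OF abs_Re_le_cmod dual_ball_le[OF x', of x]] by simp
    then have "norm y \<le> 1" by (intro norm_blinfun_bound) auto
    then have "(\<integral>\<^sup>+s. S n s \<partial>tv \<nu> x') \<le> ennreal C" for n
      using C[of y n] P_int[of n y] unfolding cy by (metis ennreal_leI)
    then have "(SUP n. \<integral>\<^sup>+s. S n s \<partial>tv \<nu> x') \<le> ennreal C" by (intro SUP_least)
    moreover have "(\<integral>\<^sup>+s. u s \<partial>tv \<nu> x') = (SUP n. \<integral>\<^sup>+s. S n s \<partial>tv \<nu> x')"
      unfolding S(4)[symmetric] using Sm S(2)
      by (intro nn_integral_monotone_convergence_SUP) (auto cong: measurable_cong_sets)
    ultimately show "(\<integral>\<^sup>+s. u s \<partial>tv \<nu> x') \<le> ennreal C" by simp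
  qed
  then show ?thesis using less_top[of "weak_integral \<nu> u"] by (auto simp: top_unique)
qed

section \<open>Young's inequality\<close>

lemma weighted_amgm3:
  fixes a b c :: real
  assumes "0 \<le> \<alpha>" "0 \<le> \<beta>" "0 \<le> \<gamma>" "\<alpha> + \<beta> + \<gamma> = 1" and "0 \<le> a" "0 \<le> b" "0 \<le> c"
  shows "a powr \<alpha> * b powr \<beta> * c powr \<gamma> \<le> \<alpha> * a + \<beta> * b + \<gamma> * c"
proof (cases "a = 0 \<or> b = 0 \<or> c = 0")
  case True
  then have "a powr \<alpha> * b powr \<beta> * c powr \<gamma> = 0" by auto
  moreover have "0 \<le> \<alpha> * a + \<beta> * b + \<gamma> * c"
    using assms by (intro add_nonneg_nonneg mult_nonneg_nonneg)
  ultimately show ?thesis by linarith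
next
  case False
  then have pos: "a > 0" "b > 0" "c > 0" using assms by auto
  define S where "S = \<alpha> * a + \<beta> * b + \<gamma> * c"
  have S: "S > 0"
  proof -
    have "\<alpha> > 0 \<or> \<beta> > 0 \<or> \<gamma> > 0" using assms by linarith
    then have "0 < \<alpha> * a \<or> 0 < \<beta> * b \<or> 0 < \<gamma> * c" using pos by auto
    moreover have "0 \<le> \<alpha> * a" "0 \<le> \<beta> * b" "0 \<le> \<gamma> * c" using assms by auto
    ultimately show ?thesis unfolding S_def by linarith
  qed
  have ln: "ln x \<le> x / S - 1 + ln S" if "x > 0" for x
    using ln_le_minus_one[of "x / S"] that S by (simp add: ln_div)
  have "\<alpha> * ln a + \<beta> * ln b + \<gamma> * ln c \<le> \<alpha> * (a / S - 1 + ln S) + \<beta> * (b / S - 1 + ln S) + \<gamma> * (c / S - 1 + ln S)"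
    using assms pos by (intro add_mono mult_left_mono ln) auto
  also have "\<dots> = (\<alpha> * a + \<beta> * b + \<gamma> * c) / S + (\<alpha> + \<beta> + \<gamma>) * (ln S - 1)" by (simp add: field_simps add_divide_distrib)
  also have "\<dots> = ln S" using S assms(4) by (simp add: S_def[symmetric])
  finally have "exp (\<alpha> * ln a + \<beta> * ln b + \<gamma> * ln c) \<le> S" using S by (simp add: ln_ge_iff)
  then show ?thesis using pos by (simp add: powr_def exp_add S_def)
qed

text \<open>Instead of the integrals of \<open>u, v, w\<close> themselves, the statement uses positive bounds
  for them. This allows an integral to vanish, and the proof is the pointwise weighted inequality between means for
  \<open>u/U, v/V, w/W\<close>, integrated once.\<close>

lemma nn_integral_Holder3:
  fixes u v w :: "'a \<Rightarrow> real"
  assumes [measurable]: "u \<in> borel_measurable M" "v \<in> borel_measurable M" "w \<in> borel_measurable M"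
    and nn: "\<And>x. 0 \<le> u x" "\<And>x. 0 \<le> v x" "\<And>x. 0 \<le> w x"
    and ex: "0 \<le> \<alpha>" "0 \<le> \<beta>" "0 \<le> \<gamma>" "\<alpha> + \<beta> + \<gamma> = 1"
    and pos: "0 < U" "0 < V" "0 < W"
    and le: "(\<integral>\<^sup>+x. ennreal (u x) \<partial>M) \<le> ennreal U" "(\<integral>\<^sup>+x. ennreal (v x) \<partial>M) \<le> ennreal V" "(\<integral>\<^sup>+x. ennreal (w x) \<partial>M) \<le> ennreal W"
  shows "(\<integral>\<^sup>+x. ennreal (u x powr \<alpha> * v x powr \<beta> * w x powr \<gamma>) \<partial>M) \<le> ennreal (U powr \<alpha> * V powr \<beta> * W powr \<gamma>)"
proof -
  let ?C = "U powr \<alpha> * V powr \<beta> * W powr \<gamma>"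
  have C: "0 < ?C" using pos by simp
  have pw: "u x powr \<alpha> * v x powr \<beta> * w x powr \<gamma> \<le> ?C * (\<alpha> / U) * u x + ?C * (\<beta> / V) * v x + ?C * (\<gamma> / W) * w x" for x
  proof -
    have "(u x / U) powr \<alpha> * (v x / V) powr \<beta> * (w x / W) powr \<gamma> \<le> \<alpha> * (u x / U) + \<beta> * (v x / V) + \<gamma> * (w x / W)"
      using nn pos ex by (intro weighted_amgm3) auto
    moreover have "(u x / U) powr \<alpha> * (v x / V) powr \<beta> * (w x / W) powr \<gamma> = (u x powr \<alpha> * v x powr \<beta> * w x powr \<gamma>) / ?C"
      using nn pos by (simp add: powr_divide)
    ultimately have "u x powr \<alpha> * v x powr \<beta> * w x powr \<gamma> \<le> ?C * (\<alpha> * (u x / U) + \<beta> * (v x / V) + \<gamma> * (w x / W))"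
      using C by (simp add: divide_le_eq mult.commute)
    then show ?thesis by (simp add: algebra_simps)
  qed
  define i where "i = ?C * (\<alpha> / U)"
  define j where "j = ?C * (\<beta> / V)"
  define k where "k = ?C * (\<gamma> / W)"
  have ijk: "0 \<le> i" "0 \<le> j" "0 \<le> k" unfolding i_def j_def k_def using C ex pos by auto
  have split: "ennreal (i * x + j * y + k * z) = ennreal i * ennreal x + ennreal j * ennreal y + ennreal k * ennreal z"
    if "0 \<le> x" "0 \<le> y" "0 \<le> z" for x y z
    using ijk that by (simp add: ennreal_mult ennreal_plus)
  have "(\<integral>\<^sup>+x. ennreal (u x powr \<alpha> * v x powr \<beta> * w x powr \<gamma>) \<partial>M)
      \<le> (\<integral>\<^sup>+x. ennreal i * ennreal (u x) + ennreal j * ennreal (v x) + ennreal k * ennreal (w x) \<partial>M)"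
    unfolding split[OF nn, symmetric]
    by (intro nn_integral_mono ennreal_leI) (unfold i_def j_def k_def, rule pw)
  also have "\<dots> = ennreal i * (\<integral>\<^sup>+x. ennreal (u x) \<partial>M) + ennreal j * (\<integral>\<^sup>+x. ennreal (v x) \<partial>M)
      + ennreal k * (\<integral>\<^sup>+x. ennreal (w x) \<partial>M)"
    by (simp add: nn_integral_add nn_integral_cmult)
  also have "\<dots> \<le> ennreal i * ennreal U + ennreal j * ennreal V + ennreal k * ennreal W"
    by (intro add_mono mult_left_mono le) auto
  also have "\<dots> = ennreal (i * U + j * V + k * W)" using pos by (intro split[symmetric]) auto
  also have "i * U + j * V + k * W = ?C * (\<alpha> + \<beta> + \<gamma>)"
    using pos by (simp add: i_def j_def k_def algebra_simps)
  finally show ?thesis using ex(4) by simp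
qed

text \<open>Where \<open>a\<close> and \<open>b\<close> are nonzero, the exponents are chosen to make the product of the three factors
  \<open>(a\<^sup>p b\<^sup>q)\<^sup>\<rho>\<close>, \<open>(a\<^sup>p) powr (1/p - \<rho>)\<close> and \<open>(b\<^sup>q) powr (1/q - \<rho>)\<close> equal to \<open>a b\<close>.\<close>

lemma young_pointwise:
  fixes a b :: "'a \<Rightarrow> real"
  assumes [measurable]: "a \<in> borel_measurable M" "b \<in> borel_measurable M" and nn: "\<And>x. 0 \<le> a x" "\<And>x. 0 \<le> b x"
    and p: "1 \<le> p" "1 \<le> q" and \<rho>: "\<rho> = 1 / p + 1 / q - 1" "0 \<le> \<rho>"
    and pos: "0 < U" "0 < A" "0 < B"
    and le: "\<rho> \<noteq> 0 \<Longrightarrow> (\<integral>\<^sup>+x. ennreal (a x powr p * b x powr q) \<partial>M) \<le> ennreal U"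
      "(\<integral>\<^sup>+x. ennreal (a x powr p) \<partial>M) \<le> ennreal A" "(\<integral>\<^sup>+x. ennreal (b x powr q) \<partial>M) \<le> ennreal B"
  shows "(\<integral>\<^sup>+x. ennreal (a x * b x) \<partial>M) \<le> ennreal (U powr \<rho> * A powr (1 / p - \<rho>) * B powr (1 / q - \<rho>))"
proof -
  have ex: "0 \<le> 1 / p - \<rho>" "0 \<le> 1 / q - \<rho>" "\<rho> + (1 / p - \<rho>) + (1 / q - \<rho>) = 1"
    using p by (auto simp: \<rho>(1) field_simps)
  have pp: "a x * b x = (a x powr p * b x powr q) powr \<rho> * (a x powr p) powr (1 / p - \<rho>) * (b x powr q) powr (1 / q - \<rho>)"
    if "a x \<noteq> 0" "b x \<noteq> 0" for x
  proof -
    have ab: "a x > 0" "b x > 0" using nn[of x] that by auto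
    have "(a x powr p * b x powr q) powr \<rho> * (a x powr p) powr (1 / p - \<rho>) * (b x powr q) powr (1 / q - \<rho>)
        = (a x powr (p * \<rho>) * a x powr (p * (1 / p - \<rho>))) * (b x powr (q * \<rho>) * b x powr (q * (1 / q - \<rho>)))"
      using ab by (simp add: powr_mult powr_powr)
    also have "\<dots> = a x powr (p * \<rho> + p * (1 / p - \<rho>)) * b x powr (q * \<rho> + q * (1 / q - \<rho>))"
      by (simp only: powr_add)
    also have "p * \<rho> + p * (1 / p - \<rho>) = 1" using p by (simp add: algebra_simps)
    also have "q * \<rho> + q * (1 / q - \<rho>) = 1" using p by (simp add: algebra_simps)
    finally show ?thesis using ab by simp
  qed
  show ?thesis
  proof (cases "\<rho> = 0")
    case False
    have "(\<integral>\<^sup>+x. ennreal (a x * b x) \<partial>M)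
        \<le> (\<integral>\<^sup>+x. ennreal ((a x powr p * b x powr q) powr \<rho> * (a x powr p) powr (1 / p - \<rho>) * (b x powr q) powr (1 / q - \<rho>)) \<partial>M)"
      by (intro nn_integral_mono ennreal_leI) (metis pp mult_eq_0_iff order_refl mult_nonneg_nonneg powr_ge_zero)
    also have "\<dots> \<le> ennreal (U powr \<rho> * A powr (1 / p - \<rho>) * B powr (1 / q - \<rho>))"
      using ex pos \<rho>(2) le False nn by (intro nn_integral_Holder3) auto
    finally show ?thesis .
  next
    case True
    \<comment> \<open>for \<open>\<rho> = 0\<close> a two-term inequality, obtained by putting the first factor equal to the second\<close>
    have "(\<integral>\<^sup>+x. ennreal (a x * b x) \<partial>M)
        \<le> (\<integral>\<^sup>+x. ennreal ((a x powr p) powr 0 * (a x powr p) powr (1 / p - \<rho>) * (b x powr q) powr (1 / q - \<rho>)) \<partial>M)"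
    proof (intro nn_integral_mono ennreal_leI)
      fix x show "a x * b x \<le> (a x powr p) powr 0 * (a x powr p) powr (1 / p - \<rho>) * (b x powr q) powr (1 / q - \<rho>)"
        using pp[of x] True by (cases "a x = 0 \<or> b x = 0") auto
    qed
    also have "\<dots> \<le> ennreal (A powr 0 * A powr (1 / p - \<rho>) * B powr (1 / q - \<rho>))"
      using ex pos True le nn by (intro nn_integral_Holder3) auto
    finally show ?thesis using True pos by simp
  qed
qed

text \<open>The form of the preceding estimate that can be integrated over a parameter: it is linear in the
  integral of \<open>a\<^sup>p b\<^sup>q\<close>, which here may be \<open>0\<close> or \<open>\<infinity>\<close>.\<close>

lemma young_power:
  fixes a b :: "'a \<Rightarrow> real"
  assumes [measurable]: "a \<in> borel_measurable M" "b \<in> borel_measurable M" and nn: "\<And>x. 0 \<le> a x" "\<And>x. 0 \<le> b x"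
    and p: "1 \<le> p" "1 \<le> q" and \<rho>: "\<rho> = 1 / p + 1 / q - 1" "0 < \<rho>"
    and pos: "0 < A" "0 < B"
    and le: "(\<integral>\<^sup>+x. ennreal (a x powr p) \<partial>M) \<le> ennreal A" "(\<integral>\<^sup>+x. ennreal (b x powr q) \<partial>M) \<le> ennreal B"
    and c: "0 \<le> c" "ennreal c \<le> (\<integral>\<^sup>+x. ennreal (a x * b x) \<partial>M)"
  shows "ennreal (c powr (1 / \<rho>)) \<le> ennreal ((A powr (1 / p - \<rho>) * B powr (1 / q - \<rho>)) powr (1 / \<rho>)) * (\<integral>\<^sup>+x. ennreal (a x powr p * b x powr q) \<partial>M)"
proof (cases "\<integral>\<^sup>+x. ennreal (a x powr p * b x powr q) \<partial>M")
  case top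
  then show ?thesis using pos by (simp add: ennreal_mult_top)
next
  case (real U)
  let ?C = "A powr (1 / p - \<rho>) * B powr (1 / q - \<rho>)"
  show ?thesis
  proof (cases "U = 0")
    case True
    then have "AE x in M. ennreal (a x powr p * b x powr q) = 0" using real by (subst nn_integral_0_iff_AE[symmetric]) auto
    then have "AE x in M. ennreal (a x * b x) = 0"
    proof eventually_elim
      case (elim x)
      have "0 \<le> a x powr p * b x powr q" by simp
      with elim have "a x powr p * b x powr q = 0" by (simp add: ennreal_eq_0_iff del: mult_eq_0_iff)
      then show ?case by auto
    qed
    then have "(\<integral>\<^sup>+x. ennreal (a x * b x) \<partial>M) = 0" by (subst nn_integral_0_iff_AE) auto
    then have "c = 0" using c by simp
    then show ?thesis by simp
  next
    case False
    then have U: "U > 0" using real by simp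
    have "ennreal c \<le> ennreal (U powr \<rho> * A powr (1 / p - \<rho>) * B powr (1 / q - \<rho>))"
      using c(2) by (rule order_trans) (use assms U real in \<open>intro young_pointwise, auto\<close>)
    then have "c \<le> U powr \<rho> * ?C" by (simp add: ennreal_le_iff mult.assoc)
    then have "c powr (1 / \<rho>) \<le> (U powr \<rho> * ?C) powr (1 / \<rho>)" using c \<rho> by (intro powr_mono2) auto
    also have "\<dots> = U * ?C powr (1 / \<rho>)" using U \<rho>(2) by (simp add: powr_mult powr_powr)
    finally show ?thesis using real by (simp add: mult.commute flip: ennreal_mult)
  qed
qed

section \<open>Convolution of scalar functions against a measure\<close>

lemma measurable_completion_AE:
  assumes H: "H \<in> borel_measurable M" and eq: "AE t in M. \<phi> t = H t"
  shows "\<phi> \<in> borel_measurable (completion M)"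
proof (rule measurableI)
  fix S :: "'b set" assume S: "S \<in> sets borel"
  obtain N where N: "N \<in> null_sets M" "{t \<in> space M. \<phi> t \<noteq> H t} \<subseteq> N"
    using eq by (auto elim!: AE_E simp: null_sets_def)
  have Nc: "N \<in> null_sets (completion M)" by (rule null_sets_completionI[OF N(1)])
  have "\<phi> -` S \<inter> space M = (H -` S \<inter> space M - N) \<union> (\<phi> -` S \<inter> space M \<inter> N)"
    using N(2) by force
  moreover have "H -` S \<inter> space M - N \<in> sets (completion M)"
    using measurable_sets[OF H S] N(1) by (intro sets_completionI_sets sets.Diff) auto
  moreover have "\<phi> -` S \<inter> space M \<inter> N \<in> null_sets (completion M)"
    by (rule null_sets_completion_subset[OF _ Nc]) auto
  ultimately show "\<phi> -` S \<inter> space (completion M) \<in> sets (completion M)"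
    unfolding space_completion by (metis null_setsD2 sets.Un)
qed simp

lemma ennreal_powr_mono: "a \<ge> 0 \<Longrightarrow> x \<le> ennreal c \<Longrightarrow> 0 \<le> c \<Longrightarrow> ennreal_powr x a \<le> ennreal (c powr a)"
proof -
  assume a: "a \<ge> 0" and x: "x \<le> ennreal c" and c: "0 \<le> c"
  then have "x \<noteq> \<infinity>" by (auto simp: top_unique)
  moreover have "enn2real x \<le> c" using x c by (rule enn2real_leI[rotated])
  ultimately show ?thesis using a by (auto simp: ennreal_powr_def intro!: ennreal_leI powr_mono2)
qed

lemma scalar_Lr_norm_le_infinity:
  assumes "\<phi> \<in> borel_measurable (completion M)" "AE t in M. ennreal (cmod (\<phi> t)) \<le> c"
  shows "scalar_Lr_norm M \<infinity> \<phi> \<le> c"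
  using assms by (auto simp: scalar_Lr_norm_def AE_completion_iff intro!: esssup_I)

lemma scalar_Lr_norm_le_finite:
  assumes \<rho>: "0 < \<rho>" and le: "(\<integral>\<^sup>+t. ennreal (cmod (\<phi> t) powr (1 / \<rho>)) \<partial>M) \<le> ennreal C" and C: "0 \<le> C"
  shows "scalar_Lr_norm M (ennreal (1 / \<rho>)) \<phi> \<le> ennreal (C powr \<rho>)"
proof -
  have "1 / ennreal (1 / \<rho>) = ennreal \<rho>" using \<rho> divide_ennreal[of 1 "1 / \<rho>"] by simp
  then have "enn2real (1 / ennreal (1 / \<rho>)) = \<rho>" using \<rho> by simp
  then show ?thesis
    using ennreal_powr_mono[OF _ le C, of \<rho>] \<rho> by (simp add: scalar_Lr_norm_def nn_integral_completion)
qed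

context compact_haar
begin

text \<open>Replace \<open>u\<close> by an equal function for which \<open>u (t - s)\<close> is measurable on the product. The
  inner integral does not change for any \<open>t\<close>, because null sets of Haar measure stay null under
  \<open>s \<mapsto> t - s\<close> and are null for \<open>M\<close>.\<close>

lemma nn_integral_difference_Fubini:
  fixes u w :: "'g \<Rightarrow> ennreal"
  assumes fin: "finite_measure M" and M[simp, measurable_cong]: "sets M = sets borel"
    and ac: "\<And>Q. (AE s in m. Q s) \<Longrightarrow> AE s in M. Q s"
    and u: "u \<in> borel_measurable borel" and w[measurable]: "w \<in> borel_measurable borel"
  shows "(\<integral>\<^sup>+t. (\<integral>\<^sup>+s. u (t - s) * w s \<partial>M) \<partial>m) = (\<integral>\<^sup>+x. u x \<partial>m) * (\<integral>\<^sup>+s. w s \<partial>M)"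
    and "(\<lambda>t. \<integral>\<^sup>+s. u (t - s) * w s \<partial>M) \<in> borel_measurable borel"
proof -
  interpret M: finite_measure M by (rule fin)
  interpret pair_sigma_finite m M ..
  obtain v where v: "difference_measurable v" "AE x in m. u x = v x"
    using difference_measurable_ex_ennreal[OF u] by blast
  have vm[measurable]: "v \<in> borel_measurable borel" "(\<lambda>(t, s). v (t - s)) \<in> borel_measurable (borel \<Otimes>\<^sub>M borel)"
    using v(1) by (auto simp: difference_measurable_def)
  have eq: "(\<integral>\<^sup>+s. u (t - s) * w s \<partial>M) = (\<integral>\<^sup>+s. v (t - s) * w s \<partial>M)" for t
  proof (rule nn_integral_cong_AE)
    show "AE s in M. u (t - s) * w s = v (t - s) * w s"
      using ac[OF AE_diff_left[OF v(2), of t]] by eventually_elim simp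
  qed
  have k: "(\<lambda>(t, s). v (t - s) * w s) \<in> borel_measurable (m \<Otimes>\<^sub>M M)"
    using vm(2) by (simp add: case_prod_unfold cong: measurable_cong_sets)
  have "(\<integral>\<^sup>+t. (\<integral>\<^sup>+s. v (t - s) * w s \<partial>M) \<partial>m) = (\<integral>\<^sup>+s. (\<integral>\<^sup>+t. v (t - s) * w s \<partial>m) \<partial>M)"
    by (rule Fubini'[OF k, symmetric])
  also have "\<dots> = (\<integral>\<^sup>+s. (\<integral>\<^sup>+x. v x \<partial>m) * w s \<partial>M)"
  proof (rule nn_integral_cong)
    fix s
    have "(\<lambda>t. v (t - s)) \<in> borel_measurable m" using measurable_compose[OF measurable_diff_right vm(1)] by simp
    then show "(\<integral>\<^sup>+t. v (t - s) * w s \<partial>m) = (\<integral>\<^sup>+x. v x \<partial>m) * w s"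
      by (simp add: nn_integral_multc nn_integral_diff_right[OF vm(1)])
  qed
  also have "\<dots> = (\<integral>\<^sup>+x. v x \<partial>m) * (\<integral>\<^sup>+s. w s \<partial>M)" by (rule nn_integral_cmult) simp
  also have "(\<integral>\<^sup>+x. v x \<partial>m) = (\<integral>\<^sup>+x. u x \<partial>m)" using v(2) by (intro nn_integral_cong_AE) auto
  finally show "(\<integral>\<^sup>+t. (\<integral>\<^sup>+s. u (t - s) * w s \<partial>M) \<partial>m) = (\<integral>\<^sup>+x. u x \<partial>m) * (\<integral>\<^sup>+s. w s \<partial>M)"
    by (simp add: eq)
  show "(\<lambda>t. \<integral>\<^sup>+s. u (t - s) * w s \<partial>M) \<in> borel_measurable borel"
    unfolding eq using M.borel_measurable_nn_integral[OF k] by (simp cong: measurable_cong_sets)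
qed

lemma cint_convolution_measurable:
  assumes \<mu>: "vector_measure \<mu>" and f: "difference_measurable f" and g[measurable]: "g \<in> borel_measurable borel"
  shows "(\<lambda>t. cint \<mu> (\<lambda>s. f (t - s) * g s)) \<in> borel_measurable borel"
proof -
  have [measurable]: "(\<lambda>(t, s). f (t - s)) \<in> borel_measurable (borel \<Otimes>\<^sub>M borel)"
    using f by (auto simp: difference_measurable_def)
  have [measurable]: "(\<lambda>t. LINT s|jordan_part \<mu> c. f (t - s) * g s) \<in> borel_measurable borel" for c
  proof -
    interpret finite_measure "jordan_part \<mu> c" by (rule finite_measure_jordan_part[OF \<mu>])
    show ?thesis
      by (rule borel_measurable_lebesgue_integral) (simp add: case_prod_unfold cong: measurable_cong_sets)
  qed
  show ?thesis unfolding cint_eq by measurable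
qed

text \<open>Fubini's theorem for each of the four Jordan parts. Their integrability follows from
  that of \<open>\<bar>f (t - s)\<bar> \<bar>g s\<bar>\<close> with respect to the total variation.\<close>

lemma cint_convolution_Fubini:
  fixes f g :: "'g \<Rightarrow> complex"
  assumes \<mu>: "vector_measure \<mu>" and ac: "\<And>Q. (AE s in m. Q s) \<Longrightarrow> AE s in tv_measure \<mu>. Q s"
    and f: "difference_measurable f" and g[measurable]: "g \<in> borel_measurable borel"
    and fin: "(\<integral>\<^sup>+x. ennreal (cmod (f x)) \<partial>m) < \<infinity>" "(\<integral>\<^sup>+s. ennreal (cmod (g s)) \<partial>tv_measure \<mu>) < \<infinity>"
    and A[measurable]: "A \<in> sets borel"
  shows "set_lebesgue_integral m A (\<lambda>t. cint \<mu> (\<lambda>s. f (t - s) * g s))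
    = cint \<mu> (\<lambda>s. g s * set_lebesgue_integral m A (\<lambda>t. f (t - s)))"
proof -
  have fm[measurable]: "f \<in> borel_measurable borel" "(\<lambda>(t, s). f (t - s)) \<in> borel_measurable (borel \<Otimes>\<^sub>M borel)"
    using f by (auto simp: difference_measurable_def)
  define F where "F t s = indicator A t *\<^sub>R (f (t - s) * g s)" for t s
  define L where "L c t = (LINT s|jordan_part \<mu> c. F t s)" for c t
  have L: "integrable m (L c)"
    and L_int: "(LINT t|m. L c t) = (LINT s|jordan_part \<mu> c. g s * set_lebesgue_integral m A (\<lambda>t. f (t - s)))"
    if c: "cmod c = 1" for c
  proof -
    interpret J: finite_measure "jordan_part \<mu> c" by (rule finite_measure_jordan_part[OF \<mu>])
    interpret pair_sigma_finite m "jordan_part \<mu> c" ..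
    have Fm: "case_prod F \<in> borel_measurable (m \<Otimes>\<^sub>M jordan_part \<mu> c)"
      using fm(2) unfolding F_def by (simp add: case_prod_unfold cong: measurable_cong_sets)
    have int: "integrable (m \<Otimes>\<^sub>M jordan_part \<mu> c) (case_prod F)"
    proof (rule integrableI_bounded[OF Fm])
      have "(\<integral>\<^sup>+z. ennreal (norm (case_prod F z)) \<partial>(m \<Otimes>\<^sub>M jordan_part \<mu> c))
          = (\<integral>\<^sup>+t. (\<integral>\<^sup>+s. ennreal (norm (F t s)) \<partial>jordan_part \<mu> c) \<partial>m)"
        using Fm by (subst J.nn_integral_fst[symmetric]) auto
      also have "\<dots> \<le> (\<integral>\<^sup>+t. (\<integral>\<^sup>+s. ennreal (cmod (f (t - s))) * ennreal (cmod (g s)) \<partial>jordan_part \<mu> c) \<partial>m)"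
        by (intro nn_integral_mono) (auto simp: F_def norm_mult indicator_def simp flip: ennreal_mult)
      also have "\<dots> = (\<integral>\<^sup>+x. ennreal (cmod (f x)) \<partial>m) * (\<integral>\<^sup>+s. ennreal (cmod (g s)) \<partial>jordan_part \<mu> c)"
        using AE_jordan_part[OF \<mu> c ac] by (intro nn_integral_difference_Fubini) (auto intro: J.finite_measure_axioms)
      also have "\<dots> \<le> (\<integral>\<^sup>+x. ennreal (cmod (f x)) \<partial>m) * (\<integral>\<^sup>+s. ennreal (cmod (g s)) \<partial>tv_measure \<mu>)"
        by (intro mult_left_mono nn_integral_jordan_part_le[OF \<mu> c]) simp
      also have "\<dots> < \<infinity>" using fin by (simp add: ennreal_mult_less_top)
      finally show "(\<integral>\<^sup>+z. ennreal (norm (case_prod F z)) \<partial>(m \<Otimes>\<^sub>M jordan_part \<mu> c)) < \<infinity>" .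
    qed
    show "integrable m (L c)" using integrable_fst'[OF int] by (simp add: L_def[abs_def])
    have inner: "(LINT t|m. F t s) = g s * set_lebesgue_integral m A (\<lambda>t. f (t - s))" for s
    proof -
      have "F t s = g s * (indicator A t *\<^sub>R f (t - s))" for t by (simp add: F_def)
      then show ?thesis by (simp only: set_lebesgue_integral_def integral_mult_right_zero)
    qed
    have "(LINT t|m. L c t) = (LINT s|jordan_part \<mu> c. LINT t|m. F t s)"
      unfolding L_def by (rule Fubini_integral[OF int, symmetric])
    then show "(LINT t|m. L c t) = (LINT s|jordan_part \<mu> c. g s * set_lebesgue_integral m A (\<lambda>t. f (t - s)))"
      by (simp only: inner)
  qed
  have Lc: "L c t = indicator A t *\<^sub>R (LINT s|jordan_part \<mu> c. f (t - s) * g s)" for c t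
    by (simp add: L_def F_def)
  have "set_lebesgue_integral m A (\<lambda>t. cint \<mu> (\<lambda>s. f (t - s) * g s))
      = (LINT t|m. L 1 t - L (-1) t + \<i> * (L (-\<i>) t - L \<i> t))"
    unfolding set_lebesgue_integral_def Lc cint_eq
    by (intro Bochner_Integration.integral_cong refl) (simp add: algebra_simps scaleR_conv_of_real)
  also have "\<dots> = (LINT t|m. L 1 t) - (LINT t|m. L (-1) t) + \<i> * ((LINT t|m. L (-\<i>) t) - (LINT t|m. L \<i> t))"
    using L by simp
  also have "\<dots> = cint \<mu> (\<lambda>s. g s * set_lebesgue_integral m A (\<lambda>t. f (t - s)))"
    unfolding cint_eq by (simp add: L_int)
  finally show ?thesis .
qed

lemma set_integral_difference_bounded:
  fixes f :: "'g \<Rightarrow> complex"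
  assumes f: "difference_measurable f" and A[measurable]: "A \<in> sets borel"
  shows "(\<lambda>s. set_lebesgue_integral m A (\<lambda>t. f (t - s))) \<in> borel_measurable borel"
    and "(\<integral>\<^sup>+x. ennreal (cmod (f x)) \<partial>m) < \<infinity> \<Longrightarrow>
      cmod (set_lebesgue_integral m A (\<lambda>t. f (t - s))) \<le> enn2real (\<integral>\<^sup>+x. ennreal (cmod (f x)) \<partial>m)"
proof -
  have fm[measurable]: "f \<in> borel_measurable borel" "(\<lambda>(t, s). f (t - s)) \<in> borel_measurable (borel \<Otimes>\<^sub>M borel)"
    using f by (auto simp: difference_measurable_def)
  have "(\<lambda>z. case_prod (\<lambda>t s. f (t - s)) (snd z, fst z)) \<in> borel_measurable (borel \<Otimes>\<^sub>M borel)"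
    by (rule measurable_compose[OF _ fm(2)]) measurable
  then show "(\<lambda>s. set_lebesgue_integral m A (\<lambda>t. f (t - s))) \<in> borel_measurable borel"
    unfolding set_lebesgue_integral_def
    by (intro borel_measurable_lebesgue_integral) (simp add: case_prod_unfold cong: measurable_cong_sets)
  assume fin: "(\<integral>\<^sup>+x. ennreal (cmod (f x)) \<partial>m) < \<infinity>"
  have "ennreal (cmod (set_lebesgue_integral m A (\<lambda>t. f (t - s)))) \<le> (\<integral>\<^sup>+t. ennreal (cmod (indicator A t *\<^sub>R f (t - s))) \<partial>m)"
  proof (cases "integrable m (\<lambda>t. indicator A t *\<^sub>R f (t - s))")
    case True
    then show ?thesis unfolding set_lebesgue_integral_def by (rule integral_norm_bound_ennreal)
  qed (simp add: set_lebesgue_integral_def not_integrable_integral_eq)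
  also have "\<dots> \<le> (\<integral>\<^sup>+t. ennreal (cmod (f (t - s))) \<partial>m)"
    by (intro nn_integral_mono) (auto simp: indicator_def)
  also have "\<dots> = (\<integral>\<^sup>+x. ennreal (cmod (f x)) \<partial>m)" by (rule nn_integral_diff_right) simp
  finally show "cmod (set_lebesgue_integral m A (\<lambda>t. f (t - s))) \<le> enn2real (\<integral>\<^sup>+x. ennreal (cmod (f x)) \<partial>m)"
    using fin by (metis enn2real_ennreal enn2real_mono infinity_ennreal_def norm_ge_zero)
qed

end

section \<open>Bounded multipliers\<close>

lemma norm_le_dual_ball:
  fixes x :: "'x::complex_normed_vector"
  assumes "\<And>x'. x' \<in> dual_ball \<Longrightarrow> cmod (x' x) \<le> c" shows "norm x \<le> c"
  using norming_functional[of x] assms order_trans by metis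

lemma is_vm_integral_indicator:
  "vector_measure \<nu> \<Longrightarrow> A \<in> sets borel \<Longrightarrow> is_vm_integral \<nu> A (\<lambda>_. 1) (\<nu> A)"
proof -
  assume "vector_measure \<nu>" "A \<in> sets borel"
  moreover have "(\<lambda>s. indicator A s *\<^sub>R (1 :: complex)) = indicator A" by (auto simp: indicator_def)
  ultimately show ?thesis
    unfolding is_vm_integral_def cint_set[of _ A]
    using cint_indicator[OF vm_pairing, of \<nu> _ A] by simp
qed

lemma const_one_in_L1:
  assumes \<nu>: "vector_measure \<nu>" shows "(\<lambda>_. 1) \<in> L1 \<nu>"
  unfolding L1_def L1_weak_def
proof (intro CollectI conjI ballI)
  fix x' :: "'b \<Rightarrow> complex" assume "x' \<in> dual"
  then interpret finite_measure "tv \<nu> x'" by (intro finite_measure_tv vm_pairing[OF \<nu>])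
  show "integrable (tv \<nu> x') (\<lambda>_. 1 :: complex)" by simp
next
  fix A :: "'a set" assume "A \<in> sets borel"
  then show "\<exists>!x. is_vm_integral \<nu> A (\<lambda>_. 1) x"
    using is_vm_integral_indicator[OF \<nu>] vm_integral_eq by metis
qed simp

text \<open>Round real and imaginary part down to multiples of \<open>1/n\<close>; boundedness leaves only
  finitely many values.\<close>

lemma simple_uniform_approximation:
  fixes b :: "'a::topological_space \<Rightarrow> complex"
  assumes b[measurable]: "b \<in> borel_measurable borel" and bd: "\<And>s. cmod (b s) \<le> K" and n: "n > 0"
  shows "\<exists>F. simple_function borel F \<and> (\<forall>s. cmod (b s - F s) \<le> 2 / real n)"
proof -
  define r where "r x = real_of_int \<lfloor>real n * x\<rfloor> / real n" for x
  have r: "\<bar>x - r x\<bar> \<le> 1 / real n" for x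
  proof -
    have "\<bar>real n * x - real_of_int \<lfloor>real n * x\<rfloor>\<bar> \<le> 1" by linarith
    then have "\<bar>real n * x - real_of_int \<lfloor>real n * x\<rfloor>\<bar> / real n \<le> 1 / real n" by (intro divide_right_mono) auto
    moreover have "x - r x = (real n * x - real_of_int \<lfloor>real n * x\<rfloor>) / real n" using n by (simp add: r_def field_simps)
    ultimately show ?thesis by (simp add: abs_divide)
  qed
  define F where "F s = Complex (r (Re (b s))) (r (Im (b s)))" for s
  have "r \<in> borel_measurable borel" unfolding r_def by measurable
  then have Fm: "F \<in> borel_measurable borel" unfolding F_def Complex_eq by measurable
  have "finite (range F)"
  proof (rule finite_subset)
    let ?I = "{\<lfloor>- real n * K\<rfloor>..\<lfloor>real n * K\<rfloor>}"
    have mem: "\<lfloor>real n * x\<rfloor> \<in> ?I" if "\<bar>x\<bar> \<le> K" for x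
    proof -
      have "- K \<le> x" "x \<le> K" using that by auto
      then show ?thesis using mult_left_mono[of "-K" x "real n"] mult_left_mono[of x K "real n"]
        by (auto intro!: floor_mono)
    qed
    show "range F \<subseteq> (\<lambda>(i, j). Complex (real_of_int i / real n) (real_of_int j / real n)) ` (?I \<times> ?I)"
    proof
      fix z assume "z \<in> range F"
      then obtain s where s: "z = F s" by auto
      have "\<bar>Re (b s)\<bar> \<le> K" "\<bar>Im (b s)\<bar> \<le> K"
        using order_trans[OF abs_Re_le_cmod bd] order_trans[OF abs_Im_le_cmod bd] by auto
      then show "z \<in> (\<lambda>(i, j). Complex (real_of_int i / real n) (real_of_int j / real n)) ` (?I \<times> ?I)"
        unfolding s F_def r_def
        by (intro image_eqI[of _ _ "(\<lfloor>real n * Re (b s)\<rfloor>, \<lfloor>real n * Im (b s)\<rfloor>)"]) (auto simp only: split mem intro!: SigmaI)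
    qed
  qed simp
  then have "simple_function borel F" using Fm by (intro simple_function_borel_measurable) auto
  moreover have "cmod (b s - F s) \<le> 2 / real n" for s
  proof -
    have "cmod (b s - F s) \<le> \<bar>Re (b s) - r (Re (b s))\<bar> + \<bar>Im (b s) - r (Im (b s))\<bar>"
      using cmod_le[of "b s - F s"] by (simp add: F_def)
    also have "\<dots> \<le> 1 / real n + 1 / real n" by (intro add_mono r)
    finally show ?thesis by simp
  qed
  ultimately show ?thesis by blast
qed

lemma weak_integral_L1_finite:
  assumes \<nu>: "vector_measure \<nu>" and w: "w \<in> L1_weak \<nu>"
  shows "weak_integral \<nu> (\<lambda>s. ennreal (cmod (w s))) < \<infinity>"
proof (rule weak_integral_finite[OF \<nu>])
  have [measurable]: "w \<in> borel_measurable borel" using w by (simp add: L1_weak_def)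
  show "(\<lambda>s. ennreal (cmod (w s))) \<in> borel_measurable borel" by measurable
  show "(\<integral>\<^sup>+s. ennreal (cmod (w s)) \<partial>tv \<nu> x') < \<infinity>" if "x' \<in> dual" for x'
    using w that by (simp add: L1_weak_def integrable_iff_bounded)
qed

lemma integrable_bounded_mult:
  fixes w h :: "'a \<Rightarrow> complex"
  assumes w: "integrable M w" and h: "h \<in> borel_measurable M" "\<And>s. cmod (h s) \<le> L"
  shows "integrable M (\<lambda>s. h s * w s)"
proof (rule Bochner_Integration.integrable_bound[OF integrable_mult_right[OF w, of "complex_of_real L"]])
  show "(\<lambda>s. h s * w s) \<in> borel_measurable M" using h(1) borel_measurable_integrable[OF w] by measurable
  have "cmod (h s) \<le> \<bar>L\<bar>" for s using h(2)[of s] by simp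
  then show "AE s in M. norm (h s * w s) \<le> norm (complex_of_real L * w s)"
    by (auto simp: norm_mult intro!: mult_right_mono)
qed

text \<open>For simple \<open>b\<close> the integral is a combination of integrals of \<open>w\<close> over sets. For bounded
  \<open>b\<close> approximate uniformly: testing with norming functionals bounds the distance of two such
  integrals by the uniform distance of the multipliers times the finite norm of \<open>w\<close>, and \<open>X\<close> is
  complete.\<close>

lemma bounded_mult_L1_vm_integral:
  fixes \<nu> :: "'g::topological_space set \<Rightarrow> 'x::{complex_normed_vector, banach}"
  assumes \<nu>: "vector_measure \<nu>" and w: "w \<in> L1 \<nu>"
    and b: "b \<in> borel_measurable borel" and bd: "\<And>s. cmod (b s) \<le> K"
  shows "\<exists>x. is_vm_integral \<nu> UNIV (\<lambda>s. b s * w s) x"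
proof -
  have wm[measurable]: "w \<in> borel_measurable borel" and ww: "w \<in> L1_weak \<nu>" using w by (auto simp: L1_def L1_weak_def)
  have wi: "integrable (tv \<nu> x') w" if "x' \<in> dual" for x' using ww that by (simp add: L1_weak_def)
  note \<mu> = vm_pairing[OF \<nu>]
  have bi: "integrable (tv \<nu> x') (\<lambda>s. h s * w s)"
    if "x' \<in> dual" "h \<in> borel_measurable borel" "\<And>s. cmod (h s) \<le> L" for x' h L
    by (rule integrable_bounded_mult[OF wi[OF that(1)] _ that(3)]) (use that(2) in \<open>simp cong: measurable_cong_sets\<close>)
  have "\<exists>x. is_vm_integral \<nu> UNIV (\<lambda>s. F s * w s) x" if F: "simple_function borel F" for F
  proof -
    note F' = simple_function_borelD[OF F]
    have "\<exists>x. is_vm_integral \<nu> (F -` {y}) w x" for y using w F'(2)[of y] by (auto simp: L1_def)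
    then obtain X where X: "\<And>y. is_vm_integral \<nu> (F -` {y}) w (X y)" by metis
    have "is_vm_integral \<nu> UNIV (\<lambda>s. F s * w s) (\<Sum>y\<in>range F. y *\<^sub>C X y)"
      unfolding is_vm_integral_def
    proof
      fix x' :: "'x \<Rightarrow> complex" assume x': "x' \<in> dual"
      have "F s * w s = (\<Sum>y\<in>range F. y * (indicator (F -` {y}) s * w s))" for s
        by (subst simple_representation[OF F'(1)]) (simp add: sum_distrib_right mult.assoc)
      then have "cint (pairing \<nu> x') (\<lambda>s. F s * w s)
          = cint (pairing \<nu> x') (\<lambda>s. \<Sum>y\<in>range F. y * (indicator (F -` {y}) s * w s))" by presburger
      also have "\<dots> = (\<Sum>y\<in>range F. cint (pairing \<nu> x') (\<lambda>s. y * (indicator (F -` {y}) s * w s)))"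
      proof (intro cint_sum[OF \<mu>[OF x']] integrable_mult_right bi[OF x', where L = 1])
        fix y
        show "indicator (F -` {y}) \<in> borel_measurable borel" using F'(2) by (rule borel_measurable_indicator)
        show "cmod (indicator (F -` {y}) s) \<le> 1" for s by (simp add: indicator_def)
      qed
      also have "\<dots> = (\<Sum>y\<in>range F. y * x' (X y))"
      proof (rule sum.cong[OF refl])
        fix y
        have "x' (X y) = complex_measure_integral (pairing \<nu> x') (F -` {y}) w" using X x' by (simp add: is_vm_integral_def)
        also have "\<dots> = cint (pairing \<nu> x') (\<lambda>s. indicator (F -` {y}) s * w s)"
          unfolding cint_set[of _ "F -` {y}"]
          by (rule arg_cong[where f = "complex_measure_integral _ _"]) (auto simp: indicator_def)
        finally show "cint (pairing \<nu> x') (\<lambda>s. y * (indicator (F -` {y}) s * w s)) = y * x' (X y)"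
          by (simp add: cint_mult)
      qed
      finally show "x' (\<Sum>y\<in>range F. y *\<^sub>C X y) = cint (pairing \<nu> x') (\<lambda>s. F s * w s)"
        using x' by (simp add: dual_sum dual_scaleC)
    qed
    then show ?thesis by blast
  qed
  note simple = this
  have "\<exists>F. simple_function borel F \<and> (\<forall>s. cmod (b s - F s) \<le> 2 / real (Suc n))" for n
    by (rule simple_uniform_approximation[OF b bd]) simp
  then obtain F where F: "\<And>n. simple_function borel (F n)" "\<And>n s. cmod (b s - F n s) \<le> 2 / real (Suc n)" by metis
  have Fm: "F n \<in> borel_measurable borel" for n by (rule borel_measurable_simple_function[OF F(1)])
  obtain X where X: "\<And>n. is_vm_integral \<nu> UNIV (\<lambda>s. F n s * w s) (X n)" using simple[OF F(1)] by metis
  define C where "C x' = (LINT s|tv \<nu> x'. cmod (w s))" for x'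
  have diff: "cmod (cint (pairing \<nu> x') (\<lambda>s. h s * w s) - cint (pairing \<nu> x') (\<lambda>s. k s * w s)) \<le> e * C x'"
    if x': "x' \<in> dual" and hm: "h \<in> borel_measurable borel" "\<And>s. cmod (h s) \<le> L" and km: "k \<in> borel_measurable borel" "\<And>s. cmod (k s) \<le> L'"
      and e: "\<And>s. cmod (h s - k s) \<le> e" for x' h k L L' e
  proof -
    have i: "integrable (tv \<nu> x') (\<lambda>s. (h s - k s) * w s)"
      using hm(1) km(1) e by (intro bi[OF x', where L = e]) auto
    have "cint (pairing \<nu> x') (\<lambda>s. (h s - k s) * w s + k s * w s)
        = cint (pairing \<nu> x') (\<lambda>s. (h s - k s) * w s) + cint (pairing \<nu> x') (\<lambda>s. k s * w s)"
      by (rule cint_add[OF \<mu>[OF x'] i bi[OF x' km]])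
    then have "cint (pairing \<nu> x') (\<lambda>s. h s * w s) - cint (pairing \<nu> x') (\<lambda>s. k s * w s)
        = cint (pairing \<nu> x') (\<lambda>s. (h s - k s) * w s)" by (simp add: algebra_simps)
    also have "cmod \<dots> \<le> (LINT s|tv \<nu> x'. cmod ((h s - k s) * w s))"
      by (rule cmod_cint_le[OF \<mu>[OF x'] i])
    also have "\<dots> \<le> (LINT s|tv \<nu> x'. e * cmod (w s))"
    proof (rule integral_mono)
      show "integrable (tv \<nu> x') (\<lambda>s. cmod ((h s - k s) * w s))" using i by (rule integrable_norm)
      show "integrable (tv \<nu> x') (\<lambda>s. e * cmod (w s))"
        by (intro integrable_mult_right integrable_norm wi[OF x'])
      show "cmod ((h s - k s) * w s) \<le> e * cmod (w s)" for s unfolding norm_mult by (intro mult_right_mono e) simp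
    qed
    finally show ?thesis by (simp add: C_def)
  qed
  have FK: "cmod (F n s) \<le> K + 2" for n s
  proof -
    have "cmod (F n s) \<le> cmod (b s) + cmod (b s - F n s)" using norm_triangle_ineq4[of "b s" "b s - F n s"] by simp
    moreover have "2 / real (Suc n) \<le> 2" by (simp add: field_simps)
    ultimately show ?thesis using bd[of s] F(2)[of s n] by linarith
  qed
  define C0 where "C0 = enn2real (weak_integral \<nu> (\<lambda>s. ennreal (cmod (w s))))"
  have C0: "C x' \<le> C0" if x': "x' \<in> dual_ball" for x'
  proof -
    have "ennreal (C x') = (\<integral>\<^sup>+s. ennreal (cmod (w s)) \<partial>tv \<nu> x')"
      unfolding C_def using wi[OF dual_ball_dual[OF x']] by (intro nn_integral_eq_integral[symmetric]) auto
    also have "\<dots> \<le> weak_integral \<nu> (\<lambda>s. ennreal (cmod (w s)))" unfolding weak_integral_def by (rule SUP_upper[OF x'])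
    finally have "enn2real (ennreal (C x')) \<le> C0"
      unfolding C0_def using weak_integral_L1_finite[OF \<nu> ww] by (intro enn2real_mono) auto
    moreover have "0 \<le> C x'" by (simp add: C_def)
    ultimately show ?thesis by simp
  qed
  have C0_nn: "0 \<le> C0" by (simp add: C0_def)
  have XX: "norm (X i - X j) \<le> (2 / real (Suc i) + 2 / real (Suc j)) * C0" for i j
  proof (rule norm_le_dual_ball)
    fix x' :: "'x \<Rightarrow> complex" assume x'b: "x' \<in> dual_ball"
    note x' = dual_ball_dual[OF x'b]
    have "cmod (F i s - F j s) \<le> 2 / real (Suc i) + 2 / real (Suc j)" for s
    proof -
      have "cmod (F i s - F j s) \<le> cmod (b s - F j s) + cmod (b s - F i s)"
        using norm_triangle_ineq4[of "b s - F j s" "b s - F i s"] by simp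
      then show ?thesis using F(2)[of s i] F(2)[of s j] by linarith
    qed
    from diff[OF x' Fm FK Fm FK this]
    have "cmod (x' (X i) - x' (X j)) \<le> (2 / real (Suc i) + 2 / real (Suc j)) * C x'"
      using X x' by (simp add: is_vm_integral_def)
    also have "\<dots> \<le> (2 / real (Suc i) + 2 / real (Suc j)) * C0" by (intro mult_left_mono C0[OF x'b]) auto
    finally show "cmod (x' (X i - X j)) \<le> (2 / real (Suc i) + 2 / real (Suc j)) * C0"
      by (simp add: linear_diff[OF bounded_linear.linear[OF dual_bounded_linear[OF x']]])
  qed
  have lim: "(\<lambda>n. 2 / real (Suc n) * c) \<longlonglongrightarrow> 0" for c
    using tendsto_mult_left_zero[OF LIMSEQ_inverse_real_of_nat, of "2 * c"] by (simp add: field_simps)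
  have "Cauchy X"
  proof (rule metric_CauchyI)
    fix e :: real assume "e > 0"
    then obtain N where N: "\<And>n. n \<ge> N \<Longrightarrow> \<bar>2 / real (Suc n) * C0\<bar> < e / 2"
      using LIMSEQ_D[OF lim[of C0], of "e / 2"] by auto
    have "dist (X i) (X j) < e" if "i \<ge> N" "j \<ge> N" for i j
      using XX[of i j] N[OF that(1)] N[OF that(2)] unfolding dist_norm distrib_right by linarith
    then show "\<exists>N. \<forall>i\<ge>N. \<forall>j\<ge>N. dist (X i) (X j) < e" by blast
  qed
  then obtain x where x: "X \<longlonglongrightarrow> x" using Cauchy_convergent convergent_def by blast
  have "is_vm_integral \<nu> UNIV (\<lambda>s. b s * w s) x" unfolding is_vm_integral_def
  proof
    fix x' :: "'x \<Rightarrow> complex" assume x': "x' \<in> dual"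
    have "cmod (F n s - b s) \<le> 2 / real (Suc n)" for n s using F(2)[of s n] by (simp add: norm_minus_commute)
    from diff[OF x' Fm FK b bd this]
    have "cmod (x' (X n) - cint (pairing \<nu> x') (\<lambda>s. b s * w s)) \<le> 2 / real (Suc n) * C x'" for n
      using X x' by (simp add: is_vm_integral_def)
    then have "(\<lambda>n. x' (X n) - cint (pairing \<nu> x') (\<lambda>s. b s * w s)) \<longlonglongrightarrow> 0"
      by (rule Lim_null_comparison[OF always_eventually[OF allI] lim[of "C x'"]])
    then have "(\<lambda>n. x' (X n)) \<longlonglongrightarrow> cint (pairing \<nu> x') (\<lambda>s. b s * w s)" by (rule LIM_zero_cancel)
    moreover have "(\<lambda>n. x' (X n)) \<longlonglongrightarrow> x' x" by (rule bounded_linear.tendsto[OF dual_bounded_linear[OF x'] x])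
    ultimately show "x' x = cint (pairing \<nu> x') (\<lambda>s. b s * w s)" by (rule LIMSEQ_unique[rotated])
  qed
  then show ?thesis by blast
qed

section \<open>Convolution against an invariant vector measure\<close>

lemma AE_tv_not_in:
  assumes \<nu>: "vector_measure \<nu>" and x': "x' \<in> dual" and N: "N \<in> sets borel"
    and null: "\<And>E. E \<in> sets borel \<Longrightarrow> E \<subseteq> N \<Longrightarrow> \<nu> E = 0"
  shows "AE s in tv \<nu> x'. s \<notin> N"
proof -
  have "total_variation (pairing \<nu> x') N \<le> 0" unfolding total_variation_eq
  proof (rule variation_le)
    fix P assume "P \<subseteq> sets borel" "\<Union>P = N"
    then have "\<nu> E = 0" if "E \<in> P" for E using that by (intro null) auto
    then show "(\<Sum>E\<in>P. ennreal (cmod (x' (\<nu> E)))) \<le> 0"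
      using linear_0[OF bounded_linear.linear[OF dual_bounded_linear[OF x']]] by simp
  qed
  then show ?thesis using N emeasure_tv_measure[OF vm_pairing[OF \<nu> x'] N]
    by (intro AE_not_in) (simp add: null_sets_def)
qed

locale invariant_vector_measure = compact_haar m for m :: "'g::{topological_group_add, t2_space} measure" +
  fixes \<nu> :: "'g set \<Rightarrow> 'x::{complex_normed_vector, banach}"
  assumes ac: "\<nu> \<in> M_ac m"
    and translation_invariant: "semivariation_translation_invariant \<nu>"
    and inversion_invariant: "semivariation_inversion_invariant \<nu>"
    and nonzero: "\<nu> UNIV \<noteq> 0"
begin

lemma vector_measure: "vector_measure \<nu>" using ac by (simp add: M_ac_def)

lemmas pairing_measure = vm_pairing[OF vector_measure]

lemma AE_tv:
  assumes x': "x' \<in> dual" and ae: "AE s in m. Q s" shows "AE s in tv \<nu> x'. Q s"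
proof -
  obtain N where N: "N \<in> sets borel" "emeasure m N = 0" "{s. \<not> Q s} \<subseteq> N"
    using ae by (auto elim!: AE_E)
  have "\<nu> E = 0" if E: "E \<in> sets borel" "E \<subseteq> N" for E
  proof -
    have "emeasure m E = 0" using N E emeasure_mono[of E N m] by simp
    have "norm (\<nu> E) < \<epsilon>" if "\<epsilon> > 0" for \<epsilon>
    proof -
      obtain \<delta> where "\<delta> > 0" "\<And>A. A \<in> sets borel \<Longrightarrow> emeasure m A < ennreal \<delta> \<Longrightarrow> norm (\<nu> A) < \<epsilon>"
        using ac \<open>\<epsilon> > 0\<close> unfolding M_ac_def by blast
      then show ?thesis using E(1) \<open>emeasure m E = 0\<close> by simp
    qed
    then show ?thesis by (metis less_irrefl zero_less_norm_iff)
  qed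
  then have "AE s in tv \<nu> x'. s \<notin> N"
    by (rule AE_tv_not_in[OF vector_measure x' N(1)])
  then show ?thesis by eventually_elim (use N(3) in auto)
qed

lemma finite_tv: "x' \<in> dual \<Longrightarrow> finite_measure (tv \<nu> x')"
  by (rule finite_measure_tv[OF pairing_measure])

text \<open>The map \<open>s \<mapsto> t - s\<close> is a right translation followed by inversion.\<close>

lemma weak_integral_diff:
  assumes u: "u \<in> borel_measurable borel"
  shows "weak_integral \<nu> (\<lambda>s. u (t - s)) = weak_integral \<nu> u"
proof -
  have u': "(\<lambda>s. u (- s)) \<in> borel_measurable borel" by (rule measurable_compose[OF measurable_uminus u])
  have "weak_integral \<nu> (\<lambda>s. u (- (s - t))) = weak_integral \<nu> (\<lambda>s. u (- s))"
    by (rule weak_integral_invariant[OF vector_measure _ measurable_add_right[of t] measurable_diff_right[of t] _ _ u'])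
      (use translation_invariant in \<open>auto simp: semivariation_translation_invariant_def\<close>)
  also have "\<dots> = weak_integral \<nu> u"
    by (rule weak_integral_invariant[OF vector_measure _ measurable_uminus measurable_uminus _ _ u])
      (use inversion_invariant in \<open>auto simp: semivariation_inversion_invariant_def\<close>)
  finally show ?thesis by simp
qed

lemma weak_integral_upper: "x' \<in> dual_ball \<Longrightarrow> (\<integral>\<^sup>+s. u s \<partial>tv \<nu> x') \<le> weak_integral \<nu> u"
  unfolding weak_integral_def by (rule SUP_upper)

text \<open>Average \<open>\<integral> u (t - s) d\<mu>(s)\<close>, which by invariance is at most the weak integral of \<open>u\<close>,
  over \<open>t\<close>. Fubini turns the average into \<open>(\<integral> u dm) \<mu>(G)\<close>, and \<open>\<mu>(G) \<ge> \<parallel>\<nu>(G)\<parallel>\<close> if \<open>x'\<close> is norming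
  for \<open>\<nu>(G)\<close>.\<close>

lemma haar_le_weak_integral:
  assumes u: "u \<in> borel_measurable borel"
  shows "ennreal (norm (\<nu> UNIV)) * (\<integral>\<^sup>+x. u x \<partial>m) \<le> weak_integral \<nu> u"
proof -
  obtain x' where x': "x' \<in> dual_ball" "norm (\<nu> UNIV) \<le> cmod (x' (\<nu> UNIV))" by (rule norming_functional)
  note x'd = dual_ball_dual[OF x'(1)]
  let ?T = "tv \<nu> x'"
  have "ennreal (norm (\<nu> UNIV)) \<le> ennreal (cmod (x' (\<nu> UNIV)))" by (rule ennreal_leI[OF x'(2)])
  also have "\<dots> \<le> emeasure ?T UNIV"
    unfolding emeasure_tv_measure[OF pairing_measure[OF x'd] UNIV_in_borel] total_variation_eq
    using vm_empty[OF pairing_measure[OF x'd]] UNIV_in_borel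
    by (intro le_variation[where \<tau> = "\<lambda>E. ennreal (cmod (x' (\<nu> E)))"]) auto
  finally have "ennreal (norm (\<nu> UNIV)) * (\<integral>\<^sup>+x. u x \<partial>m) \<le> (\<integral>\<^sup>+x. u x \<partial>m) * emeasure ?T UNIV"
    by (simp add: mult.commute mult_left_mono)
  also have "\<dots> = (\<integral>\<^sup>+t. (\<integral>\<^sup>+s. u (t - s) * 1 \<partial>?T) \<partial>m)"
    using nn_integral_difference_Fubini(1)[OF finite_tv[OF x'd] sets_tv_measure AE_tv[OF x'd] u, of "\<lambda>_. 1"] by simp
  also have "\<dots> \<le> (\<integral>\<^sup>+t. weak_integral \<nu> u \<partial>m)"
  proof (intro nn_integral_mono)
    fix t show "(\<integral>\<^sup>+s. u (t - s) * 1 \<partial>?T) \<le> weak_integral \<nu> u"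
      using weak_integral_upper[OF x'(1), of "\<lambda>s. u (t - s)"] weak_integral_diff[OF u, of t] by simp
  qed
  also have "\<dots> = weak_integral \<nu> u" by simp
  finally show ?thesis .
qed

lemma haar_integral_finite:
  assumes "u \<in> borel_measurable borel" "weak_integral \<nu> u < \<infinity>"
  shows "(\<integral>\<^sup>+x. u x \<partial>m) < \<infinity>"
proof (rule ccontr)
  assume "\<not> ?thesis"
  then have "(\<integral>\<^sup>+x. u x \<partial>m) = top" by (simp add: not_less top_unique)
  then show False using haar_le_weak_integral[OF assms(1)] assms(2) nonzero by (simp add: ennreal_mult_top top_unique)
qed

text \<open>Reduces a functional outside the dual ball to one inside it by scaling.\<close>

lemma nn_integral_tv_le:
  assumes x': "x' \<in> dual"
  obtains K :: real where "K > 0"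
    "\<forall>u\<in>borel_measurable borel. (\<integral>\<^sup>+s. u s \<partial>tv \<nu> x') \<le> ennreal K * weak_integral \<nu> u"
proof -
  define K where "K = onorm x' + 1"
  have K: "K > 0" using onorm_pos_le[OF dual_bounded_linear[OF x']] by (simp add: K_def)
  define y where "y x = complex_of_real (1 / K) * x' x" for x
  have y: "y \<in> dual_ball"
  proof (rule dual_ballI)
    have "bounded_linear y" unfolding y_def[abs_def]
      by (rule bounded_linear_compose[OF bounded_linear_mult_right dual_bounded_linear[OF x']])
    then show "y \<in> dual" using dual_scaleC[OF x'] by (simp add: dual_def y_def)
    fix x
    have "cmod (x' x) \<le> K * norm x"
      using onorm[OF dual_bounded_linear[OF x'], of x] by (simp add: K_def distrib_right add_increasing2)
    then show "cmod (y x) \<le> norm x" using K by (simp add: y_def norm_mult norm_divide divide_le_eq mult.commute)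
  qed
  have xy: "pairing \<nu> x' = (\<lambda>B. complex_of_real K * pairing \<nu> y B)" using K by (simp add: y_def)
  have tv: "tv \<nu> x' = scale_measure (ennreal K) (tv_measure (pairing \<nu> y))"
  proof (rule measure_eqI)
    fix A assume "A \<in> sets (tv \<nu> x')"
    then have A: "A \<in> sets borel" by simp
    have "total_variation (pairing \<nu> x') A = ennreal K * total_variation (pairing \<nu> y) A"
      using total_variation_mult[of "complex_of_real K" "pairing \<nu> y" A] K unfolding xy by simp
    then show "emeasure (tv \<nu> x') A = emeasure (scale_measure (ennreal K) (tv_measure (pairing \<nu> y))) A"
      by (simp add: emeasure_tv_measure[OF pairing_measure A] x' dual_ball_dual[OF y])
  qed simp
  show ?thesis
  proof (rule that[OF K], rule ballI)
    fix u :: "'g \<Rightarrow> ennreal" assume "u \<in> borel_measurable borel"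
    then have "(\<integral>\<^sup>+s. u s \<partial>tv \<nu> x') = ennreal K * (\<integral>\<^sup>+s. u s \<partial>tv_measure (pairing \<nu> y))"
      unfolding tv by (intro nn_integral_scale_measure) (simp cong: measurable_cong_sets)
    then show "(\<integral>\<^sup>+s. u s \<partial>tv \<nu> x') \<le> ennreal K * weak_integral \<nu> u"
      using weak_integral_upper[OF y] by (simp add: mult_left_mono)
  qed
qed

text \<open>Young's inequality for two measures. The constants are bounds, so that the lemma serves both for
  the dual ball with sharp constants and for a single functional outside it. Requiring \<open>D > 0\<close>
  excludes the value \<open>0 powr 0 = 0\<close> for \<open>\<rho> = 0\<close>.\<close>

lemma convolution_Lr_bound:
  assumes x': "x' \<in> dual" and [measurable]: "f \<in> borel_measurable borel" "g \<in> borel_measurable borel"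
    and \<phi>: "\<phi> \<in> borel_measurable (completion m)"
    and le: "AE t in m. ennreal (cmod (\<phi> t)) \<le> (\<integral>\<^sup>+s. ennreal (cmod (f (t - s)) * cmod (g s)) \<partial>tv \<nu> x')"
    and P: "1 \<le> P" "1 \<le> Q" and \<rho>: "\<rho> = 1 / P + 1 / Q - 1" "0 \<le> \<rho>"
    and r: "r = (if \<rho> = 0 then \<infinity> else ennreal (1 / \<rho>))"
    and nn: "0 \<le> A" "0 \<le> B" "0 < D"
    and A: "\<And>t. (\<integral>\<^sup>+s. ennreal (cmod (f (t - s)) powr P) \<partial>tv \<nu> x') \<le> ennreal A"
    and B: "(\<integral>\<^sup>+s. ennreal (cmod (g s) powr Q) \<partial>tv \<nu> x') \<le> ennreal B"
    and D: "(\<integral>\<^sup>+x. ennreal (cmod (f x) powr P) \<partial>m) \<le> ennreal D"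
  shows "scalar_Lr_norm m r \<phi> \<le> ennreal (A powr (1 / P - \<rho>) * D powr \<rho> * B powr (1 / Q))"
proof -
  let ?T = "tv \<nu> x'"
  have [measurable]: "(\<lambda>s. f (t - s)) \<in> borel_measurable borel" for t
    by (rule measurable_compose[OF measurable_diff_left]) simp
  show ?thesis
  proof (cases "A = 0 \<or> B = 0")
    case True
    have zero: "(\<integral>\<^sup>+s. ennreal (cmod (f (t - s)) * cmod (g s)) \<partial>?T) = 0" for t
    proof (subst nn_integral_0_iff_AE)
      have "(AE s in ?T. cmod (f (t - s)) powr P = 0) \<or> (AE s in ?T. cmod (g s) powr Q = 0)"
      proof -
        have *: "AE s in ?T. h s = 0" if "h \<in> borel_measurable borel" "(\<integral>\<^sup>+s. ennreal (h s) \<partial>?T) \<le> 0" "\<And>s. 0 \<le> h s" for h :: "'g \<Rightarrow> real"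
        proof -
          have "AE s in ?T. ennreal (h s) = 0"
            using that by (subst nn_integral_0_iff_AE[symmetric]) (auto cong: measurable_cong_sets)
          then show ?thesis using that(3) by (auto simp: ennreal_eq_0_iff elim!: eventually_mono intro: antisym)
        qed
        from True show ?thesis
        proof
          assume "A = 0" then show ?thesis using A[of t] by (intro disjI1 *) auto
        next
          assume "B = 0" then show ?thesis using B by (intro disjI2 *) auto
        qed
      qed
      then show "AE s in ?T. ennreal (cmod (f (t - s)) * cmod (g s)) = 0"
        by (elim disjE) (auto elim!: eventually_mono)
    qed (simp cong: measurable_cong_sets)
    have \<phi>0: "AE t in m. \<phi> t = 0" using le unfolding zero by eventually_elim (simp add: ennreal_eq_0_iff)
    have "scalar_Lr_norm m r \<phi> \<le> 0"
    proof (cases "\<rho> = 0")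
      case True
      have "AE t in m. ennreal (cmod (\<phi> t)) \<le> 0" using \<phi>0 by eventually_elim simp
      from scalar_Lr_norm_le_infinity[OF \<phi> this] show ?thesis using True r by simp
    next
      case False
      have "(\<integral>\<^sup>+t. ennreal (cmod (\<phi> t) powr (1 / \<rho>)) \<partial>m) = (\<integral>\<^sup>+t. 0 \<partial>m)"
        using \<phi>0 by (intro nn_integral_cong_AE) (auto elim!: eventually_mono)
      then show ?thesis using scalar_Lr_norm_le_finite[where \<rho> = \<rho> and \<phi> = \<phi> and M = m and C = 0] False \<rho>(2) unfolding r by simp
    qed
    then show ?thesis by simp
  next
    case False
    then have pos: "0 < A" "0 < B" using nn by auto
    show ?thesis
    proof (cases "\<rho> = 0")
      case True
      have "(\<integral>\<^sup>+s. ennreal (cmod (f (t - s)) * cmod (g s)) \<partial>?T) \<le> ennreal (1 powr \<rho> * A powr (1 / P - \<rho>) * B powr (1 / Q - \<rho>))" for t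
        by (rule young_pointwise[OF _ _ _ _ P \<rho> _ pos _ A B]) (use True in \<open>auto cong: measurable_cong_sets\<close>)
      note bound = this
      have "AE t in m. ennreal (cmod (\<phi> t)) \<le> ennreal (1 powr \<rho> * A powr (1 / P - \<rho>) * B powr (1 / Q - \<rho>))"
        using le
      proof eventually_elim
        case (elim t)
        then show ?case using bound by (rule order_trans)
      qed
      then show ?thesis using scalar_Lr_norm_le_infinity[OF \<phi>] True nn(3) unfolding r by simp
    next
      case False
      then have \<rho>0: "0 < \<rho>" using \<rho>(2) by simp
      define C where "C = (A powr (1 / P - \<rho>) * B powr (1 / Q - \<rho>)) powr (1 / \<rho>)"
      define W where "W t = (\<integral>\<^sup>+s. ennreal (cmod (f (t - s)) powr P) * ennreal (cmod (g s) powr Q) \<partial>?T)" for t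
      have W: "(\<integral>\<^sup>+t. W t \<partial>m) = (\<integral>\<^sup>+x. ennreal (cmod (f x) powr P) \<partial>m) * (\<integral>\<^sup>+s. ennreal (cmod (g s) powr Q) \<partial>?T)"
        and Wm: "W \<in> borel_measurable borel"
        unfolding W_def using nn_integral_difference_Fubini[OF finite_tv[OF x'] sets_tv_measure AE_tv[OF x'],
          of "\<lambda>x. ennreal (cmod (f x) powr P)" "\<lambda>s. ennreal (cmod (g s) powr Q)"] by auto
      have "AE t in m. ennreal (cmod (\<phi> t) powr (1 / \<rho>)) \<le> ennreal C * W t"
        using le
      proof eventually_elim
        case (elim t)
        have "ennreal (cmod (\<phi> t) powr (1 / \<rho>)) \<le> ennreal C * (\<integral>\<^sup>+s. ennreal (cmod (f (t - s)) powr P * cmod (g s) powr Q) \<partial>?T)"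
          unfolding C_def
          by (rule young_power[OF _ _ _ _ P \<rho>(1) \<rho>0 pos A B _ elim]) (auto cong: measurable_cong_sets)
        then show ?case by (simp add: W_def ennreal_mult)
      qed
      then have "(\<integral>\<^sup>+t. ennreal (cmod (\<phi> t) powr (1 / \<rho>)) \<partial>m) \<le> (\<integral>\<^sup>+t. ennreal C * W t \<partial>m)" by (rule nn_integral_mono_AE)
      also have "\<dots> = ennreal C * (\<integral>\<^sup>+t. W t \<partial>m)" using Wm by (intro nn_integral_cmult) (simp cong: measurable_cong_sets)
      also have "\<dots> \<le> ennreal C * (ennreal D * ennreal B)" unfolding W by (intro mult_left_mono mult_mono D B) auto
      also have "\<dots> = ennreal (C * (D * B))" using nn by (simp add: C_def ennreal_mult)
      finally have "scalar_Lr_norm m (ennreal (1 / \<rho>)) \<phi> \<le> ennreal ((C * (D * B)) powr \<rho>)"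
        using nn by (intro scalar_Lr_norm_le_finite[OF \<rho>0]) (auto simp: C_def)
      also have "(C * (D * B)) powr \<rho> = A powr (1 / P - \<rho>) * D powr \<rho> * (B powr (1 / Q - \<rho>) * B powr \<rho>)"
        using pos nn \<rho>0 by (simp add: C_def powr_mult powr_powr)
      also have "B powr (1 / Q - \<rho>) * B powr \<rho> = B powr (1 / Q)" by (simp flip: powr_add)
      finally show ?thesis using False by (simp add: r)
    qed
  qed
qed

lemma vconv_pairing:
  assumes conv: "AE t in m. (\<lambda>s. f (t - s) * g s) \<in> L1 \<nu>"
  shows "AE t in m. \<forall>x'\<in>dual. x' (vconv \<nu> f g t) = cint (pairing \<nu> x') (\<lambda>s. f (t - s) * g s)
    \<and> integrable (tv \<nu> x') (\<lambda>s. f (t - s) * g s)"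
  using conv
proof eventually_elim
  case (elim t)
  then have "\<exists>!x. is_vm_integral \<nu> UNIV (\<lambda>s. f (t - s) * g s) x" using UNIV_in_borel unfolding L1_def by blast
  then obtain x where "is_vm_integral \<nu> UNIV (\<lambda>s. f (t - s) * g s) x" by blast
  moreover from vm_integral_eq[OF this] have "vconv \<nu> f g t = x" by (simp add: vconv_def)
  ultimately show ?case using elim by (auto simp: is_vm_integral_def L1_def L1_weak_def)
qed

lemma vconv_pairing_le:
  assumes conv: "AE t in m. (\<lambda>s. f (t - s) * g s) \<in> L1 \<nu>" and x': "x' \<in> dual"
  shows "AE t in m. ennreal (cmod (x' (vconv \<nu> f g t)))
    \<le> (\<integral>\<^sup>+s. ennreal (cmod (f (t - s)) * cmod (g s)) \<partial>tv \<nu> x')"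
  using vconv_pairing[OF conv]
proof eventually_elim
  case (elim t)
  then have e: "x' (vconv \<nu> f g t) = cint (pairing \<nu> x') (\<lambda>s. f (t - s) * g s)"
    and i: "integrable (tv \<nu> x') (\<lambda>s. f (t - s) * g s)" using x' by auto
  have "ennreal (cmod (x' (vconv \<nu> f g t))) \<le> ennreal (LINT s|tv \<nu> x'. cmod (f (t - s) * g s))"
    unfolding e by (intro ennreal_leI cmod_cint_le pairing_measure[OF x'] i)
  also have "\<dots> = (\<integral>\<^sup>+s. ennreal (cmod (f (t - s) * g s)) \<partial>tv \<nu> x')"
    using i by (intro nn_integral_eq_integral[symmetric]) auto
  finally show ?case by (simp add: norm_mult)
qed

lemma vconv_pairing_difference:
  assumes [measurable]: "f \<in> borel_measurable borel" "g \<in> borel_measurable borel"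
    and conv: "AE t in m. (\<lambda>s. f (t - s) * g s) \<in> L1 \<nu>" and x': "x' \<in> dual"
    and f\<^sub>0: "difference_measurable f\<^sub>0" "AE x in m. f x = f\<^sub>0 x"
  shows "AE t in m. x' (vconv \<nu> f g t) = cint (pairing \<nu> x') (\<lambda>s. f\<^sub>0 (t - s) * g s)"
proof -
  have f0m[measurable]: "f\<^sub>0 \<in> borel_measurable borel" using f\<^sub>0(1) by (simp add: difference_measurable_def)
  have "cint (pairing \<nu> x') (\<lambda>s. f (t - s) * g s)
      = cint (pairing \<nu> x') (\<lambda>s. f\<^sub>0 (t - s) * g s)" for t
  proof (rule cint_cong_AE[OF pairing_measure[OF x']])
    have [measurable]: "(\<lambda>s. f (t - s)) \<in> borel_measurable borel" "(\<lambda>s. f\<^sub>0 (t - s)) \<in> borel_measurable borel"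
      by (auto intro: measurable_compose[OF measurable_diff_left])
    show "(\<lambda>s. f (t - s) * g s) \<in> borel_measurable borel" "(\<lambda>s. f\<^sub>0 (t - s) * g s) \<in> borel_measurable borel" by measurable
    show "AE s in tv \<nu> x'. f (t - s) * g s = f\<^sub>0 (t - s) * g s"
      using AE_tv[OF x' AE_diff_left[OF f\<^sub>0(2), of t]] by eventually_elim simp
  qed
  then show ?thesis using vconv_pairing[OF conv] x' by (auto elim!: eventually_mono)
qed

lemma vconv_measurable:
  assumes f: "f \<in> borel_measurable borel" and g: "g \<in> borel_measurable borel"
    and conv: "AE t in m. (\<lambda>s. f (t - s) * g s) \<in> L1 \<nu>" and x': "x' \<in> dual"
  shows "(\<lambda>t. x' (vconv \<nu> f g t)) \<in> borel_measurable (completion m)"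
proof -
  obtain f\<^sub>0 where f\<^sub>0: "difference_measurable f\<^sub>0" "AE x in m. f x = f\<^sub>0 x" by (rule difference_measurable_ex[OF f])
  have "(\<lambda>t. cint (pairing \<nu> x') (\<lambda>s. f\<^sub>0 (t - s) * g s)) \<in> borel_measurable m"
    using cint_convolution_measurable[OF pairing_measure[OF x'] f\<^sub>0(1) g] by (simp cong: measurable_cong_sets)
  then show ?thesis by (rule measurable_completion_AE[OF _ vconv_pairing_difference[OF f g conv x' f\<^sub>0]])
qed

text \<open>On the dual ball the estimate holds with \<open>A = a\<close>, \<open>B = b\<close> and \<open>D = a / \<parallel>\<nu>(G)\<parallel>\<close>, and the powers
  of \<open>a\<close> add up to \<open>1/p\<close>. Qualitative integrability for other functionals only needs finite constants.\<close>

lemma vconv_dunford: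
  assumes f[measurable]: "f \<in> borel_measurable borel" and g[measurable]: "g \<in> borel_measurable borel"
    and conv: "AE t in m. (\<lambda>s. f (t - s) * g s) \<in> L1 \<nu>"
    and P: "1 \<le> P" "1 \<le> Q" and \<rho>: "\<rho> = 1 / P + 1 / Q - 1" "0 \<le> \<rho>"
    and r: "r = (if \<rho> = 0 then \<infinity> else ennreal (1 / \<rho>))"
    and a: "weak_integral \<nu> (\<lambda>s. ennreal (cmod (f s) powr P)) = ennreal a" "0 \<le> a"
    and b: "weak_integral \<nu> (\<lambda>s. ennreal (cmod (g s) powr Q)) = ennreal b" "0 \<le> b"
  shows "dunford_integrable m r (vconv \<nu> f g)"
    and "dunford_norm m r (vconv \<nu> f g) \<le> ennreal (a powr (1 / P) * b powr (1 / Q) * norm (\<nu> UNIV) powr (- \<rho>))"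
proof -
  have fm: "(\<lambda>s. ennreal (cmod (f s) powr P)) \<in> borel_measurable borel"
    and gm: "(\<lambda>s. ennreal (cmod (g s) powr Q)) \<in> borel_measurable borel" by measurable
  have fm': "(\<lambda>s. ennreal (cmod (f (t - s)) powr P)) \<in> borel_measurable borel" for t
    by (rule measurable_compose[OF measurable_diff_left fm])
  note a' = weak_integral_diff[OF fm, unfolded a(1)]
  let ?n = "norm (\<nu> UNIV)"
  have n: "0 < ?n" using nonzero by simp
  have D: "(\<integral>\<^sup>+x. ennreal (cmod (f x) powr P) \<partial>m) \<le> ennreal (a / ?n)"
  proof -
    have "ennreal (1 / ?n) * (ennreal ?n * (\<integral>\<^sup>+x. ennreal (cmod (f x) powr P) \<partial>m)) \<le> ennreal (1 / ?n) * ennreal a"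
      using haar_le_weak_integral[OF fm] unfolding a(1) by (intro mult_left_mono) auto
    then show ?thesis using n a(2) by (simp add: mult.assoc[symmetric] ennreal_mult[symmetric])
  qed
  note bound = convolution_Lr_bound[OF _ f g vconv_measurable[OF f g conv] vconv_pairing_le[OF conv] P \<rho> r]
  show "dunford_integrable m r (vconv \<nu> f g)"
    unfolding dunford_integrable_def
  proof
    fix x' :: "'x \<Rightarrow> complex" assume x': "x' \<in> dual"
    obtain K where K: "K > 0"
      "\<forall>u\<in>borel_measurable borel. (\<integral>\<^sup>+s. u s \<partial>tv \<nu> x') \<le> ennreal K * weak_integral \<nu> u"
      by (rule nn_integral_tv_le[OF x'])
    have A: "(\<integral>\<^sup>+s. ennreal (cmod (f (t - s)) powr P) \<partial>tv \<nu> x') \<le> ennreal (K * a)" for t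
      using bspec[OF K(2) fm'[of t]] K(1) a(2) by (simp add: a' ennreal_mult)
    have B: "(\<integral>\<^sup>+s. ennreal (cmod (g s) powr Q) \<partial>tv \<nu> x') \<le> ennreal (K * b)"
      using bspec[OF K(2) gm] K(1) b by (simp add: ennreal_mult)
    have D': "(\<integral>\<^sup>+x. ennreal (cmod (f x) powr P) \<partial>m) \<le> ennreal (a / ?n + 1)"
      by (rule order_trans[OF D]) (simp add: ennreal_leI)
    have "scalar_Lr_norm m r (\<lambda>t. x' (vconv \<nu> f g t)) < \<infinity>"
      by (rule le_less_trans[OF bound[OF x' x' x' _ _ _ A B D']]) (use K(1) a(2) b(2) n in \<open>auto intro: add_nonneg_pos\<close>)
    then show "(\<lambda>t. x' (vconv \<nu> f g t)) \<in> scalar_Lr m r"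
      using vconv_measurable[OF f g conv x'] by (simp add: scalar_Lr_def)
  qed
  show "dunford_norm m r (vconv \<nu> f g) \<le> ennreal (a powr (1 / P) * b powr (1 / Q) * ?n powr (- \<rho>))"
    unfolding dunford_norm_def
  proof (rule SUP_least)
    fix x' :: "'x \<Rightarrow> complex" assume x'b: "x' \<in> dual_ball"
    note x' = dual_ball_dual[OF x'b]
    have A: "(\<integral>\<^sup>+s. ennreal (cmod (f (t - s)) powr P) \<partial>tv \<nu> x') \<le> ennreal a" for t
      using weak_integral_upper[OF x'b, of "\<lambda>s. ennreal (cmod (f (t - s)) powr P)"] by (simp add: a')
    have B: "(\<integral>\<^sup>+s. ennreal (cmod (g s) powr Q) \<partial>tv \<nu> x') \<le> ennreal b"
      using weak_integral_upper[OF x'b] by (simp add: b(1)[symmetric])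
    show "scalar_Lr_norm m r (\<lambda>t. x' (vconv \<nu> f g t)) \<le> ennreal (a powr (1 / P) * b powr (1 / Q) * ?n powr (- \<rho>))"
    proof (cases "a = 0")
      case True
      \<comment> \<open>any positive bound serves as \<open>D\<close> here, because the factor with \<open>A = 0\<close> makes the product vanish\<close>
      have D1: "(\<integral>\<^sup>+x. ennreal (cmod (f x) powr P) \<partial>m) \<le> ennreal 1" using D True by simp
      have "scalar_Lr_norm m r (\<lambda>t. x' (vconv \<nu> f g t)) \<le> ennreal (0 powr (1 / P - \<rho>) * 1 powr \<rho> * b powr (1 / Q))"
        by (rule bound[OF x' x' x' _ b(2) _ _ B D1]) (use A True in auto)
      then show ?thesis using True by simp
    next
      case False
      then have a0: "0 < a" using a(2) by simp
      have "scalar_Lr_norm m r (\<lambda>t. x' (vconv \<nu> f g t)) \<le> ennreal (a powr (1 / P - \<rho>) * (a / ?n) powr \<rho> * b powr (1 / Q))"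
        by (rule bound[OF x' x' x' a(2) b(2) _ A B D]) (use a0 n in simp)
      also have "a powr (1 / P - \<rho>) * (a / ?n) powr \<rho> * b powr (1 / Q) = (a powr (1 / P - \<rho>) * a powr \<rho>) * b powr (1 / Q) * ?n powr (- \<rho>)"
        using a0 n by (simp add: powr_divide powr_minus field_simps)
      also have "a powr (1 / P - \<rho>) * a powr \<rho> = a powr (1 / P)" by (simp flip: powr_add)
      finally show ?thesis .
    qed
  qed
qed

end

section \<open>Functions in \<open>L\<^sup>p\<close>\<close>

text \<open>The infimum that defines the norm is the limit of a sequence of admissible constants, so
  the exceptional set is a countable union of null sets.\<close>

lemma AE_le_Linf_norm:
  assumes \<nu>: "vector_measure \<nu>" and x': "x' \<in> dual"
  shows "AE s in tv \<nu> x'. ennreal (cmod (g s)) \<le> Lp_norm \<infinity> \<nu> g"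
proof -
  let ?S = "{c. vm_null \<nu> {s. c < ennreal (cmod (g s))}}"
  have "\<infinity> \<in> ?S" using vm_empty[OF \<nu>] by (auto simp: vm_null_def intro!: bexI[of _ "{}"])
  then obtain c :: "nat \<Rightarrow> ennreal" where c: "range c \<subseteq> ?S" "Inf ?S = (INF i. c i)"
    using ennreal_Inf_countable_INF[of ?S] by blast
  have "AE s in tv \<nu> x'. ennreal (cmod (g s)) \<le> c i" for i
  proof -
    have "vm_null \<nu> {s. c i < ennreal (cmod (g s))}" using c(1) by auto
    then obtain N where N: "N \<in> sets borel" "{s. c i < ennreal (cmod (g s))} \<subseteq> N"
      "\<And>E. E \<in> sets borel \<Longrightarrow> E \<subseteq> N \<Longrightarrow> \<nu> E = 0" unfolding vm_null_def by blast
    have "AE s in tv \<nu> x'. s \<notin> N" by (rule AE_tv_not_in[OF \<nu> x' N(1,3)])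
    then show ?thesis
    proof eventually_elim
      case (elim s)
      then show ?case using N(2) by (metis (mono_tags) mem_Collect_eq not_le subsetD)
    qed
  qed
  then have "AE s in tv \<nu> x'. \<forall>i. ennreal (cmod (g s)) \<le> c i" by (simp add: AE_all_countable)
  then show ?thesis
  proof eventually_elim
    case (elim s)
    then show ?case unfolding Lp_norm_def if_P[OF refl] c(2) by (intro INF_greatest) simp
  qed
qed

lemma Linf_norm_finite:
  assumes "g \<in> Linf \<nu>" shows "Lp_norm \<infinity> \<nu> g < \<infinity>"
proof -
  obtain c :: real where c: "vm_null \<nu> {s. c < cmod (g s)}" using assms by (auto simp: Linf_def)
  have "{s. ennreal c < ennreal (cmod (g s))} \<subseteq> {s. c < cmod (g s)}"     by (auto simp flip: not_le intro: ennreal_leI)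
  then have "vm_null \<nu> {s. ennreal c < ennreal (cmod (g s))}" using c unfolding vm_null_def by blast
  then have "Lp_norm \<infinity> \<nu> g \<le> ennreal c" unfolding Lp_norm_def by (simp add: Inf_lower)
  then show ?thesis by (rule le_less_trans) simp
qed

lemma Lp_finite_iff:
  "0 \<le> Q \<Longrightarrow> g \<in> Lp (ennreal Q) \<nu> \<longleftrightarrow> g \<in> borel_measurable borel \<and> (\<lambda>s. complex_of_real (cmod (g s) powr Q)) \<in> L1 \<nu>"
  "0 \<le> Q \<Longrightarrow> g \<in> Lp_weak (ennreal Q) \<nu> \<longleftrightarrow> g \<in> borel_measurable borel \<and> (\<lambda>s. complex_of_real (cmod (g s) powr Q)) \<in> L1_weak \<nu>"
  by (simp_all add: Lp_def Lp_weak_def)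

lemma Lp_weak_integral_finite:
  assumes "vector_measure \<nu>" "(\<lambda>s. complex_of_real (cmod (g s) powr Q)) \<in> L1_weak \<nu>"
  obtains b where "weak_integral \<nu> (\<lambda>s. ennreal (cmod (g s) powr Q)) = ennreal b" "0 \<le> b"
  using weak_integral_L1_finite[OF assms] by (cases "weak_integral \<nu> (\<lambda>s. ennreal (cmod (g s) powr Q))") auto

lemma Lp_norm_finite_eq:
  assumes Q: "1 \<le> Q" and b: "weak_integral \<nu> (\<lambda>s. ennreal (cmod (g s) powr Q)) = ennreal b" "0 \<le> b"
  shows "Lp_norm (ennreal Q) \<nu> g = ennreal (b powr (1 / Q))"
proof -
  have "1 / ennreal Q = ennreal (1 / Q)" using Q divide_ennreal[of 1 Q] by simp
  then show ?thesis using Q b by (simp add: Lp_norm_def L1_norm_eq ennreal_powr_def)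
qed

text \<open>For finite exponents \<open>\<bar>g\<bar> \<le> 1 + \<bar>g\<bar>\<^sup>q\<close>, and the total variation is a finite measure.\<close>

lemma Lp_weak_nn_integral_finite:
  assumes \<nu>: "vector_measure \<nu>" and q: "1 \<le> q" and g: "g \<in> Lp_weak q \<nu>" and x': "x' \<in> dual"
  shows "(\<integral>\<^sup>+s. ennreal (cmod (g s)) \<partial>tv \<nu> x') < \<infinity>"
proof -
  let ?T = "tv \<nu> x'"
  interpret finite_measure ?T by (rule finite_measure_tv[OF vm_pairing[OF \<nu> x']])
  show ?thesis
  proof (cases q)
    case top
    then have c: "Lp_norm \<infinity> \<nu> g < \<infinity>" using g by (intro Linf_norm_finite) (simp add: Lp_weak_def)
    have "(\<integral>\<^sup>+s. ennreal (cmod (g s)) \<partial>?T) \<le> (\<integral>\<^sup>+s. Lp_norm \<infinity> \<nu> g \<partial>?T)"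
      using AE_le_Linf_norm[OF \<nu> x'] by (rule nn_integral_mono_AE)
    also have "\<dots> < \<infinity>" using c emeasure_finite[of UNIV] by (simp add: ennreal_mult_eq_top_iff less_top[symmetric])
    finally show ?thesis .
  next
    case (real Q)
    then have Q: "1 \<le> Q" using q by simp
    have gm[measurable]: "g \<in> borel_measurable borel" and gi: "integrable ?T (\<lambda>s. complex_of_real (cmod (g s) powr Q))"
      using g x' Q unfolding real by (auto simp: Lp_finite_iff L1_weak_def)
    have "(\<integral>\<^sup>+s. ennreal (cmod (g s)) \<partial>?T) \<le> (\<integral>\<^sup>+s. 1 + ennreal (cmod (g s) powr Q) \<partial>?T)"
    proof (rule nn_integral_mono)
      fix s
      have "cmod (g s) \<le> 1 + cmod (g s) powr Q"
      proof (cases "cmod (g s) \<le> 1")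
        case True then show ?thesis using powr_ge_zero[of "cmod (g s)" Q] by linarith
      next
        case False then show ?thesis using powr_mono[of 1 Q "cmod (g s)"] Q by simp
      qed
      then show "ennreal (cmod (g s)) \<le> 1 + ennreal (cmod (g s) powr Q)"
        by (metis ennreal_1 ennreal_leI ennreal_plus powr_ge_zero zero_le_one)
    qed
    also have "\<dots> = emeasure ?T UNIV + (\<integral>\<^sup>+s. ennreal (cmod (g s) powr Q) \<partial>?T)"
      by (subst nn_integral_add) (auto cong: measurable_cong_sets)
    also have "\<dots> < \<infinity>" using gi by (simp add: integrable_iff_bounded less_top[symmetric])
    finally show ?thesis .
  qed
qed

lemma is_vm_integral_add:
  assumes \<nu>: "vector_measure \<nu>"
    and u: "is_vm_integral \<nu> UNIV u x" "\<And>x'. x' \<in> dual \<Longrightarrow> integrable (tv \<nu> x') u"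
    and v: "is_vm_integral \<nu> UNIV v y" "\<And>x'. x' \<in> dual \<Longrightarrow> integrable (tv \<nu> x') v"
  shows "is_vm_integral \<nu> UNIV (\<lambda>s. u s + v s) (x + y)"
  using u v cint_add[OF vm_pairing[OF \<nu>]]
  by (simp add: is_vm_integral_def linear_add[OF bounded_linear.linear[OF dual_bounded_linear]])

text \<open>The function \<open>g k\<close> is reduced to bounded multiples of \<open>1\<close> and of \<open>\<bar>g\<bar>\<^sup>q\<close>, both in
  \<open>L\<^sup>1(\<nu>)\<close>.\<close>

lemma bounded_mult_Lp_vm_integral:
  fixes \<nu> :: "'g::topological_space set \<Rightarrow> 'x::{complex_normed_vector, banach}"
  assumes \<nu>: "vector_measure \<nu>" and q: "1 \<le> q" and g: "g \<in> Lp q \<nu>"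
    and k[measurable]: "k \<in> borel_measurable borel" and bd: "\<And>s. cmod (k s) \<le> K"
  shows "\<exists>x. is_vm_integral \<nu> UNIV (\<lambda>s. g s * k s) x"
proof (cases q)
  case top
  then have gL: "g \<in> Linf \<nu>" using g by (simp add: Lp_def)
  then have gm[measurable]: "g \<in> borel_measurable borel" by (simp add: Linf_def)
  obtain c where c: "Lp_norm \<infinity> \<nu> g = ennreal c" "0 \<le> c"
    using Linf_norm_finite[OF gL] by (cases "Lp_norm \<infinity> \<nu> g") auto
  define b where "b s = (if cmod (g s) \<le> c then g s * k s else 0)" for s
  have bm: "b \<in> borel_measurable borel" unfolding b_def by measurable
  have "cmod (b s) \<le> c * \<bar>K\<bar>" for s
    using bd[of s] c(2) by (auto simp: b_def norm_mult intro!: mult_mono)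
  from bounded_mult_L1_vm_integral[OF \<nu> const_one_in_L1[OF \<nu>] bm this]
  obtain x where x: "is_vm_integral \<nu> UNIV (\<lambda>s. b s * 1) x" by blast
  have "cint (pairing \<nu> x') (\<lambda>s. g s * k s) = cint (pairing \<nu> x') (\<lambda>s. b s * 1)"
    if x': "x' \<in> dual" for x'
  proof (rule cint_cong_AE[OF vm_pairing[OF \<nu> x']])
    show "AE s in tv \<nu> x'. g s * k s = b s * 1"
      using AE_le_Linf_norm[OF \<nu> x', of g] unfolding c(1) by eventually_elim (simp add: b_def ennreal_le_iff[OF c(2)])
  qed (use bm in simp_all)
  then show ?thesis using x by (auto simp: is_vm_integral_def)
next
  case (real Q)
  then have Q: "1 \<le> Q" using q by simp
  define W where "W s = complex_of_real (cmod (g s) powr Q)" for s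
  have gm[measurable]: "g \<in> borel_measurable borel" and W: "W \<in> L1 \<nu>"
    using g Q unfolding real W_def[abs_def] by (auto simp: Lp_finite_iff)
  \<comment> \<open>\<open>g k\<close> is a bounded multiple of \<open>\<bar>g\<bar>\<^sup>q\<close> where \<open>\<bar>g\<bar> \<ge> 1\<close>, and bounded elsewhere\<close>
  define b where "b s = (if 1 \<le> cmod (g s) then g s * k s / W s else 0)" for s
  define d where "d s = (if 1 \<le> cmod (g s) then 0 else g s * k s)" for s
  have bm: "b \<in> borel_measurable borel" and dm: "d \<in> borel_measurable borel" unfolding b_def d_def W_def by measurable
  have bb: "cmod (b s) \<le> \<bar>K\<bar>" for s
  proof (cases "1 \<le> cmod (g s)")
    case True
    have "cmod (g s) \<le> cmod (g s) powr Q" using powr_mono[OF Q True] True by simp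
    then have "cmod (g s) * cmod (k s) \<le> cmod (g s) powr Q * \<bar>K\<bar>" using bd[of s] by (intro mult_mono) auto
    then show ?thesis using True by (simp add: b_def W_def norm_mult norm_divide divide_le_eq mult.commute)
  qed (simp add: b_def)
  have db: "cmod (d s) \<le> 1 * \<bar>K\<bar>" for s
    unfolding d_def using bd[of s] mult_mono[of "cmod (g s)" 1 "cmod (k s)" "\<bar>K\<bar>"] by (auto simp: norm_mult)
  have Wi: "integrable (tv \<nu> x') W" if "x' \<in> dual" for x' using W that by (simp add: L1_def L1_weak_def)
  have 1: "integrable (tv \<nu> x') (\<lambda>s. 1 :: complex)" if "x' \<in> dual" for x'
    using const_one_in_L1[OF \<nu>] that by (simp add: L1_def L1_weak_def)
  obtain x y where x: "is_vm_integral \<nu> UNIV (\<lambda>s. b s * W s) x" and y: "is_vm_integral \<nu> UNIV (\<lambda>s. d s * 1) y"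
    using bounded_mult_L1_vm_integral[OF \<nu> W bm bb] bounded_mult_L1_vm_integral[OF \<nu> const_one_in_L1[OF \<nu>] dm db] by blast
  have "is_vm_integral \<nu> UNIV (\<lambda>s. b s * W s + d s * 1) (x + y)"
  proof (rule is_vm_integral_add[OF \<nu> x _ y])
    fix x' :: "'x \<Rightarrow> complex" assume x': "x' \<in> dual"
    show "integrable (tv \<nu> x') (\<lambda>s. b s * W s)"
      by (rule integrable_bounded_mult[OF Wi[OF x'] _ bb]) (use bm in \<open>simp cong: measurable_cong_sets\<close>)
    show "integrable (tv \<nu> x') (\<lambda>s. d s * 1)"
      by (rule integrable_bounded_mult[OF 1[OF x'] _ db]) (use dm in \<open>simp cong: measurable_cong_sets\<close>)
  qed
  moreover have "b s * W s + d s * 1 = g s * k s" for s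
  proof (cases "1 \<le> cmod (g s)")
    case True
    then have "W s \<noteq> 0" by (auto simp: W_def)
    then show ?thesis using True by (simp add: b_def d_def)
  qed (simp add: b_def d_def)
  ultimately show ?thesis by auto
qed

context invariant_vector_measure
begin

lemma vconv_dunford_infinity:
  assumes f[measurable]: "f \<in> borel_measurable borel" and g[measurable]: "g \<in> borel_measurable borel"
    and conv: "AE t in m. (\<lambda>s. f (t - s) * g s) \<in> L1 \<nu>"
    and a: "weak_integral \<nu> (\<lambda>s. ennreal (cmod (f s))) < \<infinity>" and c: "Lp_norm \<infinity> \<nu> g < \<infinity>"
  shows "dunford_integrable m \<infinity> (vconv \<nu> f g)"
    and "dunford_norm m \<infinity> (vconv \<nu> f g) \<le> weak_integral \<nu> (\<lambda>s. ennreal (cmod (f s))) * Lp_norm \<infinity> \<nu> g"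
proof -
  let ?a = "weak_integral \<nu> (\<lambda>s. ennreal (cmod (f s)))"
  have fm: "(\<lambda>s. ennreal (cmod (f s))) \<in> borel_measurable borel" by measurable
  have fm': "(\<lambda>s. ennreal (cmod (f (t - s)))) \<in> borel_measurable borel" for t
    by (rule measurable_compose[OF measurable_diff_left fm])
  have bound: "scalar_Lr_norm m \<infinity> (\<lambda>t. x' (vconv \<nu> f g t)) \<le> A * Lp_norm \<infinity> \<nu> g"
    if x': "x' \<in> dual" and A: "\<And>t. (\<integral>\<^sup>+s. ennreal (cmod (f (t - s))) \<partial>tv \<nu> x') \<le> A" for x' A
  proof (rule scalar_Lr_norm_le_infinity[OF vconv_measurable[OF f g conv x']])
    have "(\<integral>\<^sup>+s. ennreal (cmod (f (t - s)) * cmod (g s)) \<partial>tv \<nu> x') \<le> A * Lp_norm \<infinity> \<nu> g" for t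
    proof -
      have "(\<integral>\<^sup>+s. ennreal (cmod (f (t - s)) * cmod (g s)) \<partial>tv \<nu> x')
          \<le> (\<integral>\<^sup>+s. ennreal (cmod (f (t - s))) * Lp_norm \<infinity> \<nu> g \<partial>tv \<nu> x')"
      proof (rule nn_integral_mono_AE)
        show "AE s in tv \<nu> x'. ennreal (cmod (f (t - s)) * cmod (g s)) \<le> ennreal (cmod (f (t - s))) * Lp_norm \<infinity> \<nu> g"
          using AE_le_Linf_norm[OF vector_measure x', of g] by eventually_elim (simp add: ennreal_mult mult_left_mono)
      qed
      also have "\<dots> = (\<integral>\<^sup>+s. ennreal (cmod (f (t - s))) \<partial>tv \<nu> x') * Lp_norm \<infinity> \<nu> g"
        using fm' by (intro nn_integral_multc) (simp cong: measurable_cong_sets)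
      also have "\<dots> \<le> A * Lp_norm \<infinity> \<nu> g" by (intro mult_right_mono A) simp
      finally show ?thesis .
    qed
    note le = this
    show "AE t in m. ennreal (cmod (x' (vconv \<nu> f g t))) \<le> A * Lp_norm \<infinity> \<nu> g"
      using vconv_pairing_le[OF conv x']
    proof eventually_elim
      case (elim t)
      then show ?case using le by (rule order_trans)
    qed
  qed
  show "dunford_integrable m \<infinity> (vconv \<nu> f g)" unfolding dunford_integrable_def
  proof
    fix x' :: "'x \<Rightarrow> complex" assume x': "x' \<in> dual"
    obtain K where K: "K > 0"
      "\<forall>u\<in>borel_measurable borel. (\<integral>\<^sup>+s. u s \<partial>tv \<nu> x') \<le> ennreal K * weak_integral \<nu> u"
      by (rule nn_integral_tv_le[OF x'])
    have "scalar_Lr_norm m \<infinity> (\<lambda>t. x' (vconv \<nu> f g t)) \<le> ennreal K * ?a * Lp_norm \<infinity> \<nu> g"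
      using bspec[OF K(2) fm'] by (intro bound[OF x']) (simp add: weak_integral_diff[OF fm])
    also have "\<dots> < \<infinity>" using a c by (simp add: ennreal_mult_less_top)
    finally show "(\<lambda>t. x' (vconv \<nu> f g t)) \<in> scalar_Lr m \<infinity>"
      using vconv_measurable[OF f g conv x'] by (simp add: scalar_Lr_def)
  qed
  show "dunford_norm m \<infinity> (vconv \<nu> f g) \<le> ?a * Lp_norm \<infinity> \<nu> g" unfolding dunford_norm_def
  proof (rule SUP_least)
    fix x' :: "'x \<Rightarrow> complex" assume x': "x' \<in> dual_ball"
    show "scalar_Lr_norm m \<infinity> (\<lambda>t. x' (vconv \<nu> f g t)) \<le> ?a * Lp_norm \<infinity> \<nu> g"
      using weak_integral_upper[OF x', of "\<lambda>s. ennreal (cmod (f (_ - s)))"]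
      by (intro bound[OF dual_ball_dual[OF x']]) (simp add: weak_integral_diff[OF fm])
  qed
qed

text \<open>By Fubini the weak integral of the convolution over \<open>A\<close> is that of \<open>g k\<close> against \<open>\<nu>\<close>, where
  \<open>k s = \<integral>\<^sub>A f (t - s) dm(t)\<close> is bounded; \<open>mult\<close> then supplies the vector.\<close>

lemma vconv_pettis:
  assumes f: "f \<in> borel_measurable borel" and g[measurable]: "g \<in> borel_measurable borel"
    and conv: "AE t in m. (\<lambda>s. f (t - s) * g s) \<in> L1 \<nu>"
    and dunford: "dunford_integrable m r (vconv \<nu> f g)"
    and fin: "(\<integral>\<^sup>+x. ennreal (cmod (f x)) \<partial>m) < \<infinity>"
      "\<And>x'. x' \<in> dual \<Longrightarrow> (\<integral>\<^sup>+s. ennreal (cmod (g s)) \<partial>tv \<nu> x') < \<infinity>"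
    and mult: "\<And>k K. k \<in> borel_measurable borel \<Longrightarrow> (\<And>s. cmod (k s) \<le> K) \<Longrightarrow> \<exists>x. is_vm_integral \<nu> UNIV (\<lambda>s. g s * k s) x"
  shows "pettis_integrable m r (vconv \<nu> f g)"
  unfolding pettis_integrable_def
proof (intro conjI ballI dunford)
  fix A :: "'g set" assume A: "A \<in> sets borel"
  obtain f\<^sub>0 where f\<^sub>0: "difference_measurable f\<^sub>0" "AE x in m. f x = f\<^sub>0 x" by (rule difference_measurable_ex[OF f])
  have "(\<integral>\<^sup>+x. ennreal (cmod (f\<^sub>0 x)) \<partial>m) = (\<integral>\<^sup>+x. ennreal (cmod (f x)) \<partial>m)"
    using f\<^sub>0(2) by (intro nn_integral_cong_AE) (auto elim!: eventually_mono)
  then have fin0: "(\<integral>\<^sup>+x. ennreal (cmod (f\<^sub>0 x)) \<partial>m) < \<infinity>" using fin(1) by simp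
  define k where "k s = set_lebesgue_integral m A (\<lambda>t. f\<^sub>0 (t - s))" for s
  have "k \<in> borel_measurable borel" "\<And>s. cmod (k s) \<le> enn2real (\<integral>\<^sup>+x. ennreal (cmod (f\<^sub>0 x)) \<partial>m)"
    unfolding k_def using set_integral_difference_bounded[OF f\<^sub>0(1) A] fin0 by auto
  from mult[OF this] obtain x where x: "is_vm_integral \<nu> UNIV (\<lambda>s. g s * k s) x" by blast
  have eq: "set_lebesgue_integral (completion m) A (\<lambda>t. x' (vconv \<nu> f g t)) = x' x" if x': "x' \<in> dual" for x'
  proof -
    let ?H = "\<lambda>t. cint (pairing \<nu> x') (\<lambda>s. f\<^sub>0 (t - s) * g s)"
    note H = cint_convolution_measurable[OF pairing_measure[OF x'] f\<^sub>0(1) g]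
    have Hm: "(\<lambda>t. indicator A t *\<^sub>R ?H t) \<in> borel_measurable m" using H A by (simp cong: measurable_cong_sets)
    have FH: "AE t in m. x' (vconv \<nu> f g t) = ?H t"
      by (rule vconv_pairing_difference[OF f g conv x' f\<^sub>0])
    have "set_lebesgue_integral (completion m) A (\<lambda>t. x' (vconv \<nu> f g t)) = (LINT t|completion m. indicator A t *\<^sub>R ?H t)"
      unfolding set_lebesgue_integral_def
    proof (rule integral_cong_AE)
      show "(\<lambda>t. indicator A t *\<^sub>R x' (vconv \<nu> f g t)) \<in> borel_measurable (completion m)"
        using vconv_measurable[OF f g conv x'] A by (intro borel_measurable_scaleR borel_measurable_indicator) auto
      show "(\<lambda>t. indicator A t *\<^sub>R ?H t) \<in> borel_measurable (completion m)" by (rule measurable_completion[OF Hm])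
      show "AE t in completion m. indicator A t *\<^sub>R x' (vconv \<nu> f g t) = indicator A t *\<^sub>R ?H t"
        using FH by (intro AE_completion) (auto elim!: eventually_mono)
    qed
    also have "\<dots> = set_lebesgue_integral m A ?H"
      unfolding set_lebesgue_integral_def by (rule integral_completion[OF Hm])
    also have "\<dots> = cint (pairing \<nu> x') (\<lambda>s. g s * k s)"
      unfolding k_def
      by (rule cint_convolution_Fubini[OF pairing_measure[OF x'] AE_tv[OF x'] f\<^sub>0(1) g fin0 fin(2)[OF x'] A])
    also have "\<dots> = x' x" using x x' by (simp add: is_vm_integral_def)
    finally show ?thesis .
  qed
  show "\<exists>!x. \<forall>x'\<in>dual. set_lebesgue_integral (completion m) A (\<lambda>t. x' (vconv \<nu> f g t)) = x' x"
  proof (rule ex1I[of _ x])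
    show "\<forall>x'\<in>dual. set_lebesgue_integral (completion m) A (\<lambda>t. x' (vconv \<nu> f g t)) = x' x" using eq by blast
    show "y = x" if "\<forall>x'\<in>dual. set_lebesgue_integral (completion m) A (\<lambda>t. x' (vconv \<nu> f g t)) = x' y" for y
      using that eq by (intro dual_separates) metis
  qed
qed

end

section \<open>The convolution theorem\<close>

theorem proposition6p12:
  fixes m :: "'g::{topological_group_add, t2_space} measure"
    and \<nu> :: "'g set \<Rightarrow> 'x::{operator_space, banach}"
    and f g :: "'g \<Rightarrow> complex"
    and p p' q r :: ennreal
  assumes "compact (UNIV :: 'g set)"
    and "normalized_haar m"
    and "1 \<le> p" and "p < \<infinity>"
    and "1 / p + 1 / p' = 1"
    and "\<nu> \<in> M_ac m"
    and "semivariation_translation_invariant \<nu>"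
    and "semivariation_inversion_invariant \<nu>"
    and "\<nu> UNIV \<noteq> 0"
    and "f \<in> Lp p \<nu>"
    and "g \<in> Lp_weak q \<nu>"
    and "1 \<le> q" and "q \<le> p'"
    and "1 / p + 1 / q = 1 + 1 / r"
    and "AE t in m. (\<lambda>s. f (t - s) * g s) \<in> L1 \<nu>"
  shows "dunford_integrable m r (vconv \<nu> f g) \<and>
         dunford_norm m r (vconv \<nu> f g)
           \<le> Lp_norm p \<nu> f * Lp_norm q \<nu> g * ennreal (norm (\<nu> UNIV) powr (- enn2real (1 / r))) \<and>
         (g \<in> Lp q \<nu> \<longrightarrow> pettis_integrable m r (vconv \<nu> f g))"
proof -
  interpret invariant_vector_measure m \<nu>
    by unfold_locales (use assms in auto)
  note conv = assms(15)
  obtain P where p: "p = ennreal P" and P: "1 \<le> P" using assms(3,4) by (cases p) auto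
  have f: "f \<in> borel_measurable borel" and fL: "(\<lambda>s. complex_of_real (cmod (f s) powr P)) \<in> L1 \<nu>"
    using assms(10) P unfolding p by (auto simp: Lp_finite_iff)
  have fw: "(\<lambda>s. complex_of_real (cmod (f s) powr P)) \<in> L1_weak \<nu>" using fL by (simp add: L1_def)
  have g: "g \<in> borel_measurable borel"
    using assms(11) by (auto simp: Lp_weak_def Linf_def split: if_splits)
  obtain a where a: "weak_integral \<nu> (\<lambda>s. ennreal (cmod (f s) powr P)) = ennreal a" "0 \<le> a"
    by (rule Lp_weak_integral_finite[OF vector_measure fw])
  have fp: "Lp_norm p \<nu> f = ennreal (a powr (1 / P))" unfolding p by (rule Lp_norm_finite_eq[OF P a])
  have P1: "1 / p = ennreal (1 / P)" unfolding p using P divide_ennreal[of 1 P] by simp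
  have n: "norm (\<nu> UNIV) > 0" using nonzero by simp
  have main: "dunford_integrable m r (vconv \<nu> f g) \<and> dunford_norm m r (vconv \<nu> f g)
           \<le> Lp_norm p \<nu> f * Lp_norm q \<nu> g * ennreal (norm (\<nu> UNIV) powr (- enn2real (1 / r)))"
  proof (cases q)
    case top
    then have "p' = \<infinity>" using assms(13) by (simp add: top_unique)
    then have "ennreal (1 / P) = 1" using assms(5) P1 by simp
    then have P': "P = 1" using P by simp
    have "1 + 1 / r = 1 + 0" using assms(14) P1 P' top by simp
    then have "1 / r = 0" by (metis ennreal_add_left_cancel ennreal_one_neq_top infinity_ennreal_def)
    then have r: "r = \<infinity>" by (simp add: ennreal_divide_eq_0_iff)
    have a1: "weak_integral \<nu> (\<lambda>s. ennreal (cmod (f s))) = ennreal a" using a(1) P' by simp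
    have "Lp_norm \<infinity> \<nu> g < \<infinity>" using assms(11) top by (intro Linf_norm_finite) (simp add: Lp_weak_def)
    from vconv_dunford_infinity[OF f g conv _ this] show ?thesis
      using n a(2) by (simp add: r top fp P' a1)
  next
    case (real Q)
    then have Q: "1 \<le> Q" using assms(12) by simp
    have gw: "(\<lambda>s. complex_of_real (cmod (g s) powr Q)) \<in> L1_weak \<nu>"
      using assms(11) Q unfolding real by (auto simp: Lp_finite_iff)
    obtain b where b: "weak_integral \<nu> (\<lambda>s. ennreal (cmod (g s) powr Q)) = ennreal b" "0 \<le> b"
      by (rule Lp_weak_integral_finite[OF vector_measure gw])
    have gq: "Lp_norm q \<nu> g = ennreal (b powr (1 / Q))" unfolding real by (rule Lp_norm_finite_eq[OF Q b])
    have Q1: "1 / q = ennreal (1 / Q)" unfolding real using Q divide_ennreal[of 1 Q] by simp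
    define \<rho> where "\<rho> = 1 / P + 1 / Q - 1"
    have sum: "ennreal (1 / P + 1 / Q) = 1 + 1 / r" using assms(14) P Q unfolding P1 Q1 by (simp add: ennreal_plus)
    have \<rho>: "0 \<le> \<rho> \<and> 1 / r = ennreal \<rho> \<and> r = (if \<rho> = 0 then \<infinity> else ennreal (1 / \<rho>))"
    proof (cases r)
      case top
      then have "ennreal (1 / P + 1 / Q) = ennreal 1" using sum by simp
      then have "1 / P + 1 / Q = 1" using P Q by (subst (asm) ennreal_inj) auto
      then show ?thesis using top by (simp add: \<rho>_def)
    next
      case r: (real R)
      have R: "R > 0"
      proof (rule ccontr)
        assume "\<not> R > 0"
        then have "1 / r = \<infinity>" using r by (simp add: ennreal_divide_zero)
        then show False using sum by simp
      qed
      have R1: "1 / r = ennreal (1 / R)" unfolding r using R divide_ennreal[of 1 R] by simp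
      then have "ennreal (1 / P + 1 / Q) = ennreal (1 + 1 / R)" using sum R by (simp add: ennreal_plus)
      then have "1 / P + 1 / Q = 1 + 1 / R" using P Q R by (subst (asm) ennreal_inj) auto
      then have "\<rho> = 1 / R" by (simp add: \<rho>_def)
      then show ?thesis using R R1 r by simp
    qed
    then have "enn2real (1 / r) = \<rho>" by (metis enn2real_ennreal)
    then show ?thesis
      using vconv_dunford[OF f g conv P Q \<rho>_def _ _ a b] \<rho> a(2) b(2) by (simp add: fp gq ennreal_mult)
  qed
  moreover have "pettis_integrable m r (vconv \<nu> f g)" if gL: "g \<in> Lp q \<nu>"
  proof (rule vconv_pettis[OF f g conv])
    show "dunford_integrable m r (vconv \<nu> f g)" using main by simp
    show "(\<integral>\<^sup>+s. ennreal (cmod (g s)) \<partial>tv \<nu> x') < \<infinity>" if "x' \<in> dual" for x'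
      by (rule Lp_weak_nn_integral_finite[OF vector_measure assms(12,11) that])
    show "\<exists>x. is_vm_integral \<nu> UNIV (\<lambda>s. g s * k s) x"
      if "k \<in> borel_measurable borel" "\<And>s. cmod (k s) \<le> K" for k K
      by (rule bounded_mult_Lp_vm_integral[OF vector_measure assms(12) gL that])
    have fm: "(\<lambda>s. ennreal (cmod (f s))) \<in> borel_measurable borel" using f by measurable
    have "f \<in> Lp_weak p \<nu>" using f fw P unfolding p by (auto simp: Lp_finite_iff)
    then have "weak_integral \<nu> (\<lambda>s. ennreal (cmod (f s))) < \<infinity>"
      by (intro weak_integral_finite[OF vector_measure fm] Lp_weak_nn_integral_finite[OF vector_measure assms(3)])
    then show "(\<integral>\<^sup>+x. ennreal (cmod (f x)) \<partial>m) < \<infinity>" by (rule haar_integral_finite[OF fm])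
  qed
  ultimately show ?thesis by blast
qed

end
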